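(* Let $\Omega\subset\mathbb R^n$ be a domain, and let $u$ be a nonconstant measurable function on $\Omega$ such that $$u\in H^s_{\rm loc}(\Omega),\qquad \int_{\Omega}\frac{|u(x)|}{1+|x|^{n+2s}}\,dx<\infty,\qquad (-\Delta^N_\Omega)^s_{\rm R}u\ge0\ \text{ in }\Omega .$$ Then, up to the choice of a representative of $u$ (i.e. after modifying $u$ on a subset of $\Omega$ of Lebesgue measure zero), $u$ is lower semicontinuous on $\Omega$, locally bounded from below on $\Omega$, and $u(x)>\inf_{\Omega}u$ for every $x\in\Omega$.
   Context: Let $n\ge1$, $s\in(0,1)$, and $C_{n,s}=\frac{s2^{2s}\Gamma(\frac n2+s)}{\pi^{n/2}\Gamma(1-s)}$. $H^s(\mathbb R^n)$ is the space of $v\in L^2(\mathbb R^n)$ with $\iint_{\mathbb R^n\times\mathbb R^n}\frac{(v(x)-v(y))^2}{|x-y|^{n+2s}}dxdy<\infty$. One writes $u\in H^s_{\rm loc}(\Omega)$ if for every $G\Subset\Omega$, $u$ coincides on $G$ with some $v\in H^s(\mathbb R^n)$. The Restricted (Regional) Neumann Laplacian is $(-\Delta^N_\Omega)^s_{\rm R}u(x)=C_{n,s}\,\mathrm{P.V.}\int_{\Omega}\frac{u(x)-u(y)}{|x-y|^{n+2s}}dy$ for regular $u$; for $u$ as in the statement it is understood as the distribution in $\Omega$ $$\langle(-\Delta^N_\Omega)^s_{\rm R}u,\varphi\rangle=\frac{C_{n,s}}2\iint_{\Omega\times\Omega}\frac{(u(x)-u(y))(\varphi(x)-\varphi(y))}{|x-y|^{n+2s}}\,dxdy,\qquad\varphi\in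 C_0^\infty(\Omega)$$ (absolutely convergent). The inequality $(-\Delta^N_\Omega)^s_{\rm R}u\ge0$ in $\Omega$ means that this quantity is $\ge0$ for every $\varphi\in C_0^\infty(\Omega)$ with $\varphi\ge0$. Conventions: $\inf_G u$ denotes the essential infimum of $u$ over $G$ (possibly $-\infty$); "nonconstant" means not almost everywhere equal to a constant; the lower semicontinuous representative takes values in $(-\infty,+\infty]$. *)

theory Defs
  imports "HOL-Probability.Essential_Supremum"
begin

text \<open>
  The dimension is \<open>n = CARD('n)\<close>, with \<open>x :: real^'n\<close>. A function on \<open>\<Omega>\<close> is a total function on
  \<open>real^'n\<close> whose values outside \<open>\<Omega>\<close> are irrelevant. On the diagonal \<open>x = y\<close>, a null set, the
  kernels below take the value \<open>0\<close> because division by zero yields zero.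
\<close>

definition frac_const :: "'n::finite itself \<Rightarrow> real \<Rightarrow> real" where
  "frac_const _ s =
     s * 2 powr (2 * s) * Gamma (real CARD('n) / 2 + s)
       / (pi powr (real CARD('n) / 2) * Gamma (1 - s))"

definition Hs :: "real \<Rightarrow> (real^'n \<Rightarrow> real) set" where
  "Hs s = {v. v \<in> borel_measurable lebesgue \<and>
      integrable lebesgue (\<lambda>x. (v x)\<^sup>2) \<and>
      integrable lebesgue (\<lambda>(x, y). (v x - v y)\<^sup>2 / norm (x - y) powr (real CARD('n) + 2 * s))}"

definition compactly_inside :: "'a::topological_space set \<Rightarrow> 'a set \<Rightarrow> bool" where
  "compactly_inside G \<Omega> \<longleftrightarrow> compact (closure G) \<and> closure G \<subseteq> \<Omega>"

definition Hs_loc :: "real \<Rightarrow> (real^'n) set \<Rightarrow> (real^'n \<Rightarrow> real) set" where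
  "Hs_loc s \<Omega> = {u. \<forall>G. compactly_inside G \<Omega> \<longrightarrow>
      (\<exists>v\<in>Hs s. AE x in lebesgue. x \<in> G \<longrightarrow> u x = v x)}"

primrec Ck :: "nat \<Rightarrow> ('a::euclidean_space \<Rightarrow> real) \<Rightarrow> bool" where
  "Ck 0 f \<longleftrightarrow> continuous_on UNIV f"
| "Ck (Suc k) f \<longleftrightarrow> (\<forall>x. f differentiable (at x)) \<and>
      (\<forall>b\<in>Basis. Ck k (\<lambda>x. frechet_derivative f (at x) b))"

text \<open>Test functions on \<open>\<Omega>\<close>, extended by zero to the whole space.\<close>

definition test_functions :: "'a::euclidean_space set \<Rightarrow> ('a \<Rightarrow> real) set" where
  "test_functions \<Omega> = {\<phi>. (\<forall>k. Ck k \<phi>) \<and> compactly_inside {x. \<phi> x \<noteq> 0} \<Omega>}"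

text \<open>
  The pairing of the distribution with \<open>\<phi>\<close>. The integral converges absolutely when \<open>u \<in> Hs_loc s \<Omega>\<close>
  and \<open>\<bar>u x\<bar> / (1 + norm x powr (n + 2 * s))\<close> is integrable on \<open>\<Omega>\<close>, so the value \<open>0\<close> that the
  library assigns to divergent integrals does not occur under these hypotheses.
\<close>

definition regional_laplacian ::
  "real \<Rightarrow> (real^'n) set \<Rightarrow> (real^'n \<Rightarrow> real) \<Rightarrow> (real^'n \<Rightarrow> real) \<Rightarrow> real" where
  "regional_laplacian s \<Omega> u \<phi> =
     frac_const TYPE('n) s / 2 *
     (LINT (x, y):(\<Omega> \<times> \<Omega>)|lebesgue.
        (u x - u y) * (\<phi> x - \<phi> y) / norm (x - y) powr (real CARD('n) + 2 * s))"

definition regional_superharmonic ::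
  "real \<Rightarrow> (real^'n) set \<Rightarrow> (real^'n \<Rightarrow> real) \<Rightarrow> bool" where
  "regional_superharmonic s \<Omega> u \<longleftrightarrow>
     (\<forall>\<phi>\<in>test_functions \<Omega>. (\<forall>x. 0 \<le> \<phi> x) \<longrightarrow> 0 \<le> regional_laplacian s \<Omega> u \<phi>)"

definition essinf_on :: "(real^'n) set \<Rightarrow> (real^'n \<Rightarrow> ereal) \<Rightarrow> ereal" where
  "essinf_on G f = - esssup (lebesgue_on G) (\<lambda>x. - f x)"

definition lsc_on :: "'a::topological_space set \<Rightarrow> ('a \<Rightarrow> ereal) \<Rightarrow> bool" where
  "lsc_on S f \<longleftrightarrow> (\<forall>x\<in>S. f x \<le> Liminf (at x within S) f)"

definition locally_bdd_below_on :: "'a::topological_space set \<Rightarrow> ('a \<Rightarrow> ereal) \<Rightarrow> bool" where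
  "locally_bdd_below_on S f \<longleftrightarrow>
     (\<forall>x\<in>S. \<exists>U c. open U \<and> x \<in> U \<and> (\<forall>y\<in>U \<inter> S. ereal c \<le> f y))"

end

theory Submission
  imports Defs "HOL-Computational_Algebra.Polynomial"
begin

text \<open>
  Write the kernel as a bounded continuous far part plus a near part supported in a small ball. On
  the near part the inequality is translation invariant, so it can be tested with
  \<open>\<psi> = \<rho> * \<phi>\<close>, where \<open>\<phi> = (b - \<rho> * u)\<^sup>+\<close> and \<open>b\<close> is a smooth barrier that tends to \<open>-\<infinity>\<close> at the boundary
  of a ball. Since the form is nonnegative on \<open>(\<phi>, \<phi>)\<close>, the function \<open>\<rho> * u\<close> may be replaced by
  \<open>max b (\<rho> * u)\<close>; if the operator applied to this maximum is negative wherever \<open>\<rho> * u < b\<close>, then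
  \<open>u \<ge> b\<close>. Negativity is a consequence of nonlocality: at a contact point the region where \<open>u\<close> lies
  above \<open>b\<close> contributes a large negative term. No Sobolev inequality or iteration is needed.

  Taking this region close to the contact point gives a lower bound \<open>u \<ge> q - \<theta> h\<close> as soon as the
  integral of \<open>(q - u)\<^sup>+\<close> is small compared with \<open>\<theta>\<close>. For large \<open>\<theta>\<close> this is local boundedness from
  below; at density points of \<open>{u \<ge> q}\<close> it shows that \<open>u\<close> is almost everywhere equal to the limit of
  its essential infima over shrinking balls, which is lower semicontinuous. Taking the region to be
  \<open>{u > m}\<close>, wherever it lies in \<open>\<Omega>\<close>, gives the strict inequality with \<open>m = inf u\<close>.
\<close>

section \<open>Smooth test functions and mollification\<close>

text \<open>The obstacle is regularity: the operator has no pointwise meaning for \<open>u\<close>,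
  while the contact argument is pointwise. The symmetric pairing converges for the full kernel, but
  reading it at a point requires the unsymmetrised form, which needs an integrable kernel. This
  fixes the order of the limits: at a fixed mollifier the truncation \<open>\<tau>\<close> is
  removed, and only then does the radius of the mollifier shrink. A contact estimate must therefore
  hold with a margin that does not depend on the mollifier. A barrier that stayed bounded would
  allow contact up to the sphere, where no estimate is uniform; the blow-up confines contact with
  the bounded function \<open>\<rho> * u\<close> to a positive depth, so that one truncation index
  serves all contact points. With \<open>h\<close> the blow-up profile and \<open>d\<close> the
  depth, the increments of the barrier cost a multiple of \<open>h * d powr (- 2 * s)\<close>, and
  the ball of radius \<open>l * d\<close> around the contact point gains the same quantity times
  \<open>l powr (- 2 * s)\<close>. The ratio \<open>l\<close> is therefore a constant that does not
  depend on the point, and the estimate closes at every depth at once.\<close>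

lemma Ck_SucD: "Ck (Suc k) f \<Longrightarrow> Ck k f"
proof (induction k arbitrary: f)
  case 0
  then show ?case
    by (auto simp: continuous_on_eq_continuous_at differentiable_imp_continuous_within)
qed auto

lemma frechet_derivative_eqI:
  "(f has_derivative f') (at x) \<Longrightarrow> frechet_derivative f (at x) = f'"
  by (metis frechet_derivative_at)

lemma Ck_const: "Ck k (\<lambda>x::'a::euclidean_space. c)"
  by (induction k arbitrary: c) (auto simp: frechet_derivative_const)

lemma Ck_add: "Ck k f \<Longrightarrow> Ck k g \<Longrightarrow> Ck k (\<lambda>x. f x + g x)"
proof (induction k arbitrary: f g)
  case (Suc k)
  have "frechet_derivative (\<lambda>x. f x + g x) (at x) =
      (\<lambda>h. frechet_derivative f (at x) h + frechet_derivative g (at x) h)" for x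
    by (intro frechet_derivative_eqI has_derivative_add)
      (use Suc.prems in \<open>auto simp: frechet_derivative_works[symmetric]\<close>)
  then show ?case
    using Suc by auto
qed (auto intro: continuous_intros)

lemma Ck_mult: "Ck k f \<Longrightarrow> Ck k g \<Longrightarrow> Ck k (\<lambda>x. f x * g x)"
proof (induction k arbitrary: f g)
  case (Suc k)
  have "frechet_derivative (\<lambda>x. f x * g x) (at x) =
      (\<lambda>h. f x * frechet_derivative g (at x) h + frechet_derivative f (at x) h * g x)" for x
    by (intro frechet_derivative_eqI has_derivative_mult)
      (use Suc.prems in \<open>auto simp: frechet_derivative_works[symmetric]\<close>)
  then show ?case
    using Suc Ck_SucD[OF Suc.prems(1)] Ck_SucD[OF Suc.prems(2)] by (auto intro!: Ck_add)
qed (auto intro: continuous_intros)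

lemma Ck_inner: "Ck k (\<lambda>x. c * (x \<bullet> b))"
proof (cases k)
  case (Suc j)
  have "((\<lambda>x. c * (x \<bullet> b)) has_derivative (\<lambda>h. c * (h \<bullet> b))) (at x)" for x :: 'a
    by (auto intro!: derivative_eq_intros)
  then have "frechet_derivative (\<lambda>x. c * (x \<bullet> b)) (at x) = (\<lambda>h. c * (h \<bullet> b))"
    and "(\<lambda>x. c * (x \<bullet> b)) differentiable (at x)" for x
    by (auto simp: frechet_derivative_eqI differentiable_def)
  then show ?thesis
    using Suc by (auto simp: Ck_const)
qed (auto intro!: continuous_intros)

text \<open>The induction runs over the whole family \<open>g\<close>, because each differentiation
  passes from \<open>g j\<close> to \<open>g (Suc j)\<close> and leaves a linear factor. Using
  \<open>x \<bullet> x\<close> instead of the norm avoids a singularity at the origin.\<close>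

lemma Ck_radial:
  fixes a :: real and g :: "nat \<Rightarrow> real \<Rightarrow> real"
  assumes "\<And>j t. (g j has_real_derivative g (Suc j) t) (at t)"
  shows "Ck k (\<lambda>x::'a::euclidean_space. g j (a - x \<bullet> x))"
proof (induction k arbitrary: j)
  case 0
  have "continuous_on UNIV (g j)" for j
    using assms DERIV_isCont continuous_at_imp_continuous_on by blast
  then have "continuous_on UNIV (g j \<circ> (\<lambda>x::'a. a - x \<bullet> x))"
    by (intro continuous_on_compose) (auto intro!: continuous_intros intro: continuous_on_subset)
  then show ?case
    by (simp add: o_def)
next
  case (Suc k)
  have D: "((\<lambda>x::'a. g j (a - x \<bullet> x)) has_derivative
      (\<lambda>h. g (Suc j) (a - x \<bullet> x) * (- 2 * (h \<bullet> x)))) (at x)" for x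
    by (rule has_derivative_eq_rhs[OF DERIV_compose_FDERIV[OF assms, where g' = "\<lambda>h. - 2 * (h \<bullet> x)"]])
      (auto intro!: derivative_eq_intros simp: inner_commute)
  have "Ck k (\<lambda>x. g (Suc j) (a - x \<bullet> x) * (- 2 * (b \<bullet> x)))" for b :: 'a
    using Ck_mult[OF Suc Ck_inner[of k "-2" b]] by (simp add: inner_commute)
  then show ?case
    using D by (auto simp: frechet_derivative_eqI[OF D] differentiable_def)
qed

text \<open>For t > 0 the j-th derivative of exp(-1/t) is P(1/t) exp(-1/t) with a polynomial P. The
  chain rule sends P to X^2 (P - P'), which is the recursion.\<close>

primrec bump_poly :: "nat \<Rightarrow> real poly" where
  "bump_poly 0 = 1"
| "bump_poly (Suc j) = monom 1 2 * (bump_poly j - pderiv (bump_poly j))"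

definition bump_fun :: "nat \<Rightarrow> real \<Rightarrow> real" where
  "bump_fun j t = (if t > 0 then poly (bump_poly j) (1 / t) * exp (- (1 / t)) else 0)"

lemma poly_times_exp_tendsto_0: "((\<lambda>x. poly p x * exp (- x)) \<longlongrightarrow> (0::real)) at_top"
proof -
  have "((\<lambda>x::real. \<Sum>i\<le>degree p. coeff p i * (x ^ i / exp x)) \<longlongrightarrow> (\<Sum>i\<le>degree p. coeff p i * 0)) at_top"
    by (intro tendsto_intros tendsto_power_div_exp_0)
  then show ?thesis
    by (simp add: poly_altdef sum_distrib_right exp_minus divide_inverse mult.assoc)
qed

lemma bump_fun_deriv: "(bump_fun j has_real_derivative bump_fun (Suc j) t) (at t)"
proof (cases t "0::real" rule: linorder_cases)
  case less
  have "((\<lambda>t. 0) has_real_derivative 0) (at t)"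
    by simp
  then have "(bump_fun j has_real_derivative 0) (at t)"
    by (rule DERIV_cong_ev[THEN iffD1, rotated -1])
      (use less in \<open>auto simp: bump_fun_def eventually_nhds intro!: exI[of _ "{..<0}"]\<close>)
  then show ?thesis
    using less by (simp add: bump_fun_def)
next
  case greater
  let ?p = "bump_poly j"
  have "((\<lambda>t. poly ?p (1 / t) * exp (- (1 / t))) has_real_derivative bump_fun (Suc j) t) (at t)"
    using greater
    by (auto intro!: derivative_eq_intros simp: bump_fun_def poly_monom field_simps power2_eq_square)
  then show ?thesis
    by (rule DERIV_cong_ev[THEN iffD1, rotated -1])
      (use greater in \<open>auto simp: bump_fun_def eventually_nhds intro!: exI[of _ "{0<..}"]\<close>)
next
  case equal
  \<comment> \<open>With x = 1/h the right difference quotient at 0 is X * P evaluated at x, times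
    exp(-x); the exponential wins. The left quotient is identically zero.\<close>
  have "((\<lambda>x. poly (monom 1 1 * bump_poly j) x * exp (- x)) \<longlongrightarrow> 0) at_top"
    by (rule poly_times_exp_tendsto_0)
  then have "((\<lambda>h. poly (monom 1 1 * bump_poly j) (inverse h) * exp (- inverse h)) \<longlongrightarrow> 0) (at_right 0)"
    by (rule filterlim_compose) (rule filterlim_inverse_at_top_right)
  moreover have "eventually (\<lambda>h. poly (monom 1 1 * bump_poly j) (inverse h) * exp (- inverse h)
      = bump_fun j h / h) (at_right 0)"
    by (auto simp: eventually_at_right_field bump_fun_def poly_monom field_simps intro!: exI[of _ 1])
  ultimately have R: "((\<lambda>h. bump_fun j h / h) \<longlongrightarrow> 0) (at_right 0)"
    by (rule Lim_transform_eventually)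
  have L: "((\<lambda>h. bump_fun j h / h) \<longlongrightarrow> 0) (at_left 0)"
    by (rule tendsto_eventually)
       (auto simp: eventually_at_left_field bump_fun_def intro!: exI[of _ "-1"])
  from R L have "((\<lambda>h. bump_fun j h / h) \<longlongrightarrow> 0) (at 0)"
    by (simp add: filterlim_split_at)
  then show ?thesis
    using equal by (simp add: has_field_derivative_iff bump_fun_def)
qed

section \<open>Smooth functions of compact support\<close>

definition smooth_cs :: "('a::euclidean_space \<Rightarrow> real) \<Rightarrow> bool" where
  "smooth_cs f \<longleftrightarrow> (\<forall>k. Ck k f) \<and> (\<exists>R. \<forall>x. norm x > R \<longrightarrow> f x = 0)"

lemma smooth_cs_continuous: "smooth_cs f \<Longrightarrow> continuous_on UNIV f"
  unfolding smooth_cs_def by (metis Ck.simps(1))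

lemma smooth_cs_bounded:
  assumes "smooth_cs f"
  obtains B where "\<And>x. \<bar>f x\<bar> \<le> B" "B \<ge> 0"
proof -
  obtain R where R: "\<And>x. norm x > R \<Longrightarrow> f x = 0"
    using assms by (auto simp: smooth_cs_def)
  have "bounded (f ` cball 0 R)"
    by (intro compact_imp_bounded compact_continuous_image continuous_on_subset[OF smooth_cs_continuous[OF assms]])
      auto
  then obtain B where "\<forall>x\<in>cball 0 R. \<bar>f x\<bar> \<le> B"
    by (auto simp: bounded_iff)
  then have "\<bar>f x\<bar> \<le> max B 0" for x
    using R[of x] by (cases "norm x > R") (force simp: not_less le_max_iff_disj)+
  then show ?thesis
    using that by (meson max.cobounded2)
qed

lemma smooth_cs_has_derivative:
  "smooth_cs f \<Longrightarrow> (f has_derivative frechet_derivative f (at x)) (at x)"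
  unfolding smooth_cs_def by (metis Ck.simps(2) frechet_derivative_works)

lemma smooth_cs_partial:
  assumes f: "smooth_cs f" and b: "b \<in> Basis"
  shows "smooth_cs (\<lambda>x. frechet_derivative f (at x) b)"
proof -
  obtain R where R: "\<And>x. norm x > R \<Longrightarrow> f x = 0"
    using f by (auto simp: smooth_cs_def)
  have "frechet_derivative f (at x) b = 0" if "norm x > R" for x
  proof -
    have "open (- cball 0 R :: 'a set)"
      by (simp add: open_Compl)
    then have "(f has_derivative (\<lambda>_. 0)) (at x)"
      using has_derivative_transform_within_open[of "\<lambda>_. 0" "\<lambda>_. 0" x UNIV "- cball 0 R" f] R that
      by (auto simp: not_le)
    then show ?thesis
      by (simp add: frechet_derivative_eqI)
  qed
  then show ?thesis
    using f b unfolding smooth_cs_def by (metis Ck.simps(2))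
qed

lemma smooth_cs_lipschitz:
  assumes f: "smooth_cs f"
  obtains L where "L \<ge> 0" "\<And>x y. \<bar>f x - f y\<bar> \<le> L * norm (x - y)"
proof -
  have "\<forall>b\<in>Basis. \<exists>B. \<forall>x. \<bar>frechet_derivative f (at x) b\<bar> \<le> B"
    using smooth_cs_bounded[OF smooth_cs_partial[OF f]] by metis
  then obtain B where B: "\<And>b x. b \<in> Basis \<Longrightarrow> \<bar>frechet_derivative f (at x) b\<bar> \<le> B b"
    by metis
  define L where "L = (\<Sum>b\<in>Basis. B b)"
  have D: "norm (frechet_derivative f (at x) h) \<le> L * norm h" for x h
  proof -
    have lin: "linear (frechet_derivative f (at x))"
      using smooth_cs_has_derivative[OF f] has_derivative_linear by blast
    have "frechet_derivative f (at x) h = frechet_derivative f (at x) (\<Sum>b\<in>Basis. (h \<bullet> b) *\<^sub>R b)"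
      by (simp add: euclidean_representation)
    also have "\<dots> = (\<Sum>b\<in>Basis. (h \<bullet> b) * frechet_derivative f (at x) b)"
      by (simp add: linear_sum[OF lin] linear_scale[OF lin])
    also have "norm \<dots> \<le> (\<Sum>b\<in>Basis. norm h * B b)"
      by (rule sum_norm_le) (auto simp: abs_mult intro!: mult_mono B Basis_le_norm)
    finally show ?thesis
      by (simp add: L_def sum_distrib_left mult.commute)
  qed
  have "norm (f x - f y) \<le> L * norm (x - y)" for x y
    by (rule differentiable_bound[of UNIV f "\<lambda>x. frechet_derivative f (at x)"])
      (auto intro: smooth_cs_has_derivative[OF f] onorm_le D)
  moreover have "L \<ge> 0"
    unfolding L_def by (intro sum_nonneg) (use B in \<open>force intro: order_trans[OF abs_ge_zero]\<close>)
  ultimately show ?thesis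
    using that by simp
qed

lemma borel_measurable_smooth_cs: "smooth_cs f \<Longrightarrow> f \<in> borel_measurable borel"
  by (intro borel_measurable_continuous_onI smooth_cs_continuous)

section \<open>Convolution with a smooth kernel\<close>

definition conv :: "('a::euclidean_space \<Rightarrow> real) \<Rightarrow> ('a \<Rightarrow> real) \<Rightarrow> 'a \<Rightarrow> real" where
  "conv \<rho> \<phi> x = (LBINT w. \<rho> (x - w) * \<phi> w)"

lemma integrable_bounded_mult:
  fixes f g :: "'a::euclidean_space \<Rightarrow> real"
  assumes "integrable M g" "f \<in> borel_measurable M" "\<And>x. \<bar>f x\<bar> \<le> B"
  shows "integrable M (\<lambda>x. f x * g x)" "integrable M (\<lambda>x. g x * f x)"
proof -
  have [measurable]: "f \<in> borel_measurable M" "g \<in> borel_measurable M"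
    using assms by auto
  show "integrable M (\<lambda>x. f x * g x)"
    using assms(3)
    by (intro Bochner_Integration.integrable_bound[OF integrable_mult_right[OF assms(1), of B]])
       (auto simp: abs_mult intro!: AE_I2 mult_mono intro: order_trans[OF _ abs_ge_self])
  then show "integrable M (\<lambda>x. g x * f x)"
    by (simp add: mult.commute)
qed

lemma conv_integrable:
  assumes "smooth_cs \<rho>" "integrable lborel \<phi>"
  shows "integrable lborel (\<lambda>w. \<rho> (x - w) * \<phi> w)"
proof -
  have [measurable]: "\<rho> \<in> borel_measurable borel"
    using assms(1) by (rule borel_measurable_smooth_cs)
  obtain B where "\<And>x. \<bar>\<rho> x\<bar> \<le> B"
    using smooth_cs_bounded[OF assms(1)] by metis
  then show ?thesis
    by (intro integrable_bounded_mult[OF assms(2)]) auto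
qed

text \<open>All derivatives fall on \<open>\<rho>\<close>, so integrability of \<open>\<phi>\<close>
  is enough. The remainder quotients of \<open>\<rho>\<close> tend to zero pointwise and are bounded
  by twice its Lipschitz constant, hence dominated convergence. Expanding the derivative over the
  basis makes its components convolutions again, so that the step can be iterated.\<close>

lemma conv_has_derivative:
  fixes \<rho> :: "'a::euclidean_space \<Rightarrow> real"
  assumes \<rho>: "smooth_cs \<rho>" and \<phi>: "integrable lborel \<phi>"
  shows "(conv \<rho> \<phi> has_derivative
      (\<lambda>h. \<Sum>b\<in>Basis. (h \<bullet> b) * conv (\<lambda>x. frechet_derivative \<rho> (at x) b) \<phi> x)) (at x)"
proof -
  let ?D = "\<lambda>x. frechet_derivative \<rho> (at x)"
  have [measurable]: "\<phi> \<in> borel_measurable borel" "\<rho> \<in> borel_measurable borel"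
    using \<phi> borel_measurable_smooth_cs[OF \<rho>] by auto
  have lin: "linear (?D x)" for x
    using smooth_cs_has_derivative[OF \<rho>] has_derivative_linear by blast
  have Dsum: "?D x h = (\<Sum>b\<in>Basis. (h \<bullet> b) * ?D x b)" for x h
    using linear_sum[OF lin, of x "\<lambda>b. (h \<bullet> b) *\<^sub>R b" Basis]
    by (simp add: euclidean_representation linear_scale[OF lin])
  have Dm[measurable]: "(\<lambda>x. ?D x h) \<in> borel_measurable borel" for h
    by (subst Dsum)
      (intro borel_measurable_sum borel_measurable_times borel_measurable_const
        borel_measurable_smooth_cs[OF smooth_cs_partial[OF \<rho>]])
  obtain L where L: "L \<ge> 0" "\<And>x y. \<bar>\<rho> x - \<rho> y\<bar> \<le> L * norm (x - y)"
    using smooth_cs_lipschitz[OF \<rho>] by metis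
  have intD: "integrable lborel (\<lambda>w. ?D (x - w) h * \<phi> w)" for h
    by (subst Dsum, subst sum_distrib_right, intro Bochner_Integration.integrable_sum)
      (simp add: mult.assoc conv_integrable[OF smooth_cs_partial[OF \<rho>] \<phi>])
  have Deq: "(\<Sum>b\<in>Basis. (h \<bullet> b) * conv (\<lambda>x. ?D x b) \<phi> x) = (LBINT w. ?D (x - w) h * \<phi> w)" for h
    by (subst Dsum, subst sum_distrib_right, subst Bochner_Integration.integral_sum)
      (simp_all add: mult.assoc conv_def conv_integrable[OF smooth_cs_partial[OF \<rho>] \<phi>])
  \<comment> \<open>The Lipschitz bound passes to the differential as a limit of difference
    quotients along \<open>h\<close>; thus increment and differential share the constant
    \<open>L\<close>.\<close>
  have Dbd: "\<bar>?D z h\<bar> \<le> L * norm h" for z h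
  proof -
    have D: "(\<rho> has_derivative ?D z) (at z)"
      by (rule smooth_cs_has_derivative[OF \<rho>])
    have "((\<lambda>t. \<rho> (z + t *\<^sub>R h)) has_derivative (\<lambda>t. ?D z (t *\<^sub>R h))) (at 0)"
      by (rule has_derivative_compose[where f = "\<lambda>t. z + t *\<^sub>R h" and g = \<rho>])
        (auto intro!: derivative_eq_intros D)
    then have "((\<lambda>t. \<rho> (z + t *\<^sub>R h)) has_real_derivative ?D z h) (at 0)"
      by (simp add: has_field_derivative_def linear_scale[OF lin] mult_commute_abs)
    then have "((\<lambda>t. \<bar>(\<rho> (z + t *\<^sub>R h) - \<rho> z) / t\<bar>) \<longlongrightarrow> \<bar>?D z h\<bar>) (at 0)"
      by (intro tendsto_rabs) (simp add: has_field_derivative_iff)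
    moreover have "\<bar>(\<rho> (z + t *\<^sub>R h) - \<rho> z) / t\<bar> \<le> L * norm h" for t
      using L(2)[of "z + t *\<^sub>R h" z] L(1) by (cases "t = 0") (auto simp: field_simps)
    ultimately show ?thesis
      by (intro tendsto_le[OF _ tendsto_const]) (auto intro!: always_eventually)
  qed
  have bl: "bounded_linear (\<lambda>h. LBINT w. ?D (x - w) h * \<phi> w)"
    by (subst Deq[symmetric]) (intro bounded_linear_sum bounded_linear_intros)
  have "((\<lambda>h. norm (conv \<rho> \<phi> (x + h) - conv \<rho> \<phi> x - (LBINT w. ?D (x - w) h * \<phi> w)) / norm h)
      \<longlongrightarrow> 0) (at 0)"
    unfolding tendsto_at_iff_sequentially comp_def
  proof (intro allI impI)
    fix X :: "nat \<Rightarrow> 'a" assume X: "\<forall>i. X i \<in> UNIV - {0}" "X \<longlonglongrightarrow> 0"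
    let ?F = "\<lambda>i w. (\<rho> (x + X i - w) - \<rho> (x - w) - ?D (x - w) (X i)) * \<phi> w / norm (X i)"
    have "(\<lambda>i. LBINT w. ?F i w) \<longlonglongrightarrow> (LINT w|(lborel::'a measure). 0)"
    proof (rule integral_dominated_convergence[where w = "\<lambda>w. 2 * L * \<bar>\<phi> w\<bar>"])
      show "integrable lborel (\<lambda>w. 2 * L * \<bar>\<phi> w\<bar>)"
        using \<phi> by auto
      show "AE w in lborel. (\<lambda>i. ?F i w) \<longlonglongrightarrow> 0"
      proof (rule AE_I2)
        fix w
        have "((\<lambda>h. norm (\<rho> (x - w + h) - \<rho> (x - w) - ?D (x - w) h) / norm h) \<longlongrightarrow> 0) (at 0)"
          using smooth_cs_has_derivative[OF \<rho>, of "x - w"] by (simp add: has_derivative_at)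
        then have "(\<lambda>i. norm (\<rho> (x - w + X i) - \<rho> (x - w) - ?D (x - w) (X i)) / norm (X i)) \<longlonglongrightarrow> 0"
          using X unfolding tendsto_at_iff_sequentially comp_def by auto
        from tendsto_mult_right[OF this, of "\<bar>\<phi> w\<bar>"]
        have "(\<lambda>i. \<bar>?F i w\<bar>) \<longlonglongrightarrow> 0"
          by (simp add: abs_mult add_diff_eq[symmetric] diff_add_eq mult.commute)
        then show "(\<lambda>i. ?F i w) \<longlonglongrightarrow> 0"
          by (rule tendsto_rabs_zero_cancel)
      qed
      show "AE w in lborel. norm (?F i w) \<le> 2 * L * \<bar>\<phi> w\<bar>" for i
      proof (rule AE_I2)
        fix w
        have "\<bar>\<rho> (x + X i - w) - \<rho> (x - w) - ?D (x - w) (X i)\<bar> \<le> 2 * L * norm (X i)"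
          using L(2)[of "x + X i - w" "x - w"] Dbd[of "x - w" "X i"] by simp
        from mult_right_mono[OF this abs_ge_zero[of "\<phi> w"]] X
        show "norm (?F i w) \<le> 2 * L * \<bar>\<phi> w\<bar>"
          by (auto simp: abs_mult divide_simps ac_simps)
      qed
    qed (auto)
    moreover have "(LBINT w. ?F i w) =
        (conv \<rho> \<phi> (x + X i) - conv \<rho> \<phi> x - (LBINT w. ?D (x - w) (X i) * \<phi> w)) / norm (X i)" for i
    proof -
      have "(LBINT w. ?F i w) =
          (LBINT w. (\<rho> (x + X i - w) - \<rho> (x - w) - ?D (x - w) (X i)) * \<phi> w) / norm (X i)"
        by (rule integral_divide_zero)
      then show ?thesis
        unfolding conv_def by (simp add: left_diff_distrib conv_integrable[OF \<rho> \<phi>] intD)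
    qed
    ultimately have "(\<lambda>i. (conv \<rho> \<phi> (x + X i) - conv \<rho> \<phi> x - (LBINT w. ?D (x - w) (X i) * \<phi> w)) / norm (X i)) \<longlonglongrightarrow> 0"
      by (simp only: integral_zero)
    from tendsto_norm[OF this]
    show "(\<lambda>i. norm (conv \<rho> \<phi> (x + X i) - conv \<rho> \<phi> x - (LBINT w. ?D (x - w) (X i) * \<phi> w)) / norm (X i)) \<longlonglongrightarrow> 0"
      by simp
  qed
  then show ?thesis
    unfolding Deq using bl by (simp add: has_derivative_at)
qed

lemma Ck_conv:
  fixes \<rho> :: "'a::euclidean_space \<Rightarrow> real"
  assumes "integrable lborel \<phi>"
  shows "smooth_cs \<rho> \<Longrightarrow> Ck k (conv \<rho> \<phi>)"
proof (induction k arbitrary: \<rho>)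
  case 0
  then show ?case
    using has_derivative_continuous[OF conv_has_derivative[OF _ assms]]
    by (auto simp: continuous_on_eq_continuous_at)
next
  case (Suc k)
  have "frechet_derivative (conv \<rho> \<phi>) (at x) b = conv (\<lambda>x. frechet_derivative \<rho> (at x) b) \<phi> x"
    if "b \<in> Basis" for b x
  proof -
    have "frechet_derivative (conv \<rho> \<phi>) (at x) b =
        (\<Sum>b'\<in>Basis. (b \<bullet> b') * conv (\<lambda>x. frechet_derivative \<rho> (at x) b') \<phi> x)"
      by (simp add: frechet_derivative_eqI[OF conv_has_derivative[OF Suc.prems assms]])
    also have "\<dots> = (\<Sum>b'\<in>Basis. (if b = b' then conv (\<lambda>x. frechet_derivative \<rho> (at x) b) \<phi> x else 0))"
      by (rule sum.cong) (auto simp: inner_Basis that)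
    finally show ?thesis
      using that by simp
  qed
  then show ?case
    using Suc.IH[OF smooth_cs_partial[OF Suc.prems]]
    by (auto intro: differentiableI[OF conv_has_derivative[OF Suc.prems assms]])
qed

text \<open>Evenness makes convolution symmetric for the integral pairing; nonnegativity and unit
  mass make it an average, hence order preserving and subject to Jensen's inequality.\<close>

definition mollifier :: "real \<Rightarrow> ('a::euclidean_space \<Rightarrow> real) \<Rightarrow> bool" where
  "mollifier \<epsilon> \<rho> \<longleftrightarrow> smooth_cs \<rho> \<and> (\<forall>x. 0 \<le> \<rho> x) \<and> (\<forall>x. \<rho> (- x) = \<rho> x) \<and>
     (\<forall>x. norm x \<ge> \<epsilon> \<longrightarrow> \<rho> x = 0) \<and> integrable lborel \<rho> \<and> (LBINT x. \<rho> x) = 1"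

lemma integrable_smooth_cs:
  assumes f: "smooth_cs f"
  shows "integrable lborel f"
proof -
  have [measurable]: "f \<in> borel_measurable borel"
    by (rule borel_measurable_smooth_cs[OF f])
  obtain R where R: "\<And>x. norm x > R \<Longrightarrow> f x = 0"
    using f by (auto simp: smooth_cs_def)
  obtain B where B: "\<And>x. \<bar>f x\<bar> \<le> B" "B \<ge> 0"
    using smooth_cs_bounded[OF f] by metis
  have "integrable lborel (\<lambda>x::'a. B * indicator (cball 0 R) x)"
    by (intro integrable_mult_right integrable_real_indicator)
       (use emeasure_bounded_finite[of "cball (0::'a) R"] in auto)
  then show ?thesis
    by (rule Bochner_Integration.integrable_bound)
       (use B R in \<open>auto simp: indicator_def not_le intro!: AE_I2\<close>)
qed

lemma mollifier_exists:
  assumes "0 < \<epsilon>"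
  shows "\<exists>\<rho>::'a::euclidean_space \<Rightarrow> real. mollifier \<epsilon> \<rho>"
proof -
  define g where "g = (\<lambda>x::'a. bump_fun 0 (\<epsilon>\<^sup>2 - x \<bullet> x))"
  have g0: "g x = 0" if "norm x \<ge> \<epsilon>" for x
    using power_mono[OF that, of 2] assms by (simp add: g_def bump_fun_def power2_norm_eq_inner)
  have gpos: "g x > 0" if "norm x < \<epsilon>" for x
    using power_strict_mono[OF that, of 2] by (simp add: g_def bump_fun_def power2_norm_eq_inner)
  have gnn: "g x \<ge> 0" for x
    using g0[of x] gpos[of x] by (cases "norm x < \<epsilon>") auto
  have g: "smooth_cs g"
    unfolding smooth_cs_def
    using Ck_radial[of bump_fun _ 0 "\<epsilon>\<^sup>2", OF bump_fun_deriv] g0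
    by (auto simp: g_def intro!: exI[of _ \<epsilon>])
  have gi: "integrable lborel g"
    by (rule integrable_smooth_cs[OF g])
  have "(LBINT x. g x) \<noteq> 0"
  proof
    assume "(LBINT x. g x) = 0"
    then have "AE x in lborel. g x = 0"
      using gi gnn by (subst (asm) integral_nonneg_eq_0_iff_AE) auto
    then have "AE x in lborel. x \<notin> ball (0::'a) \<epsilon>"
      by (rule eventually_mono) (metis gpos dist_0_norm less_irrefl mem_ball)
    then have "emeasure lborel (ball (0::'a) \<epsilon>) = 0"
      by (subst (asm) AE_iff_measurable[of "ball 0 \<epsilon>"]) auto
    moreover have "measure lborel (ball (0::'a) \<epsilon>) > 0"
      using assms by (metis content_ball_gt_0_iff measure_completion open_ball borel_open sets_lborel)
    ultimately show False
      by (simp add: measure_def)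
  qed
  then have I: "(LBINT x. g x) > 0"
    using Bochner_Integration.integral_nonneg[of lborel g] gnn by (simp add: less_le)
  define J where "J = (LBINT x. g x)"
  have "mollifier \<epsilon> (\<lambda>x. inverse J * g x)"
    unfolding mollifier_def
  proof (intro conjI allI impI)
    show "smooth_cs (\<lambda>x. inverse J * g x)"
      using g unfolding smooth_cs_def by (auto intro!: Ck_mult Ck_const)
  qed (use I gnn g0 gi in \<open>auto simp: J_def g_def\<close>)
  then show ?thesis
    by blast
qed

section \<open>Integrals of power kernels\<close>

lemma emeasure_ball_le:
  "emeasure lborel (ball (0::'a::euclidean_space) R) \<le> ennreal (measure lborel (ball (0::'a) 1) * R ^ DIM('a))"
  if "R \<ge> 0"
proof -
  have "emeasure lborel (ball (0::'a) R) = ennreal (measure lborel (ball (0::'a) R))"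
    by (intro emeasure_eq_ennreal_measure) (metis bounded_ball emeasure_bounded_finite order_less_irrefl infinity_ennreal_def)
  also have "measure lborel (ball (0::'a) R) = measure lborel (ball (0::'a) 1) * R ^ DIM('a)"
    using content_ball_conv_unit_ball[OF that, of "0::'a"] by (simp add: measure_completion)
  finally show ?thesis
    by simp
qed

text \<open>A weighted sum of indicators of concentric balls dominates \<open>f\<close>, since at
  each point a single summand is enough. Volumes of balls thereby replace integration in polar
  coordinates.\<close>

lemma nn_integral_dyadic_bound:
  fixes f :: "'a::euclidean_space \<Rightarrow> real"
  assumes R: "\<And>j::nat. 0 \<le> R j" and c: "\<And>j. 0 \<le> c j"
    and f: "\<And>z. f z \<noteq> 0 \<Longrightarrow> \<exists>j. norm z < R j \<and> f z \<le> c j"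
    and S: "summable (\<lambda>j. c j * R j ^ DIM('a))"
  shows "(\<integral>\<^sup>+z. ennreal (f z) \<partial>lborel) \<le>
     ennreal (measure lborel (ball (0::'a) 1) * (\<Sum>j. c j * R j ^ DIM('a)))"
proof -
  let ?\<omega> = "measure lborel (ball (0::'a) 1)"
  have "ennreal (f z) \<le> (\<Sum>j. ennreal (c j) * indicator (ball 0 (R j)) z)" for z
  proof (cases "f z = 0")
    case False
    then obtain j where j: "norm z < R j" "f z \<le> c j"
      using f by blast
    have "ennreal (f z) \<le> ennreal (c j) * indicator (ball 0 (R j)) z"
      using j by (simp add: ennreal_leI)
    also have "\<dots> \<le> (\<Sum>j. ennreal (c j) * indicator (ball 0 (R j)) z)"
      using sum_le_suminf[of "\<lambda>j. ennreal (c j) * indicator (ball 0 (R j)) z" "{j}"]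
      by (simp only: summableI finite.intros sum.insert sum.empty empty_iff not_False_eq_True add_0_right zero_le simp_thms)
    finally show ?thesis .
  qed simp
  then have "(\<integral>\<^sup>+z. ennreal (f z) \<partial>lborel) \<le> (\<integral>\<^sup>+z. (\<Sum>j. ennreal (c j) * indicator (ball (0::'a) (R j)) z) \<partial>lborel)"
    by (intro nn_integral_mono)
  also have "\<dots> = (\<Sum>j. ennreal (c j) * emeasure lborel (ball (0::'a) (R j)))"
    by (subst nn_integral_suminf) (auto simp: nn_integral_cmult_indicator intro!: borel_measurable_times_ennreal borel_measurable_indicator)
  also have "\<dots> \<le> (\<Sum>j. ennreal (?\<omega> * (c j * R j ^ DIM('a))))"
  proof (intro suminf_le summableI)
    show "ennreal (c j) * emeasure lborel (ball (0::'a) (R j)) \<le> ennreal (?\<omega> * (c j * R j ^ DIM('a)))" for j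
      using mult_left_mono[OF emeasure_ball_le[where 'a='a, OF R[of j]], of "ennreal (c j)"] c[of j] R[of j]
      by (simp add: ennreal_mult[symmetric] ac_simps)
  qed
  also have "\<dots> = ennreal (?\<omega> * (\<Sum>j. c j * R j ^ DIM('a)))"
    using S c R by (subst suminf_ennreal2) (auto simp: suminf_mult)
  finally show ?thesis .
qed

text \<open>The shell at radius \<open>R / 2 ^ j\<close> contributes a multiple of
  \<open>(R / 2 ^ j) powr (2 - 2 * s)\<close>: the volume cancels the dimension in the exponent, and
  \<open>s < 1\<close> makes the series geometric with ratio below one.\<close>

lemma nn_integral_norm_powr_inner:
  assumes "0 < s" "s < 1"
  shows "\<exists>C\<ge>0. \<forall>R>0. (\<integral>\<^sup>+z. ennreal (indicator (ball (0::'a::euclidean_space) R) z *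
      ((norm z)\<^sup>2 / norm z powr (real DIM('a) + 2 * s))) \<partial>lborel) \<le> ennreal (C * R powr (2 - 2 * s))"
proof -
  let ?n = "real DIM('a)"
  let ?N = "?n + 2 * s"
  let ?\<omega> = "measure lborel (ball (0::'a) 1)"
  define q :: real where "q = (1/2) powr (2 - 2 * s)"
  have q: "0 \<le> q" "q < 1"
    using assms by (auto simp: q_def powr_less_mono2[of _ "1/2" 1, simplified])
  define C where "C = ?\<omega> * (2 powr ?N * (1 / (1 - q)))"
  have "(\<integral>\<^sup>+z. ennreal (indicator (ball (0::'a) R) z * ((norm z)\<^sup>2 / norm z powr ?N)) \<partial>lborel)
      \<le> ennreal (C * R powr (2 - 2 * s))" if R: "R > 0" for R
  proof -
    define r where "r j = R * (1/2) ^ j" for j :: nat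
    have r: "r j > 0" for j
      using R by (simp add: r_def)
    \<comment> \<open>On the shell between \<open>r j / 2\<close> and \<open>r j\<close> the square
      is largest at the outer radius and the negative power at the inner one.\<close>
    define c where "c j = (r j)\<^sup>2 * (r j / 2) powr (- ?N)" for j
    have rj: "r j = R * (1/2) powr (real j)" for j
      by (simp add: r_def powr_realpow)
    have "c j * r j ^ DIM('a) = r j powr 2 * (r j powr (- ?N) * 2 powr ?N) * r j powr ?n" for j
    proof -
      have "(r j / 2) powr (- ?N) = r j powr (- ?N) * 2 powr ?N"
        using r[of j] powr_minus[of "2::real" ?N] by (simp only: powr_divide) (simp add: divide_inverse)
      then show ?thesis
        using r[of j] by (simp add: c_def powr_realpow)
    qed
    also have "\<dots> j = 2 powr ?N * r j powr (2 - 2 * s)" for j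
    proof -
      have "r j powr 2 * r j powr (- ?N) * r j powr ?n = r j powr (2 - 2 * s)"
        unfolding powr_add[symmetric] by (rule arg_cong[where f = "(powr) (r j)"]) simp
      then show ?thesis
        by (simp only: mult.assoc mult.left_commute[of _ "2 powr ?N"])
    qed
    also have "\<dots> j = 2 powr ?N * R powr (2 - 2 * s) * q ^ j" for j
    proof -
      have "((1/2::real) powr real j) powr (2 - 2 * s) = q ^ j"
        by (simp add: q_def powr_powr powr_realpow[symmetric] mult.commute)
      then show ?thesis
        using R by (simp add: rj powr_mult)
    qed
    finally have cr: "c j * r j ^ DIM('a) = 2 powr ?N * R powr (2 - 2 * s) * q ^ j" for j .
    have sm: "(\<lambda>j. c j * r j ^ DIM('a)) sums (2 powr ?N * R powr (2 - 2 * s) * (1 / (1 - q)))"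
      unfolding cr using q by (intro sums_mult geometric_sums) simp
    have "(\<integral>\<^sup>+z. ennreal (indicator (ball (0::'a) R) z * ((norm z)\<^sup>2 / norm z powr ?N)) \<partial>lborel)
        \<le> ennreal (?\<omega> * (\<Sum>j. c j * r j ^ DIM('a)))"
    proof (rule nn_integral_dyadic_bound)
      fix z :: 'a
      assume nz: "indicator (ball (0::'a) R) z * ((norm z)\<^sup>2 / norm z powr ?N) \<noteq> 0"
      then have z: "norm z < R" "norm z > 0"
        by (auto simp: indicator_def split: if_splits)
      have "\<exists>j. r j \<le> norm z"
      proof -
        obtain j where "(1/2::real) ^ j < norm z / R"
          using real_arch_pow_inv[of "norm z / R" "1/2"] z R by auto
        then show ?thesis
          using R by (intro exI[of _ j]) (simp add: r_def field_simps)
      qed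
      define j where "j = (LEAST j. r j \<le> norm z)"
      have j: "r j \<le> norm z"
        unfolding j_def by (rule LeastI_ex) fact
      have "j \<noteq> 0"
        using j z by (intro notI) (simp add: r_def)
      then obtain i where i: "j = Suc i"
        using not0_implies_Suc by blast
      have "norm z < r i"
        using not_less_Least[of i "\<lambda>j. r j \<le> norm z"] i j_def by auto
      moreover have "(norm z)\<^sup>2 / norm z powr ?N \<le> c i"
      proof -
        have "r i / 2 \<le> norm z"
          using j i by (simp add: r_def)
        then have "norm z powr (- ?N) \<le> (r i / 2) powr (- ?N)"
          using r[of i] assms by (intro powr_mono2') auto
        then show ?thesis
          unfolding c_def divide_inverse powr_minus[symmetric] using \<open>norm z < r i\<close> z
          by (intro mult_mono power_mono) auto
      qed
      ultimately show "\<exists>i. norm z < r i \<and> indicator (ball 0 R) z * ((norm z)\<^sup>2 / norm z powr ?N) \<le> c i"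
        using z by (intro exI[of _ i]) simp
    qed (use r sm in \<open>auto simp: c_def less_imp_le sums_iff\<close>)
    also have "?\<omega> * (\<Sum>j. c j * r j ^ DIM('a)) = C * R powr (2 - 2 * s)"
      unfolding sums_unique[OF sm, symmetric] C_def by simp
    finally show ?thesis .
  qed
  moreover have "C \<ge> 0"
    using q by (auto simp: C_def)
  ultimately show ?thesis
    by blast
qed

text \<open>Mirror image of the inner bound with shells that double; now \<open>s > 0\<close> keeps
  the ratio below one.\<close>

lemma nn_integral_norm_powr_outer:
  assumes "0 < s"
  shows "\<exists>C\<ge>0. \<forall>R>0. (\<integral>\<^sup>+z. ennreal (indicator (- ball (0::'a::euclidean_space) R) z /
      norm z powr (real DIM('a) + 2 * s)) \<partial>lborel) \<le> ennreal (C * R powr (- 2 * s))"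
proof -
  let ?n = "real DIM('a)"
  let ?N = "?n + 2 * s"
  let ?\<omega> = "measure lborel (ball (0::'a) 1)"
  define q :: real where "q = (1/2) powr (2 * s)"
  have q: "0 \<le> q" "q < 1"
    using assms by (auto simp: q_def powr_less_mono2[of _ "1/2" 1, simplified])
  define C where "C = ?\<omega> * (2 powr ?n * (1 / (1 - q)))"
  have "(\<integral>\<^sup>+z. ennreal (indicator (- ball (0::'a) R) z / norm z powr ?N) \<partial>lborel)
      \<le> ennreal (C * R powr (- 2 * s))" if R: "R > 0" for R
  proof -
    define r where "r j = R * 2 ^ j" for j :: nat
    have r: "r j > 0" for j
      using R by (simp add: r_def)
    define c where "c j = r j powr (- ?N)" for j
    have rj: "r j = R * 2 powr (real j)" for j
      by (simp add: r_def powr_realpow)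
    have "c j * (2 * r j) ^ DIM('a) = 2 powr ?n * (r j powr (- ?N) * r j powr ?n)" for j
      using r[of j] by (simp add: c_def power_mult_distrib powr_realpow)
    also have "\<dots> j = 2 powr ?n * r j powr (- 2 * s)" for j
      using r[of j] by (simp add: powr_add[symmetric])
    also have "\<dots> j = 2 powr ?n * R powr (- 2 * s) * q ^ j" for j
    proof -
      have "((2::real) powr real j) powr (- 2 * s) = q ^ j"
        by (simp add: q_def powr_powr powr_realpow[symmetric] mult.commute powr_divide powr_minus_divide)
      then show ?thesis
        using R by (simp add: rj powr_mult)
    qed
    finally have cr: "c j * (2 * r j) ^ DIM('a) = 2 powr ?n * R powr (- 2 * s) * q ^ j" for j .
    have sm: "(\<lambda>j. c j * (2 * r j) ^ DIM('a)) sums (2 powr ?n * R powr (- 2 * s) * (1 / (1 - q)))"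
      unfolding cr using q by (intro sums_mult geometric_sums) simp
    have "(\<integral>\<^sup>+z. ennreal (indicator (- ball (0::'a) R) z / norm z powr ?N) \<partial>lborel)
        \<le> ennreal (?\<omega> * (\<Sum>j. c j * (2 * r j) ^ DIM('a)))"
    proof (rule nn_integral_dyadic_bound)
      fix z :: 'a
      assume nz: "indicator (- ball (0::'a) R) z / norm z powr ?N \<noteq> 0"
      then have z: "norm z \<ge> R"
        by (auto simp: indicator_def split: if_splits)
      have "\<exists>j. norm z < r j"
      proof -
        obtain j where "norm z / R < 2 ^ j"
          using real_arch_pow[of 2 "norm z / R"] by auto
        then show ?thesis
          using R by (intro exI[of _ j]) (simp add: r_def field_simps)
      qed
      define j where "j = (LEAST j. norm z < r j)"
      have j: "norm z < r j"
        unfolding j_def by (rule LeastI_ex) fact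
      have "j \<noteq> 0"
        using j z by (intro notI) (simp add: r_def)
      then obtain i where i: "j = Suc i"
        using not0_implies_Suc by blast
      have "norm z \<ge> r i"
        using not_less_Least[of i "\<lambda>j. norm z < r j"] i j_def by auto
      then have "norm z powr (- ?N) \<le> c i"
        using r[of i] assms unfolding c_def by (intro powr_mono2') auto
      moreover have "norm z < 2 * r i"
        using j i by (simp add: r_def)
      ultimately show "\<exists>i. norm z < 2 * r i \<and> indicator (- ball 0 R) z / norm z powr ?N \<le> c i"
        using z powr_minus[of "norm z" ?N] by (intro exI[of _ i]) (simp add: divide_inverse)
    qed (use r sm in \<open>auto simp: c_def less_imp_le sums_iff\<close>)
    also have "?\<omega> * (\<Sum>j. c j * (2 * r j) ^ DIM('a)) = C * R powr (- 2 * s)"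
      unfolding sums_unique[OF sm, symmetric] C_def by simp
    finally show ?thesis .
  qed
  moreover have "C \<ge> 0"
    using q by (auto simp: C_def)
  ultimately show ?thesis
    by blast
qed

section \<open>The quadratic form of a translation-invariant kernel\<close>

lemma lborel_reflect:
  fixes A :: "'a::euclidean_space \<Rightarrow> real"
  assumes [measurable]: "A \<in> borel_measurable borel"
  shows "integrable lborel (\<lambda>w. A (c - w)) \<longleftrightarrow> integrable lborel A"
    and "(LBINT w. A (c - w)) = (LBINT w. A w)"
proof -
  have D: "distr lborel borel (\<lambda>w::'a. c - w) = lborel"
    by (subst (2) lborel_affine[of "-1" c]) (auto simp: density_1)
  show "integrable lborel (\<lambda>w. A (c - w)) \<longleftrightarrow> integrable lborel A"
    by (subst (2) D[symmetric], subst integrable_distr_eq) auto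
  show "(LBINT w. A (c - w)) = (LBINT w. A w)"
    by (subst (2) D[symmetric], subst integral_distr) auto
qed

lemma lborel_translate:
  fixes A :: "'a::euclidean_space \<Rightarrow> real"
  assumes [measurable]: "A \<in> borel_measurable borel"
  shows "integrable lborel (\<lambda>x. A (x + z)) \<longleftrightarrow> integrable lborel A"
    and "(LBINT x. A (x + z)) = (LBINT x. A x)"
proof -
  have D: "distr lborel borel (\<lambda>x::'a. x + z) = lborel"
    using lborel_distr_plus[of z] by (simp add: add.commute[of z, abs_def] cong: distr_cong)
  show "integrable lborel (\<lambda>x. A (x + z)) \<longleftrightarrow> integrable lborel A"
    by (subst (2) D[symmetric], subst integrable_distr_eq) auto
  show "(LBINT x. A (x + z)) = (LBINT x. A x)"
    by (subst (2) D[symmetric], subst integral_distr) auto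
qed

lemma integrable_pair_product:
  fixes f g :: "'a::euclidean_space \<Rightarrow> real"
  assumes f: "integrable lborel f" and g: "integrable lborel g"
  shows "integrable (lborel \<Otimes>\<^sub>M lborel) (\<lambda>(x, y). f x * g y)"
proof (rule lborel_pair.Fubini_integrable)
  have [measurable]: "f \<in> borel_measurable borel" "g \<in> borel_measurable borel"
    using f g by auto
  show "(\<lambda>(x, y). f x * g y) \<in> borel_measurable (lborel \<Otimes>\<^sub>M lborel)"
    by measurable
qed (use f g in \<open>auto simp: abs_mult\<close>)

lemma integrable_pair_shift:
  fixes k A :: "'a::euclidean_space \<Rightarrow> real"
  assumes k: "integrable lborel k" and A: "integrable lborel A"
  shows "integrable (lborel \<Otimes>\<^sub>M lborel) (\<lambda>(z, x). k z * A (x + z))"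
    and "integrable (lborel \<Otimes>\<^sub>M lborel) (\<lambda>(z, x). k (z - x) * A x)"
proof -
  have [measurable]: "k \<in> borel_measurable borel" "A \<in> borel_measurable borel"
    using k A by auto
  have t: "integrable lborel (\<lambda>x. A (x + z))" "(LBINT x. \<bar>A (x + z)\<bar>) = (LBINT x. \<bar>A x\<bar>)" for z
    using A lborel_translate(1)[of A z] lborel_translate(2)[of "\<lambda>x. \<bar>A x\<bar>" z] by auto
  show "integrable (lborel \<Otimes>\<^sub>M lborel) (\<lambda>(z, x). k z * A (x + z))"
    by (rule lborel_pair.Fubini_integrable) (use k t in \<open>auto simp: abs_mult\<close>)
  have t': "integrable lborel (\<lambda>x. k (x - z))" "(LBINT x. \<bar>k (x - z)\<bar>) = (LBINT x. \<bar>k x\<bar>)" for z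
    using k lborel_translate(1)[of k "-z"] lborel_translate(2)[of "\<lambda>x. \<bar>k x\<bar>" "-z"] by auto
  have "integrable (lborel \<Otimes>\<^sub>M lborel) (\<lambda>(x, z). k (z - x) * A x)"
    by (rule lborel_pair.Fubini_integrable) (use A t' in \<open>auto simp: abs_mult\<close>)
  from lborel_pair.integrable_product_swap[OF this]
  show "integrable (lborel \<Otimes>\<^sub>M lborel) (\<lambda>(z, x). k (z - x) * A x)"
    by simp
qed

text \<open>
  With the shift as the outer variable, the form commutes with mollification and is nonnegative on
  the diagonal for each shift separately, without any symmetry of the kernel.
\<close>

definition shift_form :: "('a::euclidean_space \<Rightarrow> real) \<Rightarrow> ('a \<Rightarrow> real) \<Rightarrow> ('a \<Rightarrow> real) \<Rightarrow> real" where
  "shift_form k A \<psi> = (LBINT z. k z * (LBINT x. (A x - A (x + z)) * \<psi> x))"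

lemma shift_form_integrable:
  fixes k A \<psi> :: "'a::euclidean_space \<Rightarrow> real"
  assumes k: "integrable lborel k" and A: "integrable lborel A"
    and \<psi>: "\<psi> \<in> borel_measurable borel" "\<And>x. \<bar>\<psi> x\<bar> \<le> B"
  shows "integrable (lborel \<Otimes>\<^sub>M lborel) (\<lambda>(z, x). k z * ((A x - A (x + z)) * \<psi> x))"
proof -
  have [measurable]: "k \<in> borel_measurable borel" "A \<in> borel_measurable borel" "\<psi> \<in> borel_measurable borel"
    using k A \<psi> by auto
  have "integrable (lborel \<Otimes>\<^sub>M lborel) (\<lambda>(z, x). k z * A x - k z * A (x + z))"
    using Bochner_Integration.integrable_diff[OF integrable_pair_product[OF k A] integrable_pair_shift(1)[OF k A]]
    by (simp add: split_def)
  from integrable_bounded_mult(1)[OF this, of "\<lambda>p. \<psi> (snd p)" B] \<psi>(2)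
  show ?thesis
    by (simp add: split_def algebra_simps)
qed

text \<open>With \<open>x\<close> as the outer variable the inner integral is the truncated operator
  applied to \<open>A\<close> at \<open>x\<close>, the quantity that contact-point estimates
  control.\<close>

lemma shift_form_Fubini:
  fixes k A \<psi> :: "'a::euclidean_space \<Rightarrow> real"
  assumes k: "integrable lborel k" and A: "integrable lborel A"
    and \<psi>: "\<psi> \<in> borel_measurable borel" "\<And>x. \<bar>\<psi> x\<bar> \<le> B"
  shows "shift_form k A \<psi> = (LBINT x. \<psi> x * (LBINT z. k z * (A x - A (x + z))))"
    and "integrable lborel (\<lambda>x. \<psi> x * (LBINT z. k z * (A x - A (x + z))))"
proof -
  note I = shift_form_integrable[OF assms]
  have "shift_form k A \<psi> = (LBINT z. (LBINT x. k z * ((A x - A (x + z)) * \<psi> x)))"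
    by (simp add: shift_form_def)
  also have "\<dots> = (LBINT x. (LBINT z. k z * ((A x - A (x + z)) * \<psi> x)))"
    by (rule lborel_pair.Fubini_integral[symmetric]) (rule I)
  finally show "shift_form k A \<psi> = (LBINT x. \<psi> x * (LBINT z. k z * (A x - A (x + z))))"
    by (simp add: mult.assoc[symmetric] mult.commute[of "\<psi> _"])
  show "integrable lborel (\<lambda>x. \<psi> x * (LBINT z. k z * (A x - A (x + z))))"
    using lborel_pair.integrable_snd[OF I]
    by (simp add: mult.assoc[symmetric] mult.commute[of "\<psi> _"])
qed

lemma shift_form_diff:
  fixes k A B \<psi> :: "'a::euclidean_space \<Rightarrow> real"
  assumes k: "integrable lborel k" and A: "integrable lborel A" "integrable lborel B"
    and \<psi>: "\<psi> \<in> borel_measurable borel" "\<And>x. \<bar>\<psi> x\<bar> \<le> C"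
  shows "shift_form k (\<lambda>x. A x - B x) \<psi> = shift_form k A \<psi> - shift_form k B \<psi>"
proof -
  have t: "integrable lborel (\<lambda>x. (A x - A (x + z)) * \<psi> x)" if "integrable lborel A" for A z
  proof -
    have "integrable lborel (\<lambda>x. A (x + z))"
      using that lborel_translate(1)[of A z] by auto
    then show ?thesis
      using \<psi> that by (intro integrable_bounded_mult(2)[where B = C] Bochner_Integration.integrable_diff) auto
  qed
  have k': "integrable lborel (\<lambda>z. k z * (LBINT x. (A x - A (x + z)) * \<psi> x))" if "integrable lborel A" for A
    using lborel_pair.integrable_fst[OF shift_form_integrable[OF k that \<psi>]] by simp
  have "k z * (LBINT x. (A x - B x - (A (x + z) - B (x + z))) * \<psi> x) =
    k z * (LBINT x. (A x - A (x + z)) * \<psi> x) - k z * (LBINT x. (B x - B (x + z)) * \<psi> x)" for z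
    unfolding right_diff_distrib[symmetric]
    by (subst Bochner_Integration.integral_diff[symmetric, OF t t]) (auto simp: A algebra_simps)
  then show ?thesis
    unfolding shift_form_def
    by (simp only: Bochner_Integration.integral_diff[OF k'[OF A(1)] k'[OF A(2)]])
qed

lemma integrable_bounded_square:
  fixes \<phi> :: "'a::euclidean_space \<Rightarrow> real"
  assumes "integrable M \<phi>" "\<And>x. \<bar>\<phi> x\<bar> \<le> B"
  shows "integrable M (\<lambda>x. (\<phi> x)\<^sup>2)"
  using integrable_bounded_mult(1)[OF assms(1) borel_measurable_integrable[OF assms(1)] assms(2)]
  by (simp add: power2_eq_square)

text \<open>For each shift, (a - b) a is at least (a^2 - b^2) / 2, where a and b are the values at
  \<open>x\<close> and \<open>x + z\<close>; the lower bound integrates to zero by translation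
  invariance of the measure.\<close>

lemma shift_form_nonneg:
  fixes k \<phi> :: "'a::euclidean_space \<Rightarrow> real"
  assumes k0: "\<And>z. 0 \<le> k z" and \<phi>: "integrable lborel \<phi>" "\<And>x. \<bar>\<phi> x\<bar> \<le> B"
  shows "0 \<le> shift_form k \<phi> \<phi>"
proof -
  have [measurable]: "\<phi> \<in> borel_measurable borel"
    using \<phi> by auto
  have sq: "integrable lborel (\<lambda>x. (\<phi> x)\<^sup>2)"
    by (rule integrable_bounded_square[OF \<phi>])
  have "0 \<le> (LBINT x. (\<phi> x - \<phi> (x + z)) * \<phi> x)" for z
  proof -
    have t: "integrable lborel (\<lambda>x. (\<phi> (x + z))\<^sup>2)" "(LBINT x. (\<phi> (x + z))\<^sup>2) = (LBINT x. (\<phi> x)\<^sup>2)"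
      using sq lborel_translate[of "\<lambda>x. (\<phi> x)\<^sup>2" z] by auto
    have "integrable lborel (\<lambda>x. \<phi> (x + z))"
      using \<phi> lborel_translate(1)[of \<phi> z] by auto
    then have i: "integrable lborel (\<lambda>x. (\<phi> x - \<phi> (x + z)) * \<phi> x)"
      using \<phi> by (intro integrable_bounded_mult(2)[where B = B] Bochner_Integration.integrable_diff) auto
    have "0 = (LBINT x. ((\<phi> x)\<^sup>2 - (\<phi> (x + z))\<^sup>2) / 2)"
      using t sq by simp
    also have "\<dots> \<le> (LBINT x. (\<phi> x - \<phi> (x + z)) * \<phi> x)"
    proof (rule integral_mono)
      show "((\<phi> x)\<^sup>2 - (\<phi> (x + z))\<^sup>2) / 2 \<le> (\<phi> x - \<phi> (x + z)) * \<phi> x" for x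
        using zero_le_power2[of "\<phi> x - \<phi> (x + z)"] by (simp add: power2_eq_square field_simps)
    qed (use i t sq in auto)
    finally show ?thesis .
  qed
  then show ?thesis
    unfolding shift_form_def using k0 by (intro Bochner_Integration.integral_nonneg) simp
qed

section \<open>Mollifiers as averages: duality, order and Jensen's inequality\<close>

lemma mollifierD:
  assumes "mollifier \<epsilon> \<rho>"
  shows "smooth_cs \<rho>" "0 \<le> \<rho> x" "\<rho> (- x) = \<rho> x" "norm x \<ge> \<epsilon> \<Longrightarrow> \<rho> x = 0"
    "integrable lborel \<rho>" "(LBINT x. \<rho> x) = 1"
  using assms unfolding mollifier_def by auto

lemma integrable_conv:
  assumes "integrable lborel \<rho>" "integrable lborel A"
  shows "integrable lborel (conv \<rho> A)"
  using lborel_pair.integrable_fst[OF integrable_pair_shift(2)[OF assms]]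
  by (simp add: conv_def[abs_def])

text \<open>Fubini exchanges the variables, and evenness of \<open>\<rho>\<close> restores the form
  of a convolution.\<close>

lemma conv_adjoint:
  fixes A \<phi> :: "'a::euclidean_space \<Rightarrow> real"
  assumes \<rho>: "mollifier \<epsilon> \<rho>" and A: "integrable lborel A" and \<phi>: "integrable lborel \<phi>"
  shows "(LBINT x. A x * conv \<rho> \<phi> x) = (LBINT x. conv \<rho> A x * \<phi> x)"
proof -
  have [measurable]: "\<rho> \<in> borel_measurable borel" "A \<in> borel_measurable borel" "\<phi> \<in> borel_measurable borel"
    using A \<phi> mollifierD(5)[OF \<rho>] by auto
  obtain B where B: "\<And>x. \<bar>\<rho> x\<bar> \<le> B"
    using smooth_cs_bounded[OF mollifierD(1)[OF \<rho>]] by metis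
  have I: "integrable (lborel \<Otimes>\<^sub>M lborel) (\<lambda>(x, w). A x * (\<rho> (x - w) * \<phi> w))"
    using integrable_bounded_mult(1)[OF integrable_pair_product[OF A \<phi>], of "\<lambda>p. \<rho> (fst p - snd p)" B] B
    by (simp add: split_def ac_simps)
  have "(LBINT x. A x * conv \<rho> \<phi> x) = (LBINT x. (LBINT w. A x * (\<rho> (x - w) * \<phi> w)))"
    by (simp add: conv_def)
  also have "\<dots> = (LBINT w. (LBINT x. A x * (\<rho> (x - w) * \<phi> w)))"
    using lborel_pair.Fubini_integral[OF I] by simp
  also have "\<dots> = (LBINT w. conv \<rho> A w * \<phi> w)"
  proof (rule Bochner_Integration.integral_cong[OF refl])
    fix w
    have "\<rho> (x - w) = \<rho> (w - x)" for x
      using mollifierD(3)[OF \<rho>, of "w - x"] by simp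
    then have "(LBINT x. A x * (\<rho> (x - w) * \<phi> w)) = (LBINT x. (\<rho> (w - x) * A x) * \<phi> w)"
      by (simp add: ac_simps)
    then show "(LBINT x. A x * (\<rho> (x - w) * \<phi> w)) = conv \<rho> A w * \<phi> w"
      by (simp add: conv_def)
  qed
  finally show ?thesis .
qed

lemma conv_shift: "conv \<rho> A (x + z) = conv \<rho> (\<lambda>x. A (x + z)) x"
  if [measurable]: "\<rho> \<in> borel_measurable borel" "A \<in> borel_measurable borel"
  for A :: "'a::euclidean_space \<Rightarrow> real"
  using lborel_translate(2)[of "\<lambda>w. \<rho> (x + z - w) * A w" z] by (simp add: conv_def)

text \<open>This is what makes a merely integrable \<open>\<phi>\<close> usable: its mollification
  serves as the smooth test function, while the form is evaluated with \<open>\<phi>\<close> itself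
  against the mollified \<open>A\<close>. The reason is that translations commute with
  convolution.\<close>

lemma shift_form_conv:
  fixes k A \<phi> :: "'a::euclidean_space \<Rightarrow> real"
  assumes \<rho>: "mollifier \<epsilon> \<rho>" and A: "integrable lborel A" and \<phi>: "integrable lborel \<phi>"
  shows "shift_form k A (conv \<rho> \<phi>) = shift_form k (conv \<rho> A) \<phi>"
proof -
  have [measurable]: "A \<in> borel_measurable borel" "\<rho> \<in> borel_measurable borel"
    using A mollifierD(5)[OF \<rho>] by auto
  have "(LBINT x. (A x - A (x + z)) * conv \<rho> \<phi> x) =
      (LBINT x. (conv \<rho> A x - conv \<rho> A (x + z)) * \<phi> x)" for z
  proof -
    have Az: "integrable lborel (\<lambda>x. A (x + z))"
      using A lborel_translate(1)[of A z] by auto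
    have "conv \<rho> (\<lambda>x. A x - A (x + z)) x = conv \<rho> A x - conv \<rho> A (x + z)" for x
      unfolding conv_shift[OF \<open>\<rho> \<in> _\<close> \<open>A \<in> _\<close>]
      unfolding conv_def
      by (simp add: right_diff_distrib conv_integrable[OF mollifierD(1)[OF \<rho>] A]
          conv_integrable[OF mollifierD(1)[OF \<rho>] Az])
    then show ?thesis
      using conv_adjoint[OF \<rho> Bochner_Integration.integrable_diff[OF A Az] \<phi>] by simp
  qed
  then show ?thesis
    by (simp add: shift_form_def)
qed

lemma conv_le:
  assumes \<rho>: "mollifier \<epsilon> \<rho>" and A: "integrable lborel A"
    and le: "\<And>w. norm (x - w) < \<epsilon> \<Longrightarrow> A w \<le> M"
  shows "conv \<rho> A x \<le> M"
proof -
  have [measurable]: "\<rho> \<in> borel_measurable borel"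
    using mollifierD(5)[OF \<rho>] by auto
  have r: "integrable lborel (\<lambda>w. \<rho> (x - w))" "(LBINT w. \<rho> (x - w)) = 1"
    using lborel_reflect[of \<rho> x] mollifierD(5,6)[OF \<rho>] by auto
  have "conv \<rho> A x \<le> (LBINT w. \<rho> (x - w) * M)"
    unfolding conv_def
  proof (rule integral_mono)
    show "integrable lborel (\<lambda>w. \<rho> (x - w) * A w)"
      by (rule conv_integrable[OF mollifierD(1)[OF \<rho>] A])
    show "\<rho> (x - w) * A w \<le> \<rho> (x - w) * M" for w
      using le[of w] mollifierD(2,4)[OF \<rho>, of "x - w"] by (cases "norm (x - w) < \<epsilon>") (auto intro: mult_left_mono)
  qed (use r in auto)
  then show ?thesis
    using r by simp
qed

lemma conv_mono:
  assumes \<rho>: "mollifier \<epsilon> \<rho>" and A: "integrable lborel A" "integrable lborel B"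
    and le: "\<And>w. norm (x - w) < \<epsilon> \<Longrightarrow> A w \<le> B w"
  shows "conv \<rho> A x \<le> conv \<rho> B x"
  using conv_le[OF \<rho> Bochner_Integration.integrable_diff[OF A], of x 0] le
  by (simp add: conv_def right_diff_distrib conv_integrable[OF mollifierD(1)[OF \<rho>]] A)

lemma conv_bounded:
  assumes \<rho>: "mollifier \<epsilon> \<rho>" and A: "integrable lborel A"
  obtains M where "\<And>x. \<bar>conv \<rho> A x\<bar> \<le> M"
proof -
  obtain B where B: "\<And>x. \<bar>\<rho> x\<bar> \<le> B" "B \<ge> 0"
    using smooth_cs_bounded[OF mollifierD(1)[OF \<rho>]] by metis
  have "\<bar>conv \<rho> A x\<bar> \<le> (LBINT w. B * \<bar>A w\<bar>)" for x
  proof -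
    have "\<bar>conv \<rho> A x\<bar> \<le> (LBINT w. \<bar>\<rho> (x - w) * A w\<bar>)"
      unfolding conv_def by (rule integral_abs_bound)
    also have "\<dots> \<le> (LBINT w. B * \<bar>A w\<bar>)"
      by (rule integral_mono)
        (use A B integrable_abs[OF conv_integrable[OF mollifierD(1)[OF \<rho>] A]] in
          \<open>auto simp: abs_mult intro!: mult_right_mono\<close>)
    finally show ?thesis .
  qed
  then show ?thesis
    using that by blast
qed

lemma conv_support:
  assumes \<rho>: "mollifier \<epsilon> \<rho>" and A: "\<And>w. dist c w \<ge> R \<Longrightarrow> A w = 0"
    and x: "dist c x \<ge> R + \<epsilon>"
  shows "conv \<rho> A x = 0"
proof -
  have "\<rho> (x - w) * A w = 0" for w
  proof (cases "dist c w \<ge> R")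
    case False
    have "dist c x \<le> dist c w + norm (x - w)"
      using dist_triangle[of c x w] by (simp add: dist_norm norm_minus_commute)
    then show ?thesis
      using mollifierD(4)[OF \<rho>, of "x - w"] False x by simp
  qed (use A in auto)
  then have "(\<lambda>w. \<rho> (x - w) * A w) = (\<lambda>w. 0)"
    by blast
  then show ?thesis
    by (simp only: conv_def integral_zero)
qed

text \<open>Jensen's inequality for the density \<open>\<rho> (x - w)\<close>, read off from the
  nonnegative variance around the mean \<open>a\<close>. Together with \<open>integral_conv\<close>
  it bounds squares of mollified functions independently of the mollifier.\<close>

lemma conv_square_le:
  assumes \<rho>: "mollifier \<epsilon> \<rho>" and A: "integrable lborel A" and A2: "integrable lborel (\<lambda>x. (A x)\<^sup>2)"
  shows "(conv \<rho> A x)\<^sup>2 \<le> conv \<rho> (\<lambda>x. (A x)\<^sup>2) x"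
proof -
  define a where "a = conv \<rho> A x"
  have [measurable]: "\<rho> \<in> borel_measurable borel"
    using mollifierD(5)[OF \<rho>] by auto
  have r: "integrable lborel (\<lambda>w. \<rho> (x - w))" "(LBINT w. \<rho> (x - w)) = 1"
    using lborel_reflect[of \<rho> x] mollifierD(5,6)[OF \<rho>] by auto
  note I = conv_integrable[OF mollifierD(1)[OF \<rho>] A, of x] conv_integrable[OF mollifierD(1)[OF \<rho>] A2, of x]
  have "0 \<le> (LBINT w. \<rho> (x - w) * (A w - a)\<^sup>2)"
    using mollifierD(2)[OF \<rho>] by (intro Bochner_Integration.integral_nonneg) simp
  also have "\<dots> = (LBINT w. \<rho> (x - w) * (A w)\<^sup>2 - 2 * a * (\<rho> (x - w) * A w) + a\<^sup>2 * \<rho> (x - w))"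
    by (intro Bochner_Integration.integral_cong) (auto simp: power2_eq_square algebra_simps)
  also have "\<dots> = conv \<rho> (\<lambda>x. (A x)\<^sup>2) x - 2 * a * conv \<rho> A x + a\<^sup>2"
    using r I by (simp add: conv_def)
  finally show ?thesis
    by (simp add: a_def power2_eq_square)
qed

lemma integral_conv:
  assumes \<rho>: "mollifier \<epsilon> \<rho>" and A: "integrable lborel A"
  shows "(LBINT x. conv \<rho> A x) = (LBINT x. A x)"
proof -
  have [measurable]: "\<rho> \<in> borel_measurable borel"
    using mollifierD(5)[OF \<rho>] by auto
  have "(LBINT x. conv \<rho> A x) = (LBINT w. (LBINT x. \<rho> (x - w) * A w))"
    unfolding conv_def
    using lborel_pair.Fubini_integral[OF integrable_pair_shift(2)[OF mollifierD(5)[OF \<rho>] A]] by simp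
  also have "\<dots> = (LBINT w. A w)"
    using lborel_translate(2)[of \<rho> "- w" for w] mollifierD(6)[OF \<rho>] by simp
  finally show ?thesis .
qed

section \<open>Splitting the kernel\<close>

text \<open>
  Off the origin, \<open>norm z powr (- N) = knear N r 0 z + kfar N r z\<close>. The far part is continuous, so
  that its potentials are; the near part is supported in \<open>ball 0 r\<close>, where everything is
  translation invariant, and \<open>\<tau> > 0\<close> makes it bounded. At the origin \<open>0 powr (- N) = 0\<close>.
\<close>

definition kfar :: "real \<Rightarrow> real \<Rightarrow> 'a::euclidean_space \<Rightarrow> real" where
  "kfar N r z = max (norm z) r powr (- N)"

definition knear :: "real \<Rightarrow> real \<Rightarrow> real \<Rightarrow> 'a::euclidean_space \<Rightarrow> real" where
  "knear N r \<tau> z = (if \<tau> < norm z \<and> norm z < r then norm z powr (- N) - r powr (- N) else 0)"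

definition far_pot :: "real \<Rightarrow> real \<Rightarrow> ('a::euclidean_space \<Rightarrow> real) \<Rightarrow> 'a \<Rightarrow> real" where
  "far_pot N r g x = (LBINT y. g y * kfar N r (x - y))"

lemma kfar_measurable[measurable]: "kfar N r \<in> borel_measurable borel"
  unfolding kfar_def by measurable

lemma knear_measurable[measurable]: "knear N r \<tau> \<in> borel_measurable borel"
  unfolding knear_def by measurable

lemma kfar_nonneg: "0 \<le> kfar N r z"
  by (simp add: kfar_def)

lemma kfar_le: "0 < r \<Longrightarrow> 0 \<le> N \<Longrightarrow> kfar N r z \<le> r powr (- N)"
  unfolding kfar_def by (intro powr_mono2') auto

lemma kfar_minus: "kfar N r (x - y) = kfar N r (y - x)"
  by (simp add: kfar_def norm_minus_commute)

lemma knear_minus: "knear N r \<tau> (- z) = knear N r \<tau> z"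
  by (simp add: knear_def)

lemma knear_nonneg: "0 \<le> N \<Longrightarrow> 0 \<le> \<tau> \<Longrightarrow> 0 \<le> knear N r \<tau> z"
  by (auto simp: knear_def intro!: powr_mono2')

lemma knear_add_kfar:
  assumes "0 < r" "z \<noteq> 0"
  shows "knear N r 0 z + kfar N r z = norm z powr (- N)"
  using assms by (auto simp: knear_def kfar_def max_def)

lemma knear_mono: "0 \<le> N \<Longrightarrow> 0 \<le> \<tau> \<Longrightarrow> knear N r \<tau> z \<le> knear N r 0 z"
  using knear_nonneg[of N 0 r z] by (auto simp: knear_def)

lemma knear_le:
  assumes "0 \<le> N" "0 < \<tau>"
  shows "knear N r \<tau> z \<le> \<tau> powr (- N) * indicator (ball 0 r) z"
proof (cases "\<tau> < norm z \<and> norm z < r")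
  case True
  then have "norm z powr (- N) \<le> \<tau> powr (- N)"
    using assms by (intro powr_mono2') auto
  moreover have "0 \<le> r powr (- N)"
    by simp
  moreover have "knear N r \<tau> z = norm z powr (- N) - r powr (- N)" "indicator (ball 0 r) z = (1::real)"
    using True by (auto simp: knear_def)
  ultimately have "knear N r \<tau> z \<le> \<tau> powr (- N)"
    by linarith
  then show ?thesis
    using True by simp
qed (use assms in \<open>auto simp: knear_def\<close>)

text \<open>Inside the ball of radius \<open>r\<close> the far kernel is the constant
  \<open>r powr (- N)\<close>, and outside it the near kernel vanishes. Hence one integrability
  bound for far interactions also covers the truncated near kernel.\<close>

lemma knear_le_kfar:
  assumes "0 \<le> N" "0 < \<tau>" "0 < r"
  shows "knear N r \<tau> z \<le> (\<tau> powr (- N) * r powr N) * kfar N r z"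
proof (cases "norm z < r")
  case True
  then have "kfar N r z = r powr (- N)"
    by (simp add: kfar_def)
  moreover have "r powr N * r powr (- N) = 1"
    using assms by (simp add: powr_minus)
  ultimately have "(\<tau> powr (- N) * r powr N) * kfar N r z = \<tau> powr (- N)"
    by (simp only: mult.assoc mult_1_right)
  moreover have "knear N r \<tau> z \<le> \<tau> powr (- N)"
    using knear_le[OF assms(1,2), of r z] True by simp
  ultimately show ?thesis
    by (simp only:)
qed (use assms in \<open>auto simp: knear_def kfar_nonneg\<close>)

lemma integrable_indicator_ball: "integrable lborel (indicator (ball (c::'a::euclidean_space) r) :: 'a \<Rightarrow> real)"
  using emeasure_bounded_finite[of "ball c r"] by (intro integrable_real_indicator) auto

lemma integrable_indicator_cball: "integrable lborel (indicator (cball (c::'a::euclidean_space) r) :: 'a \<Rightarrow> real)"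
  using emeasure_bounded_finite[of "cball c r"] by (intro integrable_real_indicator) auto

lemma knear_integrable:
  assumes "0 \<le> N" "0 < \<tau>"
  shows "integrable lborel (knear N r \<tau> :: 'a::euclidean_space \<Rightarrow> real)"
  by (rule Bochner_Integration.integrable_bound[OF integrable_mult_right[OF integrable_indicator_ball[of 0 r], of "\<tau> powr (- N)"]])
    (use knear_le[OF assms, of r, where 'a='a] knear_nonneg[OF assms(1), of \<tau> r, where 'a='a] assms in
      \<open>auto intro!: AE_I2 simp: abs_of_nonneg\<close>)

text \<open>With \<open>m = max (norm (x - y)) r\<close> the triangle inequality gives
  \<open>norm y \<le> m * (3 + norm c / r)\<close>: one \<open>m\<close> for the distance from
  \<open>x\<close> to \<open>y\<close>, two for the distance from \<open>c\<close> to
  \<open>x\<close>. Together with \<open>r \<le> m\<close>, which handles the summand 1, this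
  compares \<open>1 + norm y powr N\<close> with \<open>m powr N\<close> uniformly in
  \<open>x\<close>.\<close>

lemma kfar_weight:
  assumes r: "0 < r" and N: "0 \<le> N" and x: "x \<in> cball c (2 * r)"
  shows "kfar N r (x - y) \<le> (r powr (- N) + (3 + norm c / r) powr N) * (1 / (1 + norm y powr N))"
proof -
  let ?m = "max (norm (x - y)) r"
  have m: "0 < ?m"
    using r by auto
  have "norm y \<le> norm (x - y) + norm (c - x) + norm c"
    using norm_triangle_ineq4[of "x" "x - y"] norm_triangle_ineq4[of c "c - x"] by simp
  also have "\<dots> \<le> ?m + 2 * r + norm c"
    using x by (auto simp: dist_norm)
  also have "\<dots> \<le> ?m * (3 + norm c / r)"
  proof -
    have "2 * r \<le> 2 * ?m" by simp
    moreover have "norm c \<le> ?m * (norm c / r)"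
      using r mult_right_mono[of r ?m "norm c / r"] by simp
    ultimately show ?thesis
      by (simp add: algebra_simps)
  qed
  finally have "norm y powr N \<le> (?m * (3 + norm c / r)) powr N"
    using N by (intro powr_mono2) auto
  also have "\<dots> = ?m powr N * (3 + norm c / r) powr N"
    using m r by (intro powr_mult)
  finally have 1: "norm y powr N \<le> ?m powr N * (3 + norm c / r) powr N" .
  have "r powr N \<le> ?m powr N"
    using r N by (intro powr_mono2) auto
  then have "1 \<le> ?m powr N * r powr (- N)"
    using r by (simp add: powr_minus field_simps)
  with 1 have "1 + norm y powr N \<le> ?m powr N * (r powr (- N) + (3 + norm c / r) powr N)"
    by (simp add: algebra_simps)
  moreover have "kfar N r (x - y) = 1 / ?m powr N"
    by (simp add: kfar_def powr_minus_divide)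
  moreover have "0 < ?m powr N" "0 < 1 + norm y powr N"
    using m by (auto intro: add_pos_nonneg)
  moreover have "1 / M \<le> C * (1 / (1 + w))" if "1 + w \<le> M * C" "0 < M" "0 < 1 + w" for M C w :: real
    using that by (simp add: field_simps)
  ultimately show ?thesis
    by metis
qed

lemma integrable_weight:
  assumes "0 < s"
  shows "integrable lborel (\<lambda>y::'a::euclidean_space. 1 / (1 + norm y powr (real DIM('a) + 2 * s)))"
proof -
  let ?N = "real DIM('a) + 2 * s"
  obtain C where "\<forall>R>0. (\<integral>\<^sup>+z. ennreal (indicator (- ball (0::'a) R) z / norm z powr ?N) \<partial>lborel) \<le> ennreal (C * R powr (- 2 * s))"
    using nn_integral_norm_powr_outer[OF assms, where 'a='a] by auto
  from this[rule_format, of 1]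
  have "(\<integral>\<^sup>+z. ennreal (indicator (- ball (0::'a) 1) z / norm z powr ?N) \<partial>lborel) \<le> ennreal C"
    by simp
  also have "\<dots> < \<infinity>"
    by simp
  finally have "integrable lborel (\<lambda>z. indicator (- ball (0::'a) 1) z / norm z powr ?N)"
    by (intro integrableI_nonneg) auto
  from Bochner_Integration.integrable_add[OF integrable_indicator_ball[of "0::'a" 1] this]
  show ?thesis
  proof (rule Bochner_Integration.integrable_bound)
    show "AE y in lborel. norm (1 / (1 + norm (y::'a) powr ?N))
        \<le> norm (indicator (ball 0 1) y + indicator (- ball 0 1) y / norm y powr ?N)"
    proof (rule AE_I2)
      fix y :: 'a
      have "1 / (1 + norm y powr ?N) \<le> 1"
        by (simp add: divide_simps add_pos_nonneg)
      moreover have "1 / (1 + norm y powr ?N) \<le> 1 / norm y powr ?N" if "\<not> norm y < 1"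
        using that by (intro divide_left_mono) (auto intro!: mult_pos_pos add_pos_nonneg)
      ultimately show "norm (1 / (1 + norm y powr ?N)) \<le> norm (indicator (ball 0 1) y + indicator (- ball 0 1) y / norm y powr ?N)"
        by (cases "norm y < 1") (auto simp: add_nonneg_nonneg)
    qed
  qed auto
qed

lemma far_pot_integrable:
  fixes g :: "'a::euclidean_space \<Rightarrow> real"
  assumes r: "0 < r" and N: "0 \<le> N" and g: "integrable lborel (\<lambda>y. g y * (1 / (1 + norm y powr N)))"
    and [measurable]: "g \<in> borel_measurable borel"
  shows "integrable lborel (\<lambda>y. g y * kfar N r (x - y))"
proof (rule Bochner_Integration.integrable_bound)
  let ?C = "r powr (- N) + (3 + norm x / r) powr N"
  show "integrable lborel (\<lambda>y. ?C * (g y * (1 / (1 + norm y powr N))))"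
    using g by (rule integrable_mult_right)
  show "AE y in lborel. norm (g y * kfar N r (x - y)) \<le> norm (?C * (g y * (1 / (1 + norm y powr N))))"
  proof (rule AE_I2)
    fix y
    have "\<bar>g y\<bar> * kfar N r (x - y) \<le> \<bar>g y\<bar> * (?C * (1 / (1 + norm y powr N)))"
      using kfar_weight[OF r N, of x x y] r by (intro mult_left_mono) auto
    also have "\<dots> = \<bar>?C * (g y * (1 / (1 + norm y powr N)))\<bar>"
      using r by (simp add: abs_mult add_nonneg_nonneg)
    finally show "norm (g y * kfar N r (x - y)) \<le> norm (?C * (g y * (1 / (1 + norm y powr N))))"
      using kfar_nonneg[of N r "x - y"] by (simp add: abs_mult)
  qed
qed measurable

text \<open>Flattening the kernel below radius \<open>r\<close> makes it continuous, and
  \<open>kfar_weight\<close> provides a majorant common to all points of a ball, so dominated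
  convergence applies along sequences.\<close>

lemma far_pot_continuous:
  fixes g :: "'a::euclidean_space \<Rightarrow> real"
  assumes r: "0 < r" and N: "0 \<le> N" and g: "integrable lborel (\<lambda>y. g y * (1 / (1 + norm y powr N)))"
    and [measurable]: "g \<in> borel_measurable borel"
  shows "continuous_on UNIV (far_pot N r g)"
proof -
  have "continuous_on (ball c (2 * r)) (far_pot N r g)" for c
  proof (unfold continuous_on_sequentially comp_def, intro ballI allI impI, elim conjE)
    fix X x assume X: "\<forall>n. X n \<in> ball c (2 * r)" "X \<longlonglongrightarrow> x"
    let ?C = "r powr (- N) + (3 + norm c / r) powr N"
    show "(\<lambda>n. far_pot N r g (X n)) \<longlonglongrightarrow> far_pot N r g x"
      unfolding far_pot_def
    proof (rule integral_dominated_convergence[where w = "\<lambda>y. \<bar>?C * (g y * (1 / (1 + norm y powr N)))\<bar>"])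
      show "AE y in lborel. (\<lambda>n. g y * kfar N r (X n - y)) \<longlonglongrightarrow> g y * kfar N r (x - y)"
        unfolding kfar_def using r X by (auto intro!: AE_I2 tendsto_intros)
      show "AE y in lborel. norm (g y * kfar N r (X n - y)) \<le> \<bar>?C * (g y * (1 / (1 + norm y powr N)))\<bar>" for n
      proof (rule AE_I2)
        fix y
        have "\<bar>g y\<bar> * kfar N r (X n - y) \<le> \<bar>g y\<bar> * (?C * (1 / (1 + norm y powr N)))"
          using kfar_weight[OF r N, of "X n" c y] X by (intro mult_left_mono) (auto simp: less_imp_le)
        also have "\<dots> = \<bar>?C * (g y * (1 / (1 + norm y powr N)))\<bar>"
          using r by (simp add: abs_mult add_nonneg_nonneg)
        finally show "norm (g y * kfar N r (X n - y)) \<le> \<bar>?C * (g y * (1 / (1 + norm y powr N)))\<bar>"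
          using kfar_nonneg[of N r "X n - y"] by (simp add: abs_mult)
      qed
    qed (use integrable_abs[OF integrable_mult_right[OF g]] in auto)
  qed
  then have "isCont (far_pot N r g) c" for c
    using r by (metis at_within_open centre_in_ball continuous_on_eq_continuous_within mult_pos_pos open_ball zero_less_numeral)
  then show ?thesis
    by (simp add: continuous_on_eq_continuous_at)
qed

section \<open>The weak inequality against bounded kernels\<close>

text \<open>
  The function vanishes off \<open>\<Omega>\<close>, so integrals over \<open>\<Omega>\<close> against \<open>u\<close> are integrals over the whole
  space; the indicator of \<open>\<Omega>\<close> remains only where \<open>u x\<close> multiplies the kernel.
\<close>

locale supersolution =
  fixes s N :: real and \<Omega> :: "'a::euclidean_space set" and u :: "'a \<Rightarrow> real"
  assumes s: "0 < s" "s < 1" and N_def: "N = real DIM('a) + 2 * s"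
    and open_\<Omega>: "open \<Omega>"
    and u_meas[measurable]: "u \<in> borel_measurable borel"
    and u_zero: "x \<notin> \<Omega> \<Longrightarrow> u x = 0"
    and u_weight: "integrable lborel (\<lambda>x. u x * (1 / (1 + norm x powr N)))"
    and u_sq: "cball c R \<subseteq> \<Omega> \<Longrightarrow> integrable lborel (\<lambda>x. indicator (cball c R) x * (u x)\<^sup>2)"
    and energy: "cball c R \<subseteq> \<Omega> \<Longrightarrow> integrable (lborel \<Otimes>\<^sub>M lborel)
      (\<lambda>(x, y). indicator (cball c R) x * indicator (cball c R) y * ((u x - u y)\<^sup>2 * norm (x - y) powr (- N)))"
    and super: "\<psi> \<in> test_functions \<Omega> \<Longrightarrow> (\<And>x. 0 \<le> \<psi> x) \<Longrightarrow>
      0 \<le> (LINT (x, y)|(lborel \<Otimes>\<^sub>M lborel). indicator \<Omega> x * indicator \<Omega> y *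
            ((u x - u y) * (\<psi> x - \<psi> y) * norm (x - y) powr (- N)))"
begin

lemma N_pos: "0 < N" "0 \<le> N"
  using s by (auto simp: N_def add_pos_pos)

lemma \<Omega>_meas[measurable]: "\<Omega> \<in> sets borel"
  using open_\<Omega> by simp

lemma balls_meas[measurable]: "cball (c::'a) R \<in> sets borel" "ball c R \<in> sets borel"
  by auto

definition trunc :: "'a \<Rightarrow> real \<Rightarrow> 'a \<Rightarrow> real" where
  "trunc c R x = indicator (cball c R) x * u x"

lemma trunc_meas[measurable]: "trunc c R \<in> borel_measurable borel"
  unfolding trunc_def by measurable

lemma trunc_integrable:
  assumes "cball c R \<subseteq> \<Omega>"
  shows "integrable lborel (trunc c R)" "integrable lborel (\<lambda>x. (trunc c R x)\<^sup>2)"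
proof -
  have e: "(\<lambda>x. (trunc c R x)\<^sup>2) = (\<lambda>x. indicator (cball c R) x * (u x)\<^sup>2)"
    by (auto simp: trunc_def indicator_def)
  show "integrable lborel (\<lambda>x. (trunc c R x)\<^sup>2)"
    unfolding e by (rule u_sq[OF assms])
  show "integrable lborel (trunc c R)"
  proof (rule Bochner_Integration.integrable_bound[OF Bochner_Integration.integrable_add[OF
          integrable_indicator_cball[of c R] u_sq[OF assms]]])
    have "\<bar>t\<bar> \<le> 1 + t\<^sup>2" for t :: real
      using zero_le_power2[of "\<bar>t\<bar> - 1"] by (simp add: power2_eq_square algebra_simps)
    then show "AE x in lborel. norm (trunc c R x) \<le> norm (indicator (cball c R) x + indicator (cball c R) x * (u x)\<^sup>2)"
      by (auto simp: trunc_def indicator_def)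
  qed measurable
qed

lemma indicator_weight: "integrable lborel (\<lambda>y. indicator \<Omega> y * (1 / (1 + norm y powr N)))"
  using integrable_bounded_mult(1)[OF integrable_weight[OF s(1), where 'a='a], of "indicator \<Omega>" 1]
  by (simp add: N_def indicator_def)

lemma integrable_pair_swap:
  fixes f :: "'a \<Rightarrow> 'a \<Rightarrow> real"
  assumes "integrable (lborel \<Otimes>\<^sub>M lborel) (\<lambda>(x, y). f x y)"
  shows "integrable (lborel \<Otimes>\<^sub>M lborel) (\<lambda>(x, y). f y x)"
  using lborel_pair.integrable_product_swap[OF assms] by (simp add: split_def)

lemma kernel_sq_integrable:
  "integrable lborel (\<lambda>z::'a. indicator (ball 0 r) z * ((norm z)\<^sup>2 * norm z powr (- N)))"
proof (cases "r > 0")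
  case True
  obtain C where "\<forall>R>0. (\<integral>\<^sup>+z. ennreal (indicator (ball (0::'a) R) z *
      ((norm z)\<^sup>2 / norm z powr N)) \<partial>lborel) \<le> ennreal (C * R powr (2 - 2 * s))"
    using nn_integral_norm_powr_inner[OF s, where 'a='a] by (auto simp: N_def)
  from this[rule_format, OF True]
  have "(\<integral>\<^sup>+z. ennreal (indicator (ball (0::'a) r) z * ((norm z)\<^sup>2 * norm z powr (- N))) \<partial>lborel)
      \<le> ennreal (C * r powr (2 - 2 * s))"
    by (simp add: powr_minus divide_inverse)
  also have "\<dots> < \<infinity>"
    by simp
  finally have f: "(\<integral>\<^sup>+z. ennreal (indicator (ball (0::'a) r) z * ((norm z)\<^sup>2 * norm z powr (- N))) \<partial>lborel) < \<infinity>" .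
  have "(\<lambda>z::'a. (norm z)\<^sup>2) \<in> borel_measurable borel"
    by (intro borel_measurable_power) simp
  moreover have "(\<lambda>z::'a. norm z powr (- N)) \<in> borel_measurable borel"
    by simp
  ultimately have "(\<lambda>z::'a. indicator (ball 0 r) z * ((norm z)\<^sup>2 * norm z powr (- N))) \<in> borel_measurable lborel"
    by (intro borel_measurable_times borel_measurable_indicator) auto
  then show ?thesis
    using f by (intro integrableI_nonneg) auto
next
  case False
  then show ?thesis
    by (simp add: ball_empty)
qed

text \<open>The common majorant of far interactions with a test function supported in the ball of
  radius \<open>2 * r\<close>. It is a sum of two products of integrable functions: \<open>u\<close>
  on the ball times the weight, and the ball times the weighted \<open>u\<close>.\<close>

lemma far_pair_integrable:
  assumes G: "cball c (4 * r) \<subseteq> \<Omega>" and r: "0 < r"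
  shows "integrable (lborel \<Otimes>\<^sub>M lborel) (\<lambda>(x, y). indicator (cball c (2 * r)) x *
           ((\<bar>u x\<bar> + \<bar>u y\<bar>) * (indicator \<Omega> y * (1 / (1 + norm y powr N)))))"
proof -
  let ?b = "indicator (cball c (2 * r)) :: 'a \<Rightarrow> real"
  let ?W = "\<lambda>y. indicator \<Omega> y * (1 / (1 + norm y powr N)) :: real"
  have "cball c (2 * r) \<subseteq> \<Omega>"
    using G r subset_cball[of "2 * r" "4 * r" c] by simp
  then have 1: "integrable lborel (\<lambda>x. \<bar>trunc c (2 * r) x\<bar>)"
    using trunc_integrable(1) by blast
  have 2: "integrable lborel (\<lambda>y. \<bar>u y\<bar> * ?W y)"
  proof -
    have "(\<lambda>y. \<bar>u y\<bar> * ?W y) = (\<lambda>y. \<bar>u y * (1 / (1 + norm y powr N))\<bar>)"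
      using u_zero by (intro ext) (auto simp: indicator_def abs_mult)
    then show ?thesis
      using integrable_abs[OF u_weight] by simp
  qed
  have "integrable (lborel \<Otimes>\<^sub>M lborel)
      (\<lambda>(x, y). \<bar>trunc c (2 * r) x\<bar> * ?W y + ?b x * (\<bar>u y\<bar> * ?W y))"
    using Bochner_Integration.integrable_add[OF integrable_pair_product[OF 1 indicator_weight]
        integrable_pair_product[OF integrable_indicator_cball 2]]
    by (simp add: split_def)
  then show ?thesis
    by (rule back_subst[of "integrable _"]) (simp add: trunc_def abs_mult split_def distrib_right distrib_left mult.assoc add_divide_distrib)
qed

text \<open>Near the diagonal the product of the two differences is at most the sum of their
  squares: one is the energy of \<open>u\<close>, the other is controlled by the Lipschitz bound and
  the integrability of the kernel times \<open>(norm z)\<^sup>2\<close>. Away from the diagonal the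
  weights suffice.\<close>

lemma pairing_integrable:
  assumes G: "cball c (4 * r) \<subseteq> \<Omega>" and r: "0 < r"
    and \<psi>m[measurable]: "\<psi> \<in> borel_measurable borel" and \<psi>B: "\<And>x. \<bar>\<psi> x\<bar> \<le> B" and \<psi>L: "\<And>x y. \<bar>\<psi> x - \<psi> y\<bar> \<le> L * norm (x - y)"
    and \<psi>0: "\<And>x. x \<notin> cball c (2 * r) \<Longrightarrow> \<psi> x = 0"
  shows "integrable (lborel \<Otimes>\<^sub>M lborel) (\<lambda>(x, y). indicator \<Omega> x * indicator \<Omega> y *
            ((u x - u y) * (\<psi> x - \<psi> y) * norm (x - y) powr (- N)))"
proof -
  let ?K = "\<lambda>x y. norm (x - y :: 'a) powr (- N)"
  let ?b4 = "indicator (cball c (4 * r)) :: 'a \<Rightarrow> real"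
  let ?b2 = "indicator (cball c (2 * r)) :: 'a \<Rightarrow> real"
  let ?F1 = "\<lambda>x y. ?b4 x * ?b4 y * ((u x - u y)\<^sup>2 * ?K x y)"
  let ?h = "\<lambda>z::'a. indicator (ball 0 r) z * ((norm z)\<^sup>2 * norm z powr (- N)) :: real"
  let ?F2 = "\<lambda>x y. ?h (y - x) * ?b4 x"
  let ?G = "\<lambda>x y. ?b2 x * ((\<bar>u x\<bar> + \<bar>u y\<bar>) * (indicator \<Omega> y * (1 / (1 + norm y powr N))))"
  define C where "C = r powr (- N) + (3 + norm c / r) powr N"
  have C: "0 \<le> C"
    by (simp add: C_def)
  have B: "0 \<le> B"
    using \<psi>B[of c] by linarith
  have I1: "integrable (lborel \<Otimes>\<^sub>M lborel) (\<lambda>(x, y). ?F1 x y)"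
    by (rule energy[OF G])
  have I2: "integrable (lborel \<Otimes>\<^sub>M lborel) (\<lambda>(x, y). ?F2 x y)"
    using integrable_pair_swap[OF integrable_pair_shift(2)[OF kernel_sq_integrable[of r]
          integrable_indicator_cball[of c "4 * r"]]] .
  have I3: "integrable (lborel \<Otimes>\<^sub>M lborel) (\<lambda>(x, y). ?G x y)"
    by (rule far_pair_integrable[OF G r])
  have I4: "integrable (lborel \<Otimes>\<^sub>M lborel) (\<lambda>(x, y). ?G y x)"
    by (rule integrable_pair_swap[OF I3])
  have I: "integrable (lborel \<Otimes>\<^sub>M lborel)
      (\<lambda>(x, y). ?F1 x y + L\<^sup>2 * ?F2 x y + B * C * ?G x y + B * C * ?G y x)"
    using Bochner_Integration.integrable_add[OF Bochner_Integration.integrable_add[OF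
          Bochner_Integration.integrable_add[OF I1 integrable_mult_right[OF I2, of "L\<^sup>2"]]
          integrable_mult_right[OF I3, of "B * C"]] integrable_mult_right[OF I4, of "B * C"]]
    by (simp add: split_def)
  have bound: "\<bar>indicator \<Omega> x * indicator \<Omega> y * ((u x - u y) * (\<psi> x - \<psi> y) * ?K x y)\<bar>
      \<le> ?F1 x y + L\<^sup>2 * ?F2 x y + B * C * ?G x y + B * C * ?G y x" for x y
  proof (cases "x = y \<or> x \<notin> \<Omega> \<or> y \<notin> \<Omega>")
    case True
    have "0 \<le> ?F1 x y + L\<^sup>2 * ?F2 x y + B * C * ?G x y + B * C * ?G y x"
      using B C by (intro add_nonneg_nonneg mult_nonneg_nonneg) auto
    then show ?thesis
      using True by auto
  next
    case False
    then have K: "?K x y = knear N r 0 (x - y) + kfar N r (x - y)"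
      using knear_add_kfar[OF r, of "x - y" N] by simp
    have kn: "0 \<le> knear N r 0 (x - y)" "0 \<le> kfar N r (x - y)"
      using N_pos by (auto simp: knear_nonneg kfar_nonneg)
    have far: "\<bar>u x - u y\<bar> * \<bar>\<psi> x - \<psi> y\<bar> * kfar N r (x - y) \<le> B * C * ?G x y + B * C * ?G y x"
    proof -
      have p: "\<bar>\<psi> x\<bar> * kfar N r (x - y) \<le> B * C * (?b2 x * (indicator \<Omega> y * (1 / (1 + norm y powr N))))"
        if "y \<in> \<Omega>" for x y
      proof (cases "x \<in> cball c (2 * r)")
        case True
        have "\<bar>\<psi> x\<bar> * kfar N r (x - y) \<le> B * (C * (1 / (1 + norm y powr N)))"
          using kfar_weight[OF r N_pos(2) True, of y] \<psi>B[of x] B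
          by (intro mult_mono) (auto simp: C_def kfar_nonneg)
        then show ?thesis
          using True that by simp
      qed (use \<psi>0 in auto)
      have "\<bar>u x - u y\<bar> * \<bar>\<psi> x - \<psi> y\<bar> * kfar N r (x - y)
          \<le> (\<bar>u x\<bar> + \<bar>u y\<bar>) * ((\<bar>\<psi> x\<bar> + \<bar>\<psi> y\<bar>) * kfar N r (x - y))"
        unfolding mult.assoc by (intro mult_mono mult_nonneg_nonneg) (auto simp: kfar_nonneg)
      also have "\<dots> = (\<bar>u x\<bar> + \<bar>u y\<bar>) * (\<bar>\<psi> x\<bar> * kfar N r (x - y) + \<bar>\<psi> y\<bar> * kfar N r (y - x))"
        by (simp add: distrib_right kfar_minus[of N r x y])
      also have "\<dots> \<le> (\<bar>u x\<bar> + \<bar>u y\<bar>) *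
          (B * C * (?b2 x * (indicator \<Omega> y * (1 / (1 + norm y powr N)))) +
           B * C * (?b2 y * (indicator \<Omega> x * (1 / (1 + norm x powr N)))))"
        using False by (intro mult_left_mono add_mono p) auto
      also have "\<dots> = B * C * ?G x y + B * C * ?G y x"
        by (simp add: algebra_simps)
      finally show ?thesis .
    qed
    have near: "\<bar>u x - u y\<bar> * \<bar>\<psi> x - \<psi> y\<bar> * knear N r 0 (x - y) \<le> ?F1 x y + L\<^sup>2 * ?F2 x y"
    proof (cases "\<psi> x = \<psi> y \<or> \<not> norm (x - y) < r")
      case True
      have "0 \<le> ?F1 x y + L\<^sup>2 * ?F2 x y"
        by (intro add_nonneg_nonneg mult_nonneg_nonneg) auto
      then show ?thesis
        using True by (auto simp: knear_def)
    next
      case c: False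
      \<comment> \<open>A nonzero difference of \<open>\<psi>\<close> puts one point into the ball
        of radius \<open>2 * r\<close>; a distance below \<open>r\<close> then keeps both in the
        ball on which the energy is known to be finite.\<close>
      then have "x \<in> cball c (2 * r) \<or> y \<in> cball c (2 * r)"
        using \<psi>0 by metis
      then have b: "x \<in> cball c (4 * r)" "y \<in> cball c (4 * r)"
        using c r dist_triangle[of c x y] dist_triangle[of c y x]
        by (auto simp: dist_norm norm_minus_commute)
      have "\<bar>u x - u y\<bar> * \<bar>\<psi> x - \<psi> y\<bar> \<le> (u x - u y)\<^sup>2 + (\<psi> x - \<psi> y)\<^sup>2"
      proof -
        have "2 * (\<bar>u x - u y\<bar> * \<bar>\<psi> x - \<psi> y\<bar>) \<le> \<bar>u x - u y\<bar>\<^sup>2 + \<bar>\<psi> x - \<psi> y\<bar>\<^sup>2"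
          using zero_le_power2[of "\<bar>u x - u y\<bar> - \<bar>\<psi> x - \<psi> y\<bar>"] by (simp add: power2_eq_square algebra_simps)
        moreover have "0 \<le> \<bar>u x - u y\<bar> * \<bar>\<psi> x - \<psi> y\<bar>"
          by simp
        ultimately show ?thesis
          by (simp only: power2_abs)
      qed
      also have "(\<psi> x - \<psi> y)\<^sup>2 \<le> L\<^sup>2 * (norm (x - y))\<^sup>2"
        using power_mono[OF \<psi>L[of x y] abs_ge_zero, of 2] by (simp add: power_mult_distrib)
      finally have "\<bar>u x - u y\<bar> * \<bar>\<psi> x - \<psi> y\<bar> \<le> (u x - u y)\<^sup>2 + L\<^sup>2 * (norm (x - y))\<^sup>2"
        by simp
      moreover have "knear N r 0 (x - y) \<le> ?K x y"
        using K kn by simp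
      ultimately have "\<bar>u x - u y\<bar> * \<bar>\<psi> x - \<psi> y\<bar> * knear N r 0 (x - y)
          \<le> ((u x - u y)\<^sup>2 + L\<^sup>2 * (norm (x - y))\<^sup>2) * ?K x y"
        using kn by (intro mult_mono) auto
      also have "\<dots> = ?F1 x y + L\<^sup>2 * ?F2 x y"
        using b c by (simp add: algebra_simps norm_minus_commute)
      finally show ?thesis .
    qed
    have "\<bar>indicator \<Omega> x * indicator \<Omega> y * ((u x - u y) * (\<psi> x - \<psi> y) * ?K x y)\<bar> =
        \<bar>u x - u y\<bar> * \<bar>\<psi> x - \<psi> y\<bar> * (knear N r 0 (x - y) + kfar N r (x - y))"
      using False K kn by (simp add: abs_mult)
    then show ?thesis
      using near far by (simp only: distrib_left)
  qed
  show ?thesis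
  proof (rule Bochner_Integration.integrable_bound[OF I])
    show "AE p in lborel \<Otimes>\<^sub>M lborel.
       norm (case p of (x, y) \<Rightarrow> indicator \<Omega> x * indicator \<Omega> y * ((u x - u y) * (\<psi> x - \<psi> y) * ?K x y))
       \<le> norm (case p of (x, y) \<Rightarrow> ?F1 x y + L\<^sup>2 * ?F2 x y + B * C * ?G x y + B * C * ?G y x)"
    proof (rule AE_I2)
      fix p :: "'a \<times> 'a"
      obtain x y where p: "p = (x, y)"
        by (cases p)
      show "norm (case p of (x, y) \<Rightarrow> indicator \<Omega> x * indicator \<Omega> y * ((u x - u y) * (\<psi> x - \<psi> y) * ?K x y))
       \<le> norm (case p of (x, y) \<Rightarrow> ?F1 x y + L\<^sup>2 * ?F2 x y + B * C * ?G x y + B * C * ?G y x)"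
        unfolding p prod.case real_norm_def by (rule order_trans[OF bound abs_ge_self])
    qed
  qed measurable
qed


text \<open>For \<open>\<tau> > 0\<close> the kernel is bounded by a multiple of
  \<open>kfar\<close>, so \<open>\<psi> x - \<psi> y\<close> may be split into two separately
  convergent integrals, which agree by symmetry. The resulting one-sided form no longer contains
  \<open>\<psi> y\<close> and can be studied point by point.\<close>

lemma pairing_trunc:
  assumes G: "cball c (4 * r) \<subseteq> \<Omega>" and r: "0 < r" and \<tau>: "0 < \<tau>"
    and \<psi>m[measurable]: "\<psi> \<in> borel_measurable borel" and \<psi>B: "\<And>x. \<bar>\<psi> x\<bar> \<le> B"
    and \<psi>0: "\<And>x. x \<notin> cball c (2 * r) \<Longrightarrow> \<psi> x = 0"
  shows "(LINT (x, y)|(lborel \<Otimes>\<^sub>M lborel). indicator \<Omega> x * indicator \<Omega> y *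
            ((u x - u y) * (\<psi> x - \<psi> y) * (knear N r \<tau> (x - y) + kfar N r (x - y)))) =
         2 * (shift_form (knear N r \<tau>) (trunc c (4 * r)) \<psi> +
           (LBINT x. \<psi> x * (far_pot N r (indicator \<Omega>) x * u x - far_pot N r u x)))" (is ?eq)
    and "integrable lborel (\<lambda>x. \<psi> x * (far_pot N r (indicator \<Omega>) x * u x - far_pot N r u x))" (is ?int)
proof -
  let ?k = "knear N r \<tau> :: 'a \<Rightarrow> real"
  let ?K = "\<lambda>z::'a. ?k z + kfar N r z"
  let ?U = "trunc c (4 * r)"
  let ?V = "far_pot N r (indicator \<Omega>)"
  let ?f = "far_pot N r u"
  let ?G = "\<lambda>x y. indicator (cball c (2 * r)) x * ((\<bar>u x\<bar> + \<bar>u y\<bar>) * (indicator \<Omega> y * (1 / (1 + norm y powr N))))"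
  define C where "C = r powr (- N) + (3 + norm c / r) powr N"
  define D where "D = \<tau> powr (- N) * r powr N + 1"
  have CD: "0 \<le> C" "0 \<le> D"
    by (auto simp: C_def D_def)
  have B: "0 \<le> B"
    using \<psi>B[of c] by linarith
  have K0: "0 \<le> ?K z" for z
    using N_pos \<tau> by (simp add: knear_nonneg kfar_nonneg)
  have KD: "?K z \<le> D * kfar N r z" for z
    using knear_le_kfar[OF N_pos(2) \<tau> r, of z] by (simp add: D_def distrib_right)
  let ?g = "\<lambda>x y. indicator \<Omega> x * indicator \<Omega> y * ((u x - u y) * ?K (x - y)) * \<psi> x :: real"
  have gI: "integrable (lborel \<Otimes>\<^sub>M lborel) (\<lambda>(x, y). ?g x y)"
  proof (rule Bochner_Integration.integrable_bound[OF integrable_mult_right[OF far_pair_integrable[OF G r], of "B * D * C"]])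
    have "\<bar>?g x y\<bar> \<le> B * D * C * ?G x y" for x y
    proof (cases "x \<in> cball c (2 * r) \<and> y \<in> \<Omega> \<and> x \<in> \<Omega>")
      case True
      have "?K (x - y) \<le> D * (C * (1 / (1 + norm y powr N)))"
        using KD[of "x - y"] mult_left_mono[OF kfar_weight[OF r N_pos(2), of x c y] CD(2)] True
        by (auto simp: C_def)
      then have "\<bar>u x - u y\<bar> * ?K (x - y) * \<bar>\<psi> x\<bar> \<le> (\<bar>u x\<bar> + \<bar>u y\<bar>) * (D * (C * (1 / (1 + norm y powr N)))) * B"
        using K0 CD \<psi>B[of x] by (intro mult_mono mult_nonneg_nonneg) auto
      then show ?thesis
        using True K0[of "x - y"] by (simp add: abs_mult mult.commute mult.left_commute)
    next
      case False
      then have "\<bar>?g x y\<bar> = 0"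
        using \<psi>0 by (auto simp: indicator_def)
      also have "0 \<le> B * D * C * ?G x y"
        using B CD by (intro mult_nonneg_nonneg) auto
      finally show ?thesis .
    qed
    then have "norm (?g x y) \<le> norm (B * D * C * ?G x y)" for x y
      unfolding real_norm_def by (rule order_trans[OF _ abs_ge_self])
    then show "AE p in lborel \<Otimes>\<^sub>M lborel. norm (case p of (x, y) \<Rightarrow> ?g x y)
        \<le> norm (B * D * C * (case p of (x, y) \<Rightarrow> ?G x y))"
      by (intro AE_I2) (simp add: split_def)
  qed measurable
  have "(LINT (x, y)|(lborel \<Otimes>\<^sub>M lborel). indicator \<Omega> x * indicator \<Omega> y * ((u x - u y) * (\<psi> x - \<psi> y) * ?K (x - y)))
      = (LINT p|(lborel \<Otimes>\<^sub>M lborel). (case p of (x, y) \<Rightarrow> ?g x y) + (case p of (x, y) \<Rightarrow> ?g y x))"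
  proof (rule Bochner_Integration.integral_cong[OF refl])
    fix p :: "'a \<times> 'a"
    obtain x y where p: "p = (x, y)"
      by (cases p)
    have "?K (y - x) = ?K (x - y)"
      using knear_minus[of N r \<tau> "x - y"] by (simp add: kfar_minus)
    then show "(case p of (x, y) \<Rightarrow> indicator \<Omega> x * indicator \<Omega> y * ((u x - u y) * (\<psi> x - \<psi> y) * ?K (x - y))) =
        (case p of (x, y) \<Rightarrow> ?g x y) + (case p of (x, y) \<Rightarrow> ?g y x)"
      unfolding p prod.case by (simp only:) (simp add: algebra_simps)
  qed
  also have "\<dots> = (LINT (x, y)|(lborel \<Otimes>\<^sub>M lborel). ?g x y) + (LINT (x, y)|(lborel \<Otimes>\<^sub>M lborel). ?g y x)"
    by (rule Bochner_Integration.integral_add[OF gI integrable_pair_swap[OF gI]])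
  also have "(LINT (x, y)|(lborel \<Otimes>\<^sub>M lborel). ?g y x) = (LINT (x, y)|(lborel \<Otimes>\<^sub>M lborel). ?g x y)"
    using lborel_pair.integral_product_swap[OF borel_measurable_integrable[OF gI]] by (simp add: split_def)
  also have "(LINT (x, y)|(lborel \<Otimes>\<^sub>M lborel). ?g x y) = (LBINT x. (LBINT y. ?g x y))"
    using lborel_pair.integral_fst[OF gI] by simp
  finally have 1: "(LINT (x, y)|(lborel \<Otimes>\<^sub>M lborel). indicator \<Omega> x * indicator \<Omega> y * ((u x - u y) * (\<psi> x - \<psi> y) * ?K (x - y)))
     = 2 * (LBINT x. (LBINT y. ?g x y))" by simp
  have kI: "integrable lborel ?k"
    by (rule knear_integrable[OF N_pos(2) \<tau>])
  have UI: "integrable lborel ?U"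
    by (rule trunc_integrable(1)[OF G])
  have kB: "\<bar>?k z\<bar> \<le> \<tau> powr (- N)" for z
    using knear_le[OF N_pos(2) \<tau>, of r z] knear_nonneg[OF N_pos(2), of \<tau> r z] \<tau>
    by (cases "norm z < r") auto
  have inner: "(LBINT y. ?g x y) = \<psi> x * (LBINT z. ?k z * (?U x - ?U (x + z))) + \<psi> x * (?V x * u x - ?f x)" for x
  proof (cases "\<psi> x = 0")
    case False
    then have x: "x \<in> cball c (2 * r)"
      using \<psi>0 by blast
    then have xG: "x \<in> cball c (4 * r)" "x \<in> \<Omega>"
      using G r by auto
    \<comment> \<open>Where \<open>\<psi> x\<close> and the near kernel are both nonzero,
      \<open>x\<close> and \<open>y\<close> lie in the ball of radius \<open>4 * r\<close>. There
      the truncation equals \<open>u\<close> and the indicator is 1, so \<open>\<Omega>\<close>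
      disappears from the near part.\<close>
    have pw: "indicator \<Omega> y * (u x - u y) * ?k (x - y) = ?k (x - y) * (?U x - ?U y)" for y
    proof (cases "norm (x - y) < r")
      case True
      then have "y \<in> cball c (4 * r)"
        using x r dist_triangle[of c y x] by (auto simp: dist_norm)
      then show ?thesis
        using G xG by (auto simp: trunc_def)
    qed (simp add: knear_def)
    have kx: "integrable lborel (\<lambda>y. ?k (x - y))"
      using kI lborel_reflect(1)[of ?k x] by simp
    have I1: "integrable lborel (\<lambda>y. ?k (x - y) * (?U x - ?U y))"
      unfolding right_diff_distrib
      by (intro Bochner_Integration.integrable_diff integrable_mult_left kx
          integrable_bounded_mult(1)[OF UI _ kB]) simp
    have F: "integrable lborel (\<lambda>y. indicator \<Omega> y * kfar N r (x - y))" "integrable lborel (\<lambda>y. u y * kfar N r (x - y))"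
      using far_pot_integrable[OF r N_pos(2) indicator_weight] far_pot_integrable[OF r N_pos(2) u_weight] by auto
    have "(LBINT y. ?g x y) =
        (LBINT y. \<psi> x * (?k (x - y) * (?U x - ?U y)) +
          \<psi> x * (u x * (indicator \<Omega> y * kfar N r (x - y)) - u y * kfar N r (x - y)))"
    proof (rule Bochner_Integration.integral_cong[OF refl])
      fix y
      have "indicator \<Omega> y * u y = u y"
        using u_zero by (auto simp: indicator_def)
      then have "\<psi> x * (u x * (indicator \<Omega> y * kfar N r (x - y)) - u y * kfar N r (x - y)) =
        \<psi> x * (indicator \<Omega> y * (u x - u y) * kfar N r (x - y))"
        by (auto simp: algebra_simps)
      then show "?g x y = \<psi> x * (?k (x - y) * (?U x - ?U y)) +
          \<psi> x * (u x * (indicator \<Omega> y * kfar N r (x - y)) - u y * kfar N r (x - y))"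
        unfolding pw[symmetric] using xG by (simp add: algebra_simps)
    qed
    also have "\<dots> = \<psi> x * (LBINT y. ?k (x - y) * (?U x - ?U y)) + \<psi> x * (u x * ?V x - ?f x)"
      using I1 F by (simp add: far_pot_def)
    also have "(LBINT y. ?k (x - y) * (?U x - ?U y)) = (LBINT z. ?k z * (?U x - ?U (x + z)))"
      using lborel_translate(2)[of "\<lambda>y. ?k (x - y) * (?U x - ?U y)" x]
      by (simp add: knear_minus add.commute)
    finally show ?thesis
      by (simp add: mult.commute)
  qed simp
  note S = shift_form_Fubini[OF kI UI \<psi>m \<psi>B]
  have gx: "integrable lborel (\<lambda>x. (LBINT y. ?g x y))"
    using lborel_pair.integrable_fst[OF gI] by simp
  show ?int
    using Bochner_Integration.integrable_diff[OF gx S(2)] unfolding inner by simp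
  then show ?eq
    unfolding 1 inner S(1) using S(2) by simp
qed

text \<open>The truncated kernels lie below the full one and agree with it from some index on at
  each point off the diagonal, so the absolutely convergent pairing is itself the majorant. Only the
  sign of the limit is kept, which is all that the comparison uses.\<close>

lemma pairing_limit:
  assumes G: "cball c (4 * r) \<subseteq> \<Omega>" and r: "0 < r"
    and \<psi>m[measurable]: "\<psi> \<in> borel_measurable borel" and \<psi>B: "\<And>x. \<bar>\<psi> x\<bar> \<le> B" and \<psi>L: "\<And>x y. \<bar>\<psi> x - \<psi> y\<bar> \<le> L * norm (x - y)"
    and \<psi>0: "\<And>x. x \<notin> cball c (2 * r) \<Longrightarrow> \<psi> x = 0"
    and \<psi>: "\<psi> \<in> test_functions \<Omega>" "\<And>x. 0 \<le> \<psi> x"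
  obtains S where "0 \<le> S"
    "(\<lambda>m. shift_form (knear N r (inverse (Suc m))) (trunc c (4 * r)) \<psi> +
       (LBINT x. \<psi> x * (far_pot N r (indicator \<Omega>) x * u x - far_pot N r u x))) \<longlonglongrightarrow> S"
proof -
  let ?P = "lborel \<Otimes>\<^sub>M lborel :: ('a \<times> 'a) measure"
  let ?K = "\<lambda>m z::'a. knear N r (inverse (Suc m)) z + kfar N r z"
  let ?\<Phi>m = "\<lambda>m p::'a \<times> 'a. case p of (x, y) \<Rightarrow> indicator \<Omega> x * indicator \<Omega> y * ((u x - u y) * (\<psi> x - \<psi> y) * ?K m (x - y))"
  let ?\<Phi> = "\<lambda>p::'a \<times> 'a. case p of (x, y) \<Rightarrow> indicator \<Omega> x * indicator \<Omega> y * ((u x - u y) * (\<psi> x - \<psi> y) * norm (x - y) powr (- N))"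
  have I: "integrable ?P ?\<Phi>"
    by (rule pairing_integrable[OF G r \<psi>m \<psi>B \<psi>L \<psi>0])
  have "(\<lambda>m. integral\<^sup>L ?P (?\<Phi>m m)) \<longlonglongrightarrow> integral\<^sup>L ?P ?\<Phi>"
  proof (rule integral_dominated_convergence[where w = "\<lambda>p. \<bar>?\<Phi> p\<bar>"])
    have K0: "0 \<le> ?K m z" for m z
      using N_pos by (simp add: knear_nonneg kfar_nonneg)
    have Kle: "?K m z \<le> norm z powr (- N)" if "z \<noteq> 0" for m z
      using knear_mono[OF N_pos(2), of "inverse (Suc m)" r z] knear_add_kfar[OF r that, of N] by simp
    have "norm (?\<Phi>m m p) \<le> \<bar>?\<Phi> p\<bar>" for m p
    proof -
      obtain x y where p: "p = (x, y)"
        by (cases p)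
      show ?thesis
      proof (cases "x = y")
        case False
        then show ?thesis
          unfolding p prod.case real_norm_def abs_mult using K0 Kle[of "x - y" m]
          by (intro mult_left_mono) auto
      qed (simp add: p)
    qed
    then show "AE p in ?P. norm (?\<Phi>m m p) \<le> \<bar>?\<Phi> p\<bar>" for m
      by (intro AE_I2)
    have "(\<lambda>m. ?\<Phi>m m p) \<longlonglongrightarrow> ?\<Phi> p" for p
    proof -
      obtain x y where p: "p = (x, y)"
        by (cases p)
      show ?thesis
      proof (cases "x = y")
        case False
        then have "0 < norm (x - y)"
          by simp
        with LIMSEQ_inverse_real_of_nat have "eventually (\<lambda>m. inverse (Suc m) < norm (x - y)) sequentially"
          by (rule order_tendstoD(2))
        then have "eventually (\<lambda>m. ?\<Phi>m m p = ?\<Phi> p) sequentially"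
        proof eventually_elim
          case (elim m)
          then have "?K m (x - y) = norm (x - y) powr (- N)"
            using knear_add_kfar[OF r, of "x - y" N] False by (simp add: knear_def)
          then show ?case
            by (simp add: p)
        qed
        then show ?thesis
          by (rule tendsto_eventually)
      qed (simp add: p)
    qed
    then show "AE p in ?P. (\<lambda>m. ?\<Phi>m m p) \<longlonglongrightarrow> ?\<Phi> p"
      by (intro AE_I2)
  qed (use I in \<open>auto intro: borel_measurable_integrable\<close>)
  moreover have "integral\<^sup>L ?P (?\<Phi>m m) = 2 * (shift_form (knear N r (inverse (Suc m))) (trunc c (4 * r)) \<psi> +
       (LBINT x. \<psi> x * (far_pot N r (indicator \<Omega>) x * u x - far_pot N r u x)))" for m
    by (rule pairing_trunc(1)[OF G r _ \<psi>m \<psi>B \<psi>0]) auto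
  ultimately have L: "(\<lambda>m. 2 * (shift_form (knear N r (inverse (Suc m))) (trunc c (4 * r)) \<psi> +
       (LBINT x. \<psi> x * (far_pot N r (indicator \<Omega>) x * u x - far_pot N r u x)))) \<longlonglongrightarrow> integral\<^sup>L ?P ?\<Phi>"
    by simp
  have "X \<longlonglongrightarrow> l / 2" if "(\<lambda>m. 2 * X m) \<longlonglongrightarrow> l" for X and l :: real
    using tendsto_mult_left[OF that, of "1/2"] by simp
  from this[OF L] show ?thesis
    using that[of "integral\<^sup>L ?P ?\<Phi> / 2"] super[OF \<psi>] by simp
qed

end

section \<open>Comparison with a barrier\<close>

lemma conv_lipschitz:
  fixes \<phi> :: "'a::euclidean_space \<Rightarrow> real"
  assumes \<rho>: "smooth_cs \<rho>" and \<phi>: "integrable lborel \<phi>"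
  obtains L where "\<And>x y. \<bar>conv \<rho> \<phi> x - conv \<rho> \<phi> y\<bar> \<le> L * norm (x - y)"
proof -
  obtain L where L: "\<And>x y. \<bar>\<rho> x - \<rho> y\<bar> \<le> L * norm (x - y)"
    using smooth_cs_lipschitz[OF \<rho>] by metis
  have "\<bar>conv \<rho> \<phi> x - conv \<rho> \<phi> y\<bar> \<le> (L * (LBINT w. \<bar>\<phi> w\<bar>)) * norm (x - y)" for x y
  proof -
    have "conv \<rho> \<phi> x - conv \<rho> \<phi> y = (LBINT w. \<rho> (x - w) * \<phi> w - \<rho> (y - w) * \<phi> w)"
      by (simp add: conv_def conv_integrable[OF \<rho> \<phi>])
    also have "\<bar>\<dots>\<bar> \<le> (LBINT w. \<bar>\<rho> (x - w) * \<phi> w - \<rho> (y - w) * \<phi> w\<bar>)"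
      by (rule integral_abs_bound)
    also have "\<dots> \<le> (LBINT w. L * norm (x - y) * \<bar>\<phi> w\<bar>)"
    proof (rule integral_mono)
      show "\<bar>\<rho> (x - w) * \<phi> w - \<rho> (y - w) * \<phi> w\<bar> \<le> L * norm (x - y) * \<bar>\<phi> w\<bar>" for w
        using L[of "x - w" "y - w"] by (simp add: left_diff_distrib[symmetric] abs_mult mult_right_mono)
    qed (use \<phi> in \<open>auto intro!: conv_integrable[OF \<rho> \<phi>]\<close>)
    finally show ?thesis
      by (simp add: mult.commute mult.left_commute)
  qed
  then show ?thesis
    using that by blast
qed

lemma conv_nonneg:
  assumes "mollifier \<epsilon> \<rho>" "\<And>x. 0 \<le> A x"
  shows "0 \<le> conv \<rho> A x"
  using assms(2) mollifierD(2)[OF assms(1)] unfolding conv_def by (intro Bochner_Integration.integral_nonneg) auto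

lemma conv_const_near:
  assumes \<rho>: "mollifier \<epsilon> \<rho>" and A: "integrable lborel A"
    and eq: "\<And>w. norm (x - w) < \<epsilon> \<Longrightarrow> A w = M"
  shows "conv \<rho> A x = M"
proof (rule antisym)
  show "conv \<rho> A x \<le> M"
    using eq by (intro conv_le[OF \<rho> A]) auto
  have "conv \<rho> (\<lambda>w. - A w) x \<le> - M"
    using eq A by (intro conv_le[OF \<rho>]) auto
  then show "M \<le> conv \<rho> A x"
    by (simp add: conv_def)
qed

lemma conv_lincomb:
  assumes \<rho>: "smooth_cs \<rho>" and A: "integrable lborel A" and B: "integrable lborel B" and C: "integrable lborel C"
  shows "conv \<rho> (\<lambda>w. a * A w + b * B w + d * C w) x = a * conv \<rho> A x + b * conv \<rho> B x + d * conv \<rho> C x"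
proof -
  have "\<rho> (x - w) * (a * A w + b * B w + d * C w) =
      a * (\<rho> (x - w) * A w) + b * (\<rho> (x - w) * B w) + d * (\<rho> (x - w) * C w)" for w
    by (simp add: algebra_simps)
  then show ?thesis
    by (simp add: conv_def conv_integrable[OF \<rho>] A B C)
qed

context supersolution
begin

text \<open>Adding this to \<open>w\<close> gives the maximum of \<open>b\<close> and
  \<open>w\<close> on the ball and leaves \<open>w\<close> alone elsewhere. The cut-off is explicit
  because the formula for the barrier is meaningful only inside the ball.\<close>

definition excess :: "'a \<Rightarrow> real \<Rightarrow> ('a \<Rightarrow> real) \<Rightarrow> ('a \<Rightarrow> real) \<Rightarrow> 'a \<Rightarrow> real" where
  "excess c r b w x = (if x \<in> ball c r then max 0 (b x - w x) else 0)"

text \<open>\<open>b\<close> may be unbounded below: the positive part discards its large negative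
  values, so an upper bound on \<open>b\<close> and a bound on \<open>w\<close> control
  everything.\<close>

lemma excess_bounds:
  assumes b: "\<And>x. x \<in> ball c r \<Longrightarrow> b x \<le> q"
    and bm[measurable]: "(\<lambda>x. indicator (ball c r) x * b x) \<in> borel_measurable borel"
    and wm[measurable]: "w \<in> borel_measurable borel" and w: "\<And>x. \<bar>w x\<bar> \<le> M"
  shows "excess c r b w \<in> borel_measurable borel" "\<And>x. 0 \<le> excess c r b w x"
    "\<And>x. \<bar>excess c r b w x\<bar> \<le> \<bar>q\<bar> + M" "integrable lborel (excess c r b w)"
proof -
  have e: "excess c r b w = (\<lambda>x. max 0 (indicator (ball c r) x * b x - indicator (ball c r) x * w x))"
    by (auto simp: excess_def indicator_def)
  show m: "excess c r b w \<in> borel_measurable borel"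
    unfolding e by measurable
  show n: "0 \<le> excess c r b w x" for x
    by (auto simp: excess_def)
  have M: "0 \<le> M"
    using w[of c] by linarith
  have B: "excess c r b w x \<le> (\<bar>q\<bar> + M) * indicator (ball c r) x" for x
    using b[of x] w[of x] M by (auto simp: excess_def)
  show "\<bar>excess c r b w x\<bar> \<le> \<bar>q\<bar> + M" for x
    using B[of x] n[of x] M by (cases "x \<in> ball c r") auto
  show "integrable lborel (excess c r b w)"
    by (rule Bochner_Integration.integrable_bound[OF integrable_mult_right[OF integrable_indicator_ball[of c r], of "\<bar>q\<bar> + M"]])
      (use B n m M in \<open>auto intro!: AE_I2\<close>)
qed

lemma far_pot_\<Omega>_nonneg: "0 \<le> far_pot N r (indicator \<Omega>) x"
  unfolding far_pot_def by (intro Bochner_Integration.integral_nonneg) (simp add: kfar_nonneg)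

text \<open>
  The bracket is the operator, truncated at \<open>\<tau>\<close>, applied at \<open>x\<close> to \<open>max b ue\<close>. Mollification does not
  commute with the potential of the far kernel; the commutator costs the modulus of continuity \<open>\<omega>\<close>
  times a quantity bounded independently of \<open>\<epsilon>\<close>, because \<open>u\<close> is locally square integrable.
\<close>

lemma comparison_core:
  fixes b :: "'a \<Rightarrow> real"
  assumes G: "cball c (4 * r) \<subseteq> \<Omega>" and r: "0 < r" and \<rho>: "mollifier \<epsilon> \<rho>" and \<epsilon>: "\<epsilon> \<le> r"
    and bm: "(\<lambda>x. indicator (ball c r) x * b x) \<in> borel_measurable borel"
    and bq: "\<And>x. x \<in> ball c r \<Longrightarrow> b x \<le> q"
    and \<omega>: "0 \<le> \<omega>"
    and oscV: "\<And>x w. x \<in> ball c r \<Longrightarrow> norm (x - w) < \<epsilon> \<Longrightarrow>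
        \<bar>far_pot N r (indicator \<Omega>) w - far_pot N r (indicator \<Omega>) x\<bar> \<le> \<omega>"
    and oscf: "\<And>x w. x \<in> ball c r \<Longrightarrow> norm (x - w) < \<epsilon> \<Longrightarrow> \<bar>far_pot N r u w - far_pot N r u x\<bar> \<le> \<omega>"
    and ue_def: "ue = conv \<rho> (trunc c (4 * r))"
    and bracket: "\<And>m x. m \<ge> m0 \<Longrightarrow> x \<in> ball c r \<Longrightarrow> ue x < b x \<Longrightarrow>
       (LBINT z. knear N r (inverse (real (Suc m))) z * (b x - (ue (x + z) + excess c r b ue (x + z))))
       + (far_pot N r (indicator \<Omega>) x * b x - far_pot N r u x) \<le> - c0"
  shows "c0 * (LBINT x. excess c r b ue x) \<le>
    \<omega> * ((2 * \<bar>q\<bar> + 1) * measure lborel (ball c r) + (\<bar>q\<bar> + 2) * (LBINT x. (trunc c (4 * r) x)\<^sup>2))"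
proof -
  let ?U = "trunc c (4 * r)"
  let ?V = "far_pot N r (indicator \<Omega>) :: 'a \<Rightarrow> real"
  let ?f = "far_pot N r u"
  let ?k = "\<lambda>m. knear N r (inverse (real (Suc m))) :: 'a \<Rightarrow> real"
  let ?ind = "indicator (cball c (4 * r)) :: 'a \<Rightarrow> real"
  define \<phi> where "\<phi> = excess c r b ue"
  define \<psi> where "\<psi> = conv \<rho> \<phi>"
  define v where "v = (\<lambda>x. ue x + \<phi> x)"
  define a where "a = conv \<rho> (\<lambda>x. \<bar>?U x\<bar>)"
  define a2 where "a2 = conv \<rho> (\<lambda>x. (?U x)\<^sup>2)"
  note \<rho>D = mollifierD[OF \<rho>]
  have UI: "integrable lborel ?U" "integrable lborel (\<lambda>x. (?U x)\<^sup>2)" "integrable lborel (\<lambda>x. \<bar>?U x\<bar>)"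
    using trunc_integrable[OF G] by auto
  have ueI: "integrable lborel ue"
    unfolding ue_def by (rule integrable_conv[OF \<rho>D(5) UI(1)])
  then have uem[measurable]: "ue \<in> borel_measurable borel"
    by auto
  obtain M where M: "\<And>x. \<bar>ue x\<bar> \<le> M"
    using conv_bounded[OF \<rho> UI(1)] unfolding ue_def by metis
  note E = excess_bounds[where b = b and w = ue, OF bq bm uem M, folded \<phi>_def]
  have \<phi>m[measurable]: "\<phi> \<in> borel_measurable borel"
    by (rule E(1))
  have \<phi>0: "\<phi> x = 0" if "x \<notin> ball c r" for x
    using that by (simp add: \<phi>_def excess_def)
  have \<psi>m[measurable]: "\<psi> \<in> borel_measurable borel"
    using integrable_conv[OF \<rho>D(5) E(4)] by (auto simp: \<psi>_def)
  obtain B where \<psi>B: "\<And>x. \<bar>\<psi> x\<bar> \<le> B"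
    using conv_bounded[OF \<rho> E(4)] unfolding \<psi>_def by metis
  obtain L where \<psi>L: "\<And>x y. \<bar>\<psi> x - \<psi> y\<bar> \<le> L * norm (x - y)"
    using conv_lipschitz[OF \<rho>D(1) E(4)] unfolding \<psi>_def by metis
  have \<psi>0: "\<psi> x = 0" if "x \<notin> cball c (2 * r)" for x
    unfolding \<psi>_def by (rule conv_support[OF \<rho>, where c = c and R = r]) (use \<phi>0 that \<epsilon> in auto)
  have \<psi>n: "0 \<le> \<psi> x" for x
    unfolding \<psi>_def by (rule conv_nonneg[OF \<rho> E(2)])
  have "\<psi> \<in> test_functions \<Omega>"
    unfolding test_functions_def compactly_inside_def
  proof (intro CollectI conjI allI)
    show "Ck k \<psi>" for k
      unfolding \<psi>_def by (rule Ck_conv[OF E(4) \<rho>D(1)])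
    have sub: "closure {x. \<psi> x \<noteq> 0} \<subseteq> cball c (2 * r)"
      by (intro closure_minimal subsetI) (metis (mono_tags) \<psi>0 mem_Collect_eq, simp)
    then show "compact (closure {x. \<psi> x \<noteq> 0})"
      using bounded_subset[OF bounded_cball] closed_closure compact_eq_bounded_closed by blast
    show "closure {x. \<psi> x \<noteq> 0} \<subseteq> \<Omega>"
      using sub G r subset_cball[of "2 * r" "4 * r" c] by auto
  qed
  then obtain S where S: "0 \<le> S" "(\<lambda>m. shift_form (?k m) ?U \<psi> +
       (LBINT x. \<psi> x * (?V x * u x - ?f x))) \<longlonglongrightarrow> S"
    using pairing_limit[OF G r \<psi>m \<psi>B \<psi>L \<psi>0 _ \<psi>n] by blast
  \<comment> \<open>The far term, cut off to a ball containing the support of \<open>\<psi>\<close>;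
    it becomes integrable without changing its product with \<open>\<psi>\<close>, so the mollifier
    can be moved onto it.\<close>
  define H where "H = (\<lambda>x. (?ind x * ?V x) * ?U x - ?ind x * ?f x)"
  have contV: "continuous_on UNIV ?V" and contf: "continuous_on UNIV ?f"
    using far_pot_continuous[OF r N_pos(2) indicator_weight] far_pot_continuous[OF r N_pos(2) u_weight] by auto
  have [measurable]: "?V \<in> borel_measurable borel" "?f \<in> borel_measurable borel"
    using contV contf by (auto intro: borel_measurable_continuous_onI)
  obtain BV where BV: "\<And>x. x \<in> cball c (4 * r) \<Longrightarrow> \<bar>?V x\<bar> \<le> BV"
    using compact_imp_bounded[OF compact_continuous_image[OF continuous_on_subset[OF contV subset_UNIV] compact_cball[of c "4 * r"]]]
    unfolding bounded_iff by (metis imageI real_norm_def)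
  obtain Bf where Bf: "\<And>x. x \<in> cball c (4 * r) \<Longrightarrow> \<bar>?f x\<bar> \<le> Bf"
    using compact_imp_bounded[OF compact_continuous_image[OF continuous_on_subset[OF contf subset_UNIV] compact_cball[of c "4 * r"]]]
    unfolding bounded_iff by (metis imageI real_norm_def)
  have c4: "c \<in> cball c (4 * r)"
    using r by simp
  have HI: "integrable lborel H"
    unfolding H_def
  proof (intro Bochner_Integration.integrable_diff)
    show "integrable lborel (\<lambda>x. (?ind x * ?V x) * ?U x)"
      by (rule integrable_bounded_mult(1)[OF UI(1), of _ BV])
        (use BV BV[OF c4] in \<open>auto simp: indicator_def\<close>)
    have "integrable lborel (\<lambda>x. ?ind x * (?ind x * ?f x))"
      by (rule integrable_bounded_mult(2)[OF integrable_indicator_cball, of _ Bf])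
        (use Bf Bf[OF c4] in \<open>auto simp: indicator_def\<close>)
    then show "integrable lborel (\<lambda>x. ?ind x * ?f x)"
      by (rule back_subst[of "integrable lborel"]) (auto simp: indicator_def)
  qed
  have "(\<lambda>x. \<psi> x * (?V x * u x - ?f x)) = (\<lambda>x. H x * \<psi> x)"
  proof
    fix x
    show "\<psi> x * (?V x * u x - ?f x) = H x * \<psi> x"
    proof (cases "x \<in> cball c (2 * r)")
      case True
      then have "x \<in> cball c (4 * r)"
        using r by auto
      then show ?thesis
        by (simp add: H_def trunc_def)
    qed (simp add: \<psi>0)
  qed
  then have lower: "(LBINT x. \<psi> x * (?V x * u x - ?f x)) = (LBINT x. conv \<rho> H x * \<phi> x)"
    using conv_adjoint[OF \<rho> HI E(4)] by (simp add: \<psi>_def)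
  \<comment> \<open>Freezing both potentials at \<open>x\<close> costs their oscillation:
    \<open>\<omega>\<close> for the potential of \<open>u\<close>, and \<open>\<omega>\<close> times
    the average of the absolute value of \<open>u\<close> for the potential of
    \<open>\<Omega>\<close>, which multiplies \<open>u\<close>.\<close>
  have convH: "conv \<rho> H x \<le> ?V x * ue x - ?f x + \<omega> * (1 + a x)" if x: "x \<in> ball c r" for x
  proof -
    have "conv \<rho> H x \<le> conv \<rho> (\<lambda>w. ?V x * ?U w + \<omega> * \<bar>?U w\<bar> + (\<omega> - ?f x) * ?ind w) x"
    proof (rule conv_mono[OF \<rho> HI])
      show "integrable lborel (\<lambda>w. ?V x * ?U w + \<omega> * \<bar>?U w\<bar> + (\<omega> - ?f x) * ?ind w)"
        using UI integrable_indicator_cball[of c "4 * r"] by auto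
      fix w assume w: "norm (x - w) < \<epsilon>"
      have "w \<in> cball c (4 * r)"
        using w x \<epsilon> r dist_triangle[of c w x] by (auto simp: dist_norm)
      moreover have "?V w * ?U w \<le> ?V x * ?U w + \<omega> * \<bar>?U w\<bar>"
      proof -
        have "(?V w - ?V x) * ?U w \<le> \<bar>?V w - ?V x\<bar> * \<bar>?U w\<bar>"
          by (metis abs_ge_self abs_mult)
        also have "\<dots> \<le> \<omega> * \<bar>?U w\<bar>"
          using oscV[OF x w] by (intro mult_right_mono) auto
        finally show ?thesis
          by (simp add: algebra_simps)
      qed
      ultimately show "H w \<le> ?V x * ?U w + \<omega> * \<bar>?U w\<bar> + (\<omega> - ?f x) * ?ind w"
        using oscf[OF x w] by (simp add: H_def)
    qed
    also have "\<dots> = ?V x * ue x + \<omega> * a x + (\<omega> - ?f x) * conv \<rho> ?ind x"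
      unfolding ue_def a_def
      by (rule conv_lincomb[OF \<rho>D(1) UI(1) UI(3) integrable_indicator_cball])
    also have "conv \<rho> ?ind x = 1"
    proof (rule conv_const_near[OF \<rho> integrable_indicator_cball])
      fix w assume w: "norm (x - w) < \<epsilon>"
      have "w \<in> cball c (4 * r)"
        using w x \<epsilon> r dist_triangle[of c w x] by (auto simp: dist_norm)
      then show "?ind w = 1" by simp
    qed
    finally show ?thesis
      by (simp add: algebra_simps)
  qed
  have a0: "0 \<le> a x" and ua: "- ue x \<le> a x" and aa: "(a x)\<^sup>2 \<le> a2 x" for x
  proof -
    show "0 \<le> a x"
      unfolding a_def by (rule conv_nonneg[OF \<rho>]) simp
    have "conv \<rho> (\<lambda>w. - ?U w) x \<le> a x"
      unfolding a_def using UI by (intro conv_mono[OF \<rho>]) auto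
    then show "- ue x \<le> a x"
      by (simp add: ue_def conv_def)
    show "(a x)\<^sup>2 \<le> a2 x"
      using conv_square_le[OF \<rho> UI(3)] UI(2) by (simp add: a_def a2_def)
  qed
  \<comment> \<open>\<open>- ue x \<le> a x\<close> gives
    \<open>\<phi> x \<le> \<bar>q\<bar> + a x\<close>, so the product is at most quadratic in
    \<open>a x\<close>; Jensen replaces the square by \<open>a2 x\<close>, whose integral is that of
    the unmollified square.\<close>
  have \<phi>a: "\<phi> x * (1 + a x) \<le> (2 * \<bar>q\<bar> + 1) * indicator (ball c r) x + (\<bar>q\<bar> + 2) * a2 x" for x
  proof (cases "x \<in> ball c r")
    case True
    have "\<phi> x \<le> \<bar>q\<bar> + a x"
      using True bq[OF True] ua[of x] a0[of x] by (auto simp: \<phi>_def excess_def)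
    then have "\<phi> x * (1 + a x) \<le> (\<bar>q\<bar> + a x) * (1 + a x)"
      using a0[of x] by (intro mult_right_mono) auto
    also have "\<dots> = \<bar>q\<bar> + (\<bar>q\<bar> + 1) * a x + (a x)\<^sup>2"
      by (simp add: algebra_simps power2_eq_square)
    also have "\<dots> \<le> \<bar>q\<bar> + (\<bar>q\<bar> + 1) * (1 + (a x)\<^sup>2) + (a x)\<^sup>2"
    proof -
      have "2 * a x \<le> 1 + (a x)\<^sup>2"
        using zero_le_power2[of "a x - 1"] by (simp add: power2_eq_square algebra_simps)
      then have "a x \<le> 1 + (a x)\<^sup>2"
        using a0[of x] by linarith
      then show ?thesis
        by (intro add_mono mult_left_mono) auto
    qed
    also have "\<dots> = (2 * \<bar>q\<bar> + 1) + (\<bar>q\<bar> + 2) * (a x)\<^sup>2"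
      by (simp add: algebra_simps)
    also have "\<dots> \<le> (2 * \<bar>q\<bar> + 1) + (\<bar>q\<bar> + 2) * a2 x"
      using aa by (intro add_mono mult_left_mono) auto
    finally show ?thesis
      using True by simp
  next
    case False
    have "0 \<le> a2 x"
      unfolding a2_def by (rule conv_nonneg[OF \<rho>]) simp
    then show ?thesis
      using False \<phi>0 by simp
  qed
  have vI: "integrable lborel v"
    unfolding v_def by (intro Bochner_Integration.integrable_add ueI E(4))
  obtain BH where BH: "\<And>x. \<bar>conv \<rho> H x\<bar> \<le> BH"
    using conv_bounded[OF \<rho> HI] by metis
  have cHm: "conv \<rho> H \<in> borel_measurable lborel"
    using integrable_conv[OF \<rho>D(5) HI] by (rule borel_measurable_integrable)
  have a2I: "integrable lborel a2" "(LBINT x. a2 x) = (LBINT x. (?U x)\<^sup>2)"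
    unfolding a2_def using integrable_conv[OF \<rho>D(5) UI(2)] integral_conv[OF \<rho> UI(2)] by auto
  have step: "shift_form (?k m) ?U \<psi> + (LBINT x. \<psi> x * (?V x * u x - ?f x))
      \<le> - c0 * (LBINT x. \<phi> x) + \<omega> * ((2 * \<bar>q\<bar> + 1) * measure lborel (ball c r) + (\<bar>q\<bar> + 2) * (LBINT x. (?U x)\<^sup>2))"
    if m: "m \<ge> m0" for m
  proof -
    have kI: "integrable lborel (?k m)"
      by (rule knear_integrable[OF N_pos(2)]) simp
    have k0: "0 \<le> ?k m z" for z
      by (rule knear_nonneg[OF N_pos(2)]) simp
    have ue_v: "ue = (\<lambda>x. v x - \<phi> x)"
      by (simp add: v_def)
    have "shift_form (?k m) ?U \<psi> = shift_form (?k m) ue \<phi>"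
      unfolding \<psi>_def ue_def by (rule shift_form_conv[OF \<rho> UI(1) E(4)])
    also have "\<dots> = shift_form (?k m) v \<phi> - shift_form (?k m) \<phi> \<phi>"
      by (subst ue_v) (rule shift_form_diff[OF kI vI E(4) \<phi>m E(3)])
    also have "\<dots> \<le> shift_form (?k m) v \<phi>"
      using shift_form_nonneg[OF k0 E(4,3)] by simp
    also have "\<dots> = (LBINT x. \<phi> x * (LBINT z. ?k m z * (v x - v (x + z))))"
      by (rule shift_form_Fubini(1)[OF kI vI \<phi>m E(3)])
    finally have "shift_form (?k m) ?U \<psi> + (LBINT x. \<psi> x * (?V x * u x - ?f x))
      \<le> (LBINT x. \<phi> x * (LBINT z. ?k m z * (v x - v (x + z)))) + (LBINT x. conv \<rho> H x * \<phi> x)"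
      by (simp add: lower)
    also have "\<dots> = (LBINT x. \<phi> x * (LBINT z. ?k m z * (v x - v (x + z))) + conv \<rho> H x * \<phi> x)"
    proof (rule Bochner_Integration.integral_add[symmetric])
      show "integrable lborel (\<lambda>x. \<phi> x * (LBINT z. ?k m z * (v x - v (x + z))))"
        by (rule shift_form_Fubini(2)[OF kI vI \<phi>m E(3)])
      show "integrable lborel (\<lambda>x. conv \<rho> H x * \<phi> x)"
        by (rule integrable_bounded_mult(1)[OF E(4) cHm BH])
    qed
    also have "\<dots> \<le> (LBINT x. - c0 * \<phi> x + \<omega> * ((2 * \<bar>q\<bar> + 1) * indicator (ball c r) x + (\<bar>q\<bar> + 2) * a2 x))"
    proof (rule integral_mono)
      show "integrable lborel (\<lambda>x. \<phi> x * (LBINT z. ?k m z * (v x - v (x + z))) + conv \<rho> H x * \<phi> x)"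
        by (intro Bochner_Integration.integrable_add shift_form_Fubini(2)[OF kI vI \<phi>m E(3)]
            integrable_bounded_mult(1)[OF E(4) cHm BH])
      show "integrable lborel (\<lambda>x. - c0 * \<phi> x + \<omega> * ((2 * \<bar>q\<bar> + 1) * indicator (ball c r) x + (\<bar>q\<bar> + 2) * a2 x))"
        by (intro Bochner_Integration.integrable_add integrable_mult_right E(4) a2I integrable_indicator_ball)
      fix x
      show "\<phi> x * (LBINT z. ?k m z * (v x - v (x + z))) + conv \<rho> H x * \<phi> x
        \<le> - c0 * \<phi> x + \<omega> * ((2 * \<bar>q\<bar> + 1) * indicator (ball c r) x + (\<bar>q\<bar> + 2) * a2 x)"
      proof (cases "x \<in> ball c r \<and> ue x < b x")
        case True
        then have vx: "v x = b x"
          by (simp add: v_def \<phi>_def excess_def)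
        let ?J = "LBINT z. ?k m z * (v x - v (x + z))"
        have "?J + (?V x * b x - ?f x) \<le> - c0"
          unfolding vx using bracket[OF m, of x] True by (simp add: v_def \<phi>_def)
        \<comment> \<open>The mollified far term contains \<open>ue\<close>, the bracket contains
          \<open>b\<close>. The potential is nonnegative and \<open>ue x < b x\<close> at a contact
          point, so the replacement goes in the right direction.\<close>
        moreover have "?V x * ue x \<le> ?V x * b x"
          using True far_pot_\<Omega>_nonneg by (intro mult_left_mono) auto
        ultimately have "?J + conv \<rho> H x \<le> - c0 + \<omega> * (1 + a x)"
          using convH[of x] True by linarith
        then have "\<phi> x * (?J + conv \<rho> H x) \<le> \<phi> x * (- c0 + \<omega> * (1 + a x))"
          using E(2) by (rule mult_left_mono)
        also have "\<dots> = - c0 * \<phi> x + \<omega> * (\<phi> x * (1 + a x))"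
          by (simp add: algebra_simps)
        also have "\<dots> \<le> - c0 * \<phi> x + \<omega> * ((2 * \<bar>q\<bar> + 1) * indicator (ball c r) x + (\<bar>q\<bar> + 2) * a2 x)"
          using \<phi>a[of x] \<omega> by (intro add_left_mono mult_left_mono) auto
        finally show ?thesis
          by (simp add: algebra_simps)
      next
        case False
        then have z: "\<phi> x = 0"
          by (auto simp: \<phi>_def excess_def)
        have "0 \<le> \<omega> * ((2 * \<bar>q\<bar> + 1) * indicator (ball c r) x + (\<bar>q\<bar> + 2) * a2 x)"
          using \<phi>a[of x] \<omega> by (intro mult_nonneg_nonneg) (auto simp: z)
        then show ?thesis
          by (simp add: z)
      qed
    qed
    also have "\<dots> = - c0 * (LBINT x. \<phi> x) + \<omega> * ((2 * \<bar>q\<bar> + 1) * measure lborel (ball c r) + (\<bar>q\<bar> + 2) * (LBINT x. (?U x)\<^sup>2))"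
      using E(4) a2I integrable_indicator_ball[of c r] by simp
    finally show ?thesis .
  qed
  have "S \<le> - c0 * (LBINT x. \<phi> x) + \<omega> * ((2 * \<bar>q\<bar> + 1) * measure lborel (ball c r) + (\<bar>q\<bar> + 2) * (LBINT x. (?U x)\<^sup>2))"
    by (rule LIMSEQ_le_const2[OF S(2)]) (use step in blast)
  then show ?thesis
    using S(1) by (simp add: \<phi>_def)
qed

end

text \<open>Serves two purposes: passing from averages to pointwise inequalities in the comparison,
  and finding density points for the lower semicontinuous representative.\<close>

lemma lebesgue_differentiation:
  fixes F :: "'a::euclidean_space \<Rightarrow> real"
  assumes F: "integrable lborel F"
  shows "AE x in lborel. \<forall>e>0. \<exists>d>0. \<forall>h. 0 < h \<and> h < d \<longrightarrow>
    \<bar>(LBINT y. indicator (cbox x (x + h *\<^sub>R One)) y * F y) / h ^ DIM('a) - F x\<bar> < e"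
proof -
  have S: "set_integrable lborel (cbox a b) F" for a b
    unfolding set_integrable_def using integrable_bounded_mult(1)[OF F, of "indicator (cbox a b)" 1]
    by (simp add: indicator_def)
  then have "F integrable_on cbox a b" for a b
    by (rule set_borel_integral_eq_integral)
  then obtain N where N: "negligible N"
    "\<And>x e. \<lbrakk>x \<notin> N; 0 < e\<rbrakk> \<Longrightarrow> \<exists>d>0. \<forall>h. 0 < h \<and> h < d \<longrightarrow>
        norm (integral (cbox x (x + h *\<^sub>R One)) F /\<^sub>R h ^ DIM('a) - F x) < e"
    using integrable_ccontinuous_explicit[of F] by metis
  have "AE x in lebesgue. x \<notin> N"
    using N(1) by (simp add: negligible_iff_null_sets AE_not_in)
  then have "AE x in lborel. x \<notin> N"
    by (simp add: AE_completion_iff)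
  then show ?thesis
  proof (rule eventually_mono)
    fix x assume x: "x \<notin> N"
    show "\<forall>e>0. \<exists>d>0. \<forall>h. 0 < h \<and> h < d \<longrightarrow>
    \<bar>(LBINT y. indicator (cbox x (x + h *\<^sub>R One)) y * F y) / h ^ DIM('a) - F x\<bar> < e"
      using N(2)[OF x] set_borel_integral_eq_integral(2)[OF S]
      by (simp add: set_lebesgue_integral_def divide_inverse mult.commute)
  qed
qed

lemma cbox_cube_subset:
  fixes x y :: "'a::euclidean_space"
  assumes "0 \<le> h" "y \<in> cbox x (x + h *\<^sub>R One)"
  shows "dist x y \<le> h * real DIM('a)"
proof -
  have "dist x y = norm (y - x)"
    by (simp add: dist_norm norm_minus_commute)
  also have "\<dots> \<le> (\<Sum>b\<in>Basis. \<bar>(y - x) \<bullet> b\<bar>)"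
    by (rule norm_le_l1)
  also have "\<dots> \<le> (\<Sum>b\<in>(Basis :: 'a set). h)"
    using assms by (intro sum_mono) (auto simp: mem_box inner_simps)
  finally show ?thesis
    by (simp add: mult.commute)
qed

context supersolution
begin

lemma far_pot_osc:
  assumes r: "0 < r" and \<eta>: "0 < \<eta>" and g: "integrable lborel (\<lambda>y. g y * (1 / (1 + norm y powr N)))"
    and gm: "g \<in> borel_measurable borel"
  obtains \<delta> where "0 < \<delta>" "\<And>x w. x \<in> ball c r \<Longrightarrow> norm (x - w) < \<delta> \<Longrightarrow> \<bar>far_pot N r g w - far_pot N r g x\<bar> \<le> \<eta>"
proof -
  have "uniformly_continuous_on (cball c (2 * r)) (far_pot N r g)"
    by (intro compact_uniformly_continuous continuous_on_subset[OF far_pot_continuous[OF r N_pos(2) g gm]]) auto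
  then obtain d where d: "d > 0" "\<And>x w. x \<in> cball c (2 * r) \<Longrightarrow> w \<in> cball c (2 * r) \<Longrightarrow> dist w x < d \<Longrightarrow>
      dist (far_pot N r g w) (far_pot N r g x) < \<eta>"
    unfolding uniformly_continuous_on_def using \<eta> by metis
  show ?thesis
  proof (rule that[of "min d r"])
    fix x w assume x: "x \<in> ball c r" and w: "norm (x - w) < min d r"
    have "x \<in> cball c (2 * r)" "w \<in> cball c (2 * r)"
      using x w dist_triangle[of c w x] r by (auto simp: dist_norm)
    then show "\<bar>far_pot N r g w - far_pot N r g x\<bar> \<le> \<eta>"
      using d(2)[of x w] w by (auto simp: dist_norm norm_minus_commute)
  qed (use d r in auto)
qed

text \<open>The margin \<open>c0\<close> is the same for all mollifiers, whereas the commutator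
  error vanishes with their radius; so the integral of the excess tends to zero. Averages over boxes
  pass to the limit, and differentiation gives the pointwise inequality. The index \<open>m0\<close>
  may depend on the mollifier because the truncation limit is taken first.\<close>

lemma comparison:
  fixes b :: "'a \<Rightarrow> real"
  assumes G: "cball c (4 * r) \<subseteq> \<Omega>" and r: "0 < r"
    and bc: "continuous_on (ball c r) b"
    and bq: "\<And>x. x \<in> ball c r \<Longrightarrow> b x \<le> q"
    and c0: "0 < c0"
    and bracket: "\<And>\<epsilon> \<rho> ue. 0 < \<epsilon> \<Longrightarrow> \<epsilon> \<le> r \<Longrightarrow> mollifier \<epsilon> \<rho> \<Longrightarrow> ue = conv \<rho> (trunc c (4 * r)) \<Longrightarrow>
      \<exists>m0. \<forall>m x. m \<ge> m0 \<longrightarrow> x \<in> ball c r \<longrightarrow> ue x < b x \<longrightarrow>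
       (LBINT z. knear N r (inverse (real (Suc m))) z * (b x - (ue (x + z) + excess c r b ue (x + z))))
       + (far_pot N r (indicator \<Omega>) x * b x - far_pot N r u x) \<le> - c0"
  shows "AE x in lborel. x \<in> ball c r \<longrightarrow> b x \<le> u x"
proof -
  let ?U = "trunc c (4 * r)"
  define C where "C = (2 * \<bar>q\<bar> + 1) * measure lborel (ball c r) + (\<bar>q\<bar> + 2) * (LBINT x. (?U x)\<^sup>2)"
  have C: "0 \<le> C"
    by (simp add: C_def add_nonneg_nonneg)
  have bm[measurable]: "(\<lambda>x. indicator (ball c r) x * b x) \<in> borel_measurable borel"
    using borel_measurable_continuous_on_indicator[OF _ bc] by simp
  have UI: "integrable lborel ?U"
    by (rule trunc_integrable(1)[OF G])
  have "\<forall>j. \<exists>\<rho>::'a \<Rightarrow> real. mollifier (r / real (Suc j)) \<rho>"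
    using r by (intro allI mollifier_exists) simp
  then obtain \<rho> :: "nat \<Rightarrow> 'a \<Rightarrow> real" where \<rho>: "\<And>j. mollifier (r / real (Suc j)) (\<rho> j)"
    by metis
  define ue where "ue j = conv (\<rho> j) ?U" for j
  define I where "I j = (LBINT x. excess c r b (ue j) x)" for j
  have ueI: "integrable lborel (ue j)" for j
    unfolding ue_def by (rule integrable_conv[OF mollifierD(5)[OF \<rho>] UI])
  have EI: "integrable lborel (excess c r b (ue j))" for j
  proof -
    obtain M where "\<And>x. \<bar>ue j x\<bar> \<le> M"
      using conv_bounded[OF \<rho> UI] unfolding ue_def by metis
    then show ?thesis
      using ueI[of j] by (intro excess_bounds(4)[OF bq bm]) auto
  qed
  have E0: "0 \<le> excess c r b w x" for w x
    by (simp add: excess_def)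
  have I0: "0 \<le> I j" for j
    unfolding I_def using E0 by (intro Bochner_Integration.integral_nonneg) auto
  have rj: "(\<lambda>j. r / real (Suc j)) \<longlonglongrightarrow> 0"
    using tendsto_mult_left[OF LIMSEQ_inverse_real_of_nat, of r] by (simp add: divide_inverse)
  have Ilim: "I \<longlonglongrightarrow> 0"
  proof (rule LIMSEQ_I)
    fix e :: real assume e: "0 < e"
    \<comment> \<open>Makes the error \<open>\<eta> * C\<close> at most \<open>c0 * e / 2\<close>;
      the summand 1 covers the case \<open>C = 0\<close>.\<close>
    define \<eta> where "\<eta> = c0 * e / (2 * (C + 1))"
    have \<eta>: "0 < \<eta>"
      using c0 e C by (simp add: \<eta>_def)
    obtain d1 where d1: "0 < d1" "\<And>x w. x \<in> ball c r \<Longrightarrow> norm (x - w) < d1 \<Longrightarrow>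
        \<bar>far_pot N r (indicator \<Omega>) w - far_pot N r (indicator \<Omega>) x\<bar> \<le> \<eta>"
      using far_pot_osc[OF r \<eta> indicator_weight, where c = c] by auto
    obtain d2 where d2: "0 < d2" "\<And>x w. x \<in> ball c r \<Longrightarrow> norm (x - w) < d2 \<Longrightarrow>
        \<bar>far_pot N r u w - far_pot N r u x\<bar> \<le> \<eta>"
      using far_pot_osc[OF r \<eta> u_weight u_meas, where c = c] by auto
    have "eventually (\<lambda>j. r / real (Suc j) < min d1 d2) sequentially"
      using rj d1(1) d2(1) by (intro order_tendstoD(2)) auto
    then obtain j0 where j0: "\<And>j. j \<ge> j0 \<Longrightarrow> r / real (Suc j) < min d1 d2"
      by (auto simp: eventually_sequentially)
    have "norm (I j - 0) < e" if j: "j \<ge> j0" for j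
    proof -
      have rjr: "r / real (Suc j) \<le> r" "0 < r / real (Suc j)"
        using r by (auto simp: field_simps)
      obtain m0 where m0: "\<forall>m x. m \<ge> m0 \<longrightarrow> x \<in> ball c r \<longrightarrow> ue j x < b x \<longrightarrow>
         (LBINT z. knear N r (inverse (real (Suc m))) z * (b x - (ue j (x + z) + excess c r b (ue j) (x + z))))
         + (far_pot N r (indicator \<Omega>) x * b x - far_pot N r u x) \<le> - c0"
        using bracket[OF rjr(2,1) \<rho> ue_def] by (rule exE)
      have "c0 * I j \<le> \<eta> * C"
        unfolding I_def C_def
        by (rule comparison_core[OF G r \<rho> rjr(1) bm bq less_imp_le[OF \<eta>] _ _ ue_def m0[rule_format]])
          (use d1(2) d2(2) j0[OF j] in auto)
      also have "\<dots> < c0 * e"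
      proof -
        have "\<eta> * C \<le> \<eta> * (C + 1)"
          using \<eta> by (intro mult_left_mono) auto
        also have "\<dots> = c0 * e / 2"
          using C by (simp add: \<eta>_def field_simps)
        also have "\<dots> < c0 * e"
          using c0 e by simp
        finally show ?thesis .
      qed
      finally show ?thesis
        using c0 I0[of j] by simp
    qed
    then show "\<exists>no. \<forall>n\<ge>no. norm (I n - 0) < e"
      by blast
  qed
  \<comment> \<open>The mollifier is moved onto the indicator of the box. At each point off the
    boundary of the box the mollified indicator equals the indicator once the radius is small, and
    the boundary is a null set.\<close>
  have box: "(LBINT x. indicator (cbox p p') x * b x) \<le> (LBINT x. indicator (cbox p p') x * ?U x)"
    if Q: "cbox p p' \<subseteq> ball c r" for p p'
  proof -
    let ?Q = "indicator (cbox p p') :: 'a \<Rightarrow> real"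
    have QI: "integrable lborel ?Q"
      using emeasure_bounded_finite[OF bounded_cbox[of p p']] by (intro integrable_real_indicator) auto
    have Qb: "integrable lborel (\<lambda>x. ?Q x * b x)"
      using borel_integrable_compact[of "cbox p p'" b] continuous_on_subset[OF bc Q] by simp
    have Que: "integrable lborel (\<lambda>x. ?Q x * ue j x)" for j
      by (rule integrable_bounded_mult(1)[OF ueI, of _ 1]) (auto simp: indicator_def)
    have "(LBINT x. ?Q x * b x) - (LBINT x. ?Q x * ue j x) \<le> I j" for j
    proof -
      have "(LBINT x. ?Q x * b x - ?Q x * ue j x) \<le> I j"
        unfolding I_def
      proof (rule integral_mono)
        show "?Q x * b x - ?Q x * ue j x \<le> excess c r b (ue j) x" for x
          using Q E0[of "ue j" x] by (auto simp: indicator_def excess_def)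
      qed (use Qb Que EI in auto)
      then show ?thesis
        using Qb Que by simp
    qed
    then have 1: "(LBINT x. ?Q x * b x) - I j \<le> (LBINT x. ?Q x * ue j x)" for j
      by (simp add: algebra_simps)
    have "(LBINT x. ?Q x * ue j x) = (LBINT x. conv (\<rho> j) ?Q x * ?U x)" for j
      unfolding ue_def by (rule conv_adjoint[OF \<rho> QI UI])
    moreover have "(\<lambda>j. LBINT x. conv (\<rho> j) ?Q x * ?U x) \<longlonglongrightarrow> (LBINT x. ?Q x * ?U x)"
    proof (rule integral_dominated_convergence[where w = "\<lambda>x. \<bar>?U x\<bar>"])
      have "AE x in lebesgue. x \<notin> cbox p p' - box p p'"
        using negligible_frontier_interval[of p p'] by (simp add: negligible_iff_null_sets AE_not_in del: Diff_iff)
      then have "AE x in lborel. x \<notin> cbox p p' - box p p'"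
        by (simp only: AE_completion_iff)
      then show "AE x in lborel. (\<lambda>j. conv (\<rho> j) ?Q x * ?U x) \<longlonglongrightarrow> ?Q x * ?U x"
      proof (rule eventually_mono)
        fix x assume x: "x \<notin> cbox p p' - box p p'"
        obtain d where d: "d > 0" "\<And>w. norm (x - w) < d \<Longrightarrow> ?Q w = ?Q x"
        proof (cases "x \<in> box p p'")
          case True
          then obtain d where "d > 0" "ball x d \<subseteq> box p p'"
            using open_contains_ball open_box by metis
          moreover have "box p p' \<subseteq> cbox p p'"
            by (rule box_subset_cbox)
          ultimately show ?thesis
            using True by (intro that[of d]) (auto simp: dist_norm subset_eq indicator_def)
        next
          case False
          then have "x \<in> - cbox p p'"
            using x by auto
          then obtain d where "d > 0" "ball x d \<subseteq> - cbox p p'"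
            using open_contains_ball open_Compl[OF closed_cbox] by metis
          then show ?thesis
            using \<open>x \<in> - cbox p p'\<close> by (intro that[of d]) (auto simp: dist_norm subset_eq indicator_def)
        qed
        have "eventually (\<lambda>j. r / real (Suc j) < d) sequentially"
          using rj d(1) by (rule order_tendstoD(2))
        then have "eventually (\<lambda>j. conv (\<rho> j) ?Q x * ?U x = ?Q x * ?U x) sequentially"
        proof eventually_elim
          case (elim j)
          have "conv (\<rho> j) ?Q x = ?Q x"
            by (rule conv_const_near[OF \<rho> QI]) (use d(2) elim in auto)
          then show ?case by simp
        qed
        then show "(\<lambda>j. conv (\<rho> j) ?Q x * ?U x) \<longlonglongrightarrow> ?Q x * ?U x"
          by (rule tendsto_eventually)
      qed
      show "AE x in lborel. norm (conv (\<rho> j) ?Q x * ?U x) \<le> \<bar>?U x\<bar>" for j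
      proof (rule AE_I2)
        fix x
        have "conv (\<rho> j) ?Q x \<le> 1"
          by (rule conv_le[OF \<rho> QI]) (simp add: indicator_def)
        moreover have "0 \<le> conv (\<rho> j) ?Q x"
          by (rule conv_nonneg[OF \<rho>]) simp
        ultimately show "norm (conv (\<rho> j) ?Q x * ?U x) \<le> \<bar>?U x\<bar>"
          by (simp add: abs_mult mult_left_le_one_le)
      qed
      show "(\<lambda>x. conv (\<rho> j) ?Q x * ?U x) \<in> borel_measurable lborel" for j
        using integrable_conv[OF mollifierD(5)[OF \<rho>] QI, of j] by auto
    qed (use UI in auto)
    ultimately have "(\<lambda>j. LBINT x. ?Q x * ue j x) \<longlonglongrightarrow> (LBINT x. ?Q x * ?U x)"
      by simp
    moreover have "(\<lambda>j. (LBINT x. ?Q x * b x) - I j) \<longlonglongrightarrow> (LBINT x. ?Q x * b x) - 0"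
      by (intro tendsto_diff tendsto_const Ilim)
    ultimately show ?thesis
      using 1 by (intro LIMSEQ_le[of "\<lambda>j. (LBINT x. ?Q x * b x) - I j" _ "\<lambda>j. LBINT x. ?Q x * ue j x"]) auto
  qed
  \<comment> \<open>\<open>b\<close> may be unbounded near the sphere, so it is integrated only over
    smaller concentric balls; countably many of them exhaust the ball.\<close>
  have sub: "AE x in lborel. x \<in> ball c r' \<longrightarrow> b x \<le> u x" if r': "r' < r" for r'
  proof -
    let ?B = "indicator (cball c r') :: 'a \<Rightarrow> real"
    have sub: "cball c r' \<subseteq> ball c r"
      using r' by auto
    have Bb: "integrable lborel (\<lambda>x. ?B x * b x)"
      using borel_integrable_compact[of "cball c r'" b] continuous_on_subset[OF bc sub] by simp
    have BU: "integrable lborel (\<lambda>x. ?B x * ?U x)"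
      by (rule integrable_bounded_mult(1)[OF UI, of _ 1]) (auto simp: indicator_def)
    have FI: "integrable lborel (\<lambda>x. ?B x * b x - ?B x * ?U x)"
      using Bb BU by auto
    show ?thesis
    proof (rule eventually_mono[OF lebesgue_differentiation[OF FI]], intro impI)
      fix x assume D: "\<forall>e>0. \<exists>d>0. \<forall>h. 0 < h \<and> h < d \<longrightarrow>
          \<bar>(LBINT y. indicator (cbox x (x + h *\<^sub>R One)) y * (?B y * b y - ?B y * ?U y)) / h ^ DIM('a)
            - (?B x * b x - ?B x * ?U x)\<bar> < e"
        and x: "x \<in> ball c r'"
      have xr: "x \<in> cball c (4 * r)"
        using x r r' by auto
      show "b x \<le> u x"
      proof (rule ccontr)
        assume "\<not> b x \<le> u x"
        then have e: "0 < b x - u x" by simp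
        then obtain d where d: "d > 0" "\<And>h. 0 < h \<and> h < d \<Longrightarrow>
          \<bar>(LBINT y. indicator (cbox x (x + h *\<^sub>R One)) y * (?B y * b y - ?B y * ?U y)) / h ^ DIM('a)
            - (?B x * b x - ?B x * ?U x)\<bar> < b x - u x"
          using D by blast
        \<comment> \<open>The first bound gives \<open>h < d\<close>. The second keeps the cube
          inside the smaller ball, since its points are within \<open>h * real DIM('a)\<close> of
          \<open>x\<close>.\<close>
        define h where "h = min (d / 2) ((r' - dist c x) / real DIM('a))"
        have h: "0 < h" "h < d"
        proof -
          have "h \<le> d / 2"
            unfolding h_def by (rule min.cobounded1)
          then show "h < d"
            using d(1) by linarith
          show "0 < h"
            using d(1) x by (simp add: h_def)
        qed
        have hr: "h * real DIM('a) \<le> r' - dist c x"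
        proof -
          have "h \<le> (r' - dist c x) / real DIM('a)"
            unfolding h_def by (rule min.cobounded2)
          then show ?thesis
            by (simp add: field_simps)
        qed
        have Q: "cbox x (x + h *\<^sub>R One) \<subseteq> cball c r'"
        proof
          fix y assume "y \<in> cbox x (x + h *\<^sub>R One)"
          then have "dist x y \<le> h * real DIM('a)"
            using h by (intro cbox_cube_subset) auto
          then show "y \<in> cball c r'"
            using hr dist_triangle[of c y x] by simp
        qed
        let ?Q = "indicator (cbox x (x + h *\<^sub>R One)) :: 'a \<Rightarrow> real"
        have "(LBINT y. ?Q y * (?B y * b y - ?B y * ?U y)) = (LBINT y. ?Q y * b y - ?Q y * ?U y)"
          by (rule Bochner_Integration.integral_cong[OF refl]) (use Q in \<open>auto simp: indicator_def\<close>)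
        also have "\<dots> = (LBINT y. ?Q y * b y) - (LBINT y. ?Q y * ?U y)"
        proof (rule Bochner_Integration.integral_diff)
          show "integrable lborel (\<lambda>y. ?Q y * b y)"
            using borel_integrable_compact[of "cbox x (x + h *\<^sub>R One)" b] continuous_on_subset[OF bc] Q sub by simp
          show "integrable lborel (\<lambda>x. ?Q x * ?U x)"
            by (rule integrable_bounded_mult(1)[OF UI, of _ 1]) (auto simp: indicator_def)
        qed
        also have "\<dots> \<le> 0"
          using box[of x "x + h *\<^sub>R One"] Q sub by simp
        finally have "(LBINT y. ?Q y * (?B y * b y - ?B y * ?U y)) / h ^ DIM('a) \<le> 0"
          using h by (simp add: divide_nonpos_pos)
        moreover have "?B x * b x - ?B x * ?U x = b x - u x"
          using x xr by (simp add: trunc_def)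
        ultimately show False
          using d(2)[of h] h e by linarith
      qed
    qed
  qed
  have "AE x in lborel. \<forall>k::nat. x \<in> ball c (r - inverse (Suc k)) \<longrightarrow> b x \<le> u x"
    by (subst AE_all_countable, intro allI sub) simp
  then show ?thesis
  proof (rule eventually_mono, intro impI)
    fix x assume A: "\<forall>k::nat. x \<in> ball c (r - inverse (Suc k)) \<longrightarrow> b x \<le> u x" and x: "x \<in> ball c r"
    obtain k :: nat where "inverse (Suc k) < r - dist c x"
      using reals_Archimedean[of "r - dist c x"] x by auto
    then have "x \<in> ball c (r - inverse (Suc k))"
      by simp
    then show "b x \<le> u x"
      using A by blast
  qed
qed

end

section \<open>The kernel bounds as Bochner integrals\<close>

lemma inner_kernel_integral:
  assumes s: "0 < s" "s < 1"
  shows "\<exists>C\<ge>0. \<forall>R>0.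
    integrable lborel (\<lambda>z::'a::euclidean_space. indicator (ball 0 R) z * ((norm z)\<^sup>2 * norm z powr (- (real DIM('a) + 2 * s)))) \<and>
    (LBINT z::'a. indicator (ball 0 R) z * ((norm z)\<^sup>2 * norm z powr (- (real DIM('a) + 2 * s)))) \<le> C * R powr (2 - 2 * s)"
proof -
  let ?N = "real DIM('a) + 2 * s"
  obtain C where C: "0 \<le> C" "\<And>R. R > 0 \<Longrightarrow> (\<integral>\<^sup>+z. ennreal (indicator (ball (0::'a) R) z *
      ((norm z)\<^sup>2 / norm z powr ?N)) \<partial>lborel) \<le> ennreal (C * R powr (2 - 2 * s))"
    using nn_integral_norm_powr_inner[OF s, where 'a='a] by auto
  have e: "(norm z)\<^sup>2 / norm z powr ?N = (norm z)\<^sup>2 * norm z powr (- ?N)" for z :: 'a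
    unfolding powr_minus by (rule divide_inverse)
  note C2 = C(2)[unfolded e]
  show ?thesis
  proof (intro exI[of _ C] conjI allI impI C(1))
    fix R :: real assume R: "0 < R"
    have "(\<lambda>z::'a. (norm z)\<^sup>2) \<in> borel_measurable borel"
      by (intro borel_measurable_power) simp
    moreover have "(\<lambda>z::'a. norm z powr (- ?N)) \<in> borel_measurable borel"
      by simp
    ultimately have "(\<lambda>z::'a. indicator (ball 0 R) z * ((norm z)\<^sup>2 * norm z powr (- ?N))) \<in> borel_measurable lborel"
      by (intro borel_measurable_times borel_measurable_indicator) auto
    moreover have "(\<integral>\<^sup>+z. ennreal (indicator (ball (0::'a) R) z * ((norm z)\<^sup>2 * norm z powr (- ?N))) \<partial>lborel) < \<infinity>"
      using C2[OF R] by (simp add: order_le_less_trans[OF _ ennreal_less_top])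
    ultimately show "integrable lborel (\<lambda>z::'a. indicator (ball 0 R) z * ((norm z)\<^sup>2 * norm z powr (- ?N)))"
      by (intro integrableI_nonneg) auto
    show "(LBINT z::'a. indicator (ball 0 R) z * ((norm z)\<^sup>2 * norm z powr (- ?N))) \<le> C * R powr (2 - 2 * s)"
      by (rule integral_real_bounded[OF _ C2[OF R]]) (use C(1) in simp)
  qed
qed

lemma outer_kernel_integral:
  assumes s: "0 < s"
  shows "\<exists>C\<ge>0. \<forall>R>0.
    integrable lborel (\<lambda>z::'a::euclidean_space. indicator (- ball 0 R) z * norm z powr (- (real DIM('a) + 2 * s))) \<and>
    (LBINT z::'a. indicator (- ball 0 R) z * norm z powr (- (real DIM('a) + 2 * s))) \<le> C * R powr (- 2 * s)"
proof -
  let ?N = "real DIM('a) + 2 * s"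
  obtain C where C: "0 \<le> C" "\<And>R. R > 0 \<Longrightarrow> (\<integral>\<^sup>+z. ennreal (indicator (- ball (0::'a) R) z /
      norm z powr ?N) \<partial>lborel) \<le> ennreal (C * R powr (- 2 * s))"
    using nn_integral_norm_powr_outer[OF s, where 'a='a] by auto
  have e: "(indicator (- ball 0 R) z :: real) / norm z powr ?N = indicator (- ball 0 R) z * norm z powr (- ?N)" for z :: 'a and R
    unfolding powr_minus by (rule divide_inverse)
  note C2 = C(2)[unfolded e]
  show ?thesis
  proof (intro exI[of _ C] conjI allI impI C(1))
    fix R :: real assume R: "0 < R"
    have "(\<lambda>z::'a. norm z powr (- ?N)) \<in> borel_measurable borel"
      by simp
    then have "(\<lambda>z::'a. indicator (- ball 0 R) z * norm z powr (- ?N)) \<in> borel_measurable lborel"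
      by (intro borel_measurable_times borel_measurable_indicator) auto
    moreover have "(\<integral>\<^sup>+z. ennreal (indicator (- ball (0::'a) R) z * norm z powr (- ?N)) \<partial>lborel) < \<infinity>"
      using C2[OF R] by (simp add: order_le_less_trans[OF _ ennreal_less_top])
    ultimately show "integrable lborel (\<lambda>z::'a. indicator (- ball 0 R) z * norm z powr (- ?N))"
      by (intro integrableI_nonneg) auto
    show "(LBINT z::'a. indicator (- ball 0 R) z * norm z powr (- ?N)) \<le> C * R powr (- 2 * s)"
      by (rule integral_real_bounded[OF _ C2[OF R]]) (use C(1) in simp)
  qed
qed

section \<open>The barrier\<close>

text \<open>The induction multiplies by \<open>inverse (1 - a) \<le> 1 + a + 2 * a\<^sup>2\<close>.
  The linear coefficient has to be exact, because the linear part is later removed by symmetry,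
  while everything of second order is merely estimated.\<close>

lemma inverse_power_quadratic_bound:
  "\<exists>C\<ge>0. \<forall>a::real. \<bar>a\<bar> \<le> 1 / 2 \<longrightarrow> inverse ((1 - a) ^ n) \<le> 1 + real n * a + C * a\<^sup>2"
proof (induction n)
  case 0
  show ?case
    by (intro exI[of _ 0]) simp
next
  case (Suc n)
  then obtain C where C: "0 \<le> C" "\<And>a::real. \<bar>a\<bar> \<le> 1 / 2 \<Longrightarrow> inverse ((1 - a) ^ n) \<le> 1 + real n * a + C * a\<^sup>2"
    by auto
  \<comment> \<open>Bounds the factor left after extracting \<open>a\<^sup>2\<close> from the
    product: with \<open>\<bar>a\<bar> \<le> 1 / 2\<close> its terms in \<open>a\<close> and
    \<open>a\<^sup>2\<close> add at most \<open>real n + C / 2\<close> and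
    \<open>C / 2\<close>.\<close>
  define D where "D = 2 + 2 * real n + 2 * C"
  have "inverse ((1 - a) ^ Suc n) \<le> 1 + real (Suc n) * a + D * a\<^sup>2" if a: "\<bar>a\<bar> \<le> 1 / 2" for a :: real
  proof -
    have i: "inverse (1 - a) \<le> 1 + a + 2 * a\<^sup>2"
    proof -
      have "(1 + a + 2 * a\<^sup>2) * (1 - a) = 1 + a\<^sup>2 * (1 - 2 * a)"
        by (simp add: algebra_simps power2_eq_square)
      moreover have "0 \<le> a\<^sup>2 * (1 - 2 * a)"
        using a by (intro mult_nonneg_nonneg) auto
      ultimately show ?thesis
        using a unfolding inverse_eq_divide by (subst pos_divide_le_eq) auto
    qed
    have p: "0 < inverse ((1 - a) ^ n)"
      using a by auto
    have "inverse ((1 - a) ^ Suc n) = inverse ((1 - a) ^ n) * inverse (1 - a)"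
      by simp
    also have "\<dots> \<le> (1 + real n * a + C * a\<^sup>2) * (1 + a + 2 * a\<^sup>2)"
    proof (rule mult_mono[OF C(2)[OF a] i])
      show "0 \<le> 1 + real n * a + C * a\<^sup>2"
        using p C(2)[OF a] by linarith
    qed (use a in simp)
    also have "\<dots> = 1 + real (Suc n) * a + a\<^sup>2 * (2 + real n + C + a * (2 * real n + C) + a\<^sup>2 * (2 * C))"
      by (simp add: algebra_simps power2_eq_square)
    also have "\<dots> \<le> 1 + real (Suc n) * a + a\<^sup>2 * D"
    proof (intro add_left_mono mult_left_mono)
      have "a * (2 * real n + C) \<le> 1 / 2 * (2 * real n + C)"
        using a C(1) by (intro mult_right_mono) auto
      moreover have "a\<^sup>2 * (2 * C) \<le> (1 / 2)\<^sup>2 * (2 * C)"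
        using power_mono[OF a abs_ge_zero, of 2] C(1) by (intro mult_right_mono) auto
      ultimately show "2 + real n + C + a * (2 * real n + C) + a\<^sup>2 * (2 * C) \<le> D"
        using C(1) by (simp add: D_def power2_eq_square)
    qed simp
    finally show ?thesis
      by (simp add: mult.commute)
  qed
  moreover have "0 \<le> D"
    using C(1) by (simp add: D_def)
  ultimately show ?case
    by blast
qed

text \<open>
  The exponent is the dimension, so that near the boundary the mass \<open>barrier * d ^ DIM('a)\<close> in a ball
  of radius comparable to the distance \<open>d\<close> stays comparable to \<open>r ^ DIM('a)\<close>: an integral bound on
  the deficit is then scaled correctly at every depth.
\<close>

definition barrier :: "'a::euclidean_space \<Rightarrow> real \<Rightarrow> 'a \<Rightarrow> real" where
  "barrier c r x = inverse ((1 - (norm (x - c))\<^sup>2 / r\<^sup>2) ^ DIM('a))"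

lemma barrier_base:
  assumes x: "x \<in> ball c r"
  shows "0 < 1 - (norm (x - c))\<^sup>2 / r\<^sup>2"
proof -
  have "norm (x - c) < r"
    using x by (simp add: dist_norm norm_minus_commute)
  then have "(norm (x - c))\<^sup>2 < r\<^sup>2"
    by (intro power_strict_mono) auto
  then show ?thesis
    by (auto simp: divide_less_eq)
qed

lemma barrier_ge_1:
  assumes x: "x \<in> ball c r"
  shows "1 \<le> barrier c r x"
proof -
  have "(1 - (norm (x - c))\<^sup>2 / r\<^sup>2) ^ n \<le> 1" for n
    using barrier_base[OF x] by (intro power_le_one) auto
  then show ?thesis
    unfolding barrier_def using barrier_base[OF x] by (intro one_le_inverse) auto
qed

lemma barrier_continuous: "continuous_on (ball c r) (barrier c r)"
  unfolding barrier_def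
proof (intro continuous_intros ballI)
  show "(1 - (norm (x - c))\<^sup>2 / r\<^sup>2) ^ DIM('a) \<noteq> 0" if "x \<in> ball c r" for x
    using barrier_base[OF that] by (metis less_irrefl power_not_zero)
qed (use barrier_base in force)+

text \<open>With \<open>R = norm (x - c)\<close> the base of the power factors as
  \<open>(r - R) * (r + R) / r\<^sup>2\<close>, which is at most \<open>2 * d / r\<close>. This
  converts depth into size, and conversely a bound on the barrier into a bound on the depth.\<close>

lemma barrier_lower:
  fixes c :: "'a::euclidean_space"
  assumes x: "x \<in> ball c r" and d: "d = r - norm (x - c)"
  shows "(r / (2 * d)) ^ DIM('a) \<le> barrier c r x"
proof -
  have "norm (x - c) < r"
    using x by (simp add: dist_norm norm_minus_commute)
  then have d0: "0 < d" and r0: "0 < r"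
    using norm_ge_zero[of "x - c"] unfolding d by linarith+
  have "(1 - (norm (x - c))\<^sup>2 / r\<^sup>2) = (r - norm (x - c)) * (r + norm (x - c)) / r\<^sup>2"
    using r0 by (simp add: field_simps power2_eq_square)
  also have "\<dots> \<le> d * (2 * r) / r\<^sup>2"
    using d0 r0 by (intro divide_right_mono mult_mono) (auto simp: d)
  also have "\<dots> = 2 * d / r"
    using r0 by (simp add: power2_eq_square)
  finally have "(1 - (norm (x - c))\<^sup>2 / r\<^sup>2) ^ DIM('a) \<le> (2 * d / r) ^ DIM('a)"
    using barrier_base[OF x] by (intro power_mono) auto
  then have "inverse ((2 * d / r) ^ DIM('a)) \<le> barrier c r x"
    unfolding barrier_def using barrier_base[OF x] by (intro le_imp_inverse_le) auto
  then show ?thesis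
    by (simp add: power_inverse[symmetric] field_simps)
qed

text \<open>If \<open>t\<close> is the base of the power at \<open>x\<close>, the base at
  \<open>x + z\<close> is \<open>t * (1 - a)\<close> with \<open>a\<close> linear in
  \<open>z\<close> up to a multiple of \<open>(norm z)\<^sup>2\<close>, so the one-variable
  expansion applies. The vector \<open>e\<close> is chosen before \<open>z\<close> and left
  unspecified: only the oddness of \<open>e \<bullet> z\<close> will matter.\<close>

lemma barrier_increment:
  "\<exists>C\<ge>0. \<forall>(c::'a::euclidean_space) x r d. x \<in> ball c r \<longrightarrow> d = r - norm (x - c) \<longrightarrow>
     (\<exists>e. \<forall>z. norm z \<le> d / 4 \<longrightarrow>
       x + z \<in> ball c r \<and> (2 / 3) ^ DIM('a) * barrier c r x \<le> barrier c r (x + z) \<and>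
       barrier c r (x + z) - barrier c r x \<le> barrier c r x * (e \<bullet> z + C * (norm z)\<^sup>2 / d\<^sup>2))"
proof -
  let ?n = "DIM('a)"
  obtain C where C: "0 \<le> C" "\<And>a::real. \<bar>a\<bar> \<le> 1 / 2 \<Longrightarrow> inverse ((1 - a) ^ ?n) \<le> 1 + real ?n * a + C * a\<^sup>2"
    using inverse_power_quadratic_bound[of ?n] by auto
  \<comment> \<open>\<open>4 * C\<close> comes from
    \<open>a\<^sup>2 \<le> 4 * (norm z)\<^sup>2 / d\<^sup>2\<close>, and \<open>real ?n\<close> from
    the quadratic part of \<open>a\<close> itself, using
    \<open>d\<^sup>2 \<le> r\<^sup>2 * t\<close>.\<close>
  define D where "D = real ?n + 4 * C"
  have "\<exists>e::'a. \<forall>z. norm z \<le> d / 4 \<longrightarrow> x + z \<in> ball c r \<and> (2 / 3) ^ DIM('a) * barrier c r x \<le> barrier c r (x + z) \<and>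
       barrier c r (x + z) - barrier c r x \<le> barrier c r x * (e \<bullet> z + D * (norm z)\<^sup>2 / d\<^sup>2)"
    if x: "x \<in> ball c r" and d: "d = r - norm (x - c)" for c x :: 'a and r d
  proof -
    define R where "R = norm (x - c)"
    have "norm (x - c) < r"
      using x by (simp add: dist_norm norm_minus_commute)
    then have d0: "0 < d" and r0: "0 < r" and R: "0 \<le> R" "R < r" "d = r - R"
      using norm_ge_zero[of "x - c"] unfolding d R_def by linarith+
    define t where "t = 1 - R\<^sup>2 / r\<^sup>2"
    have t0: "0 < t"
      using barrier_base[OF x] by (simp add: t_def R_def)
    \<comment> \<open>The denominator of \<open>a\<close> contains \<open>r + R\<close>, and so does
      the bound \<open>2 * norm z * (r + R)\<close> on its numerator. After cancellation
      \<open>\<bar>a\<bar> \<le> 2 * norm z / d\<close>, which is at most \<open>1 / 2\<close> for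
      \<open>norm z \<le> d / 4\<close>; the factor \<open>2 / 3\<close> is the resulting bound
      \<open>1 - a \<le> 3 / 2\<close>.\<close>
    have rt: "r\<^sup>2 * t = d * (r + R)"
    proof -
      have "r\<^sup>2 * t = r\<^sup>2 - R\<^sup>2"
        using r0 by (simp add: t_def right_diff_distrib)
      also have "\<dots> = d * (r + R)"
        by (simp add: R(3) power2_eq_square algebra_simps)
      finally show ?thesis .
    qed
    have rt_ge: "d\<^sup>2 \<le> r\<^sup>2 * t"
      unfolding rt using d0 R by (simp add: power2_eq_square)
    have rt0: "0 < r\<^sup>2 * t"
      using r0 t0 by simp
    define e where "e = (2 * real ?n / (r\<^sup>2 * t)) *\<^sub>R (x - c)"
    have main: "x + z \<in> ball c r \<and> (2 / 3) ^ ?n * barrier c r x \<le> barrier c r (x + z) \<and>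
       barrier c r (x + z) - barrier c r x \<le> barrier c r x * (e \<bullet> z + D * (norm z)\<^sup>2 / d\<^sup>2)" if z: "norm z \<le> d / 4" for z
    proof -
      define a where "a = (2 * ((x - c) \<bullet> z) + (norm z)\<^sup>2) / (r\<^sup>2 * t)"
      have "norm (x + z - c) \<le> R + norm z"
        using norm_triangle_ineq[of "x - c" z] by (simp add: R_def algebra_simps)
      then have 1: "x + z \<in> ball c r"
        using z d0 R by (simp add: dist_norm norm_minus_commute)
      have "(norm (x + z - c))\<^sup>2 = R\<^sup>2 + 2 * ((x - c) \<bullet> z) + (norm z)\<^sup>2"
        unfolding R_def power2_norm_eq_inner by (simp add: inner_simps inner_commute algebra_simps)
      then have t': "1 - (norm (x + z - c))\<^sup>2 / r\<^sup>2 = t * (1 - a)"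
      proof -
        have "t * a = (2 * ((x - c) \<bullet> z) + (norm z)\<^sup>2) / r\<^sup>2"
          using r0 t0 by (simp add: a_def)
        then show ?thesis
          using \<open>(norm (x + z - c))\<^sup>2 = _\<close> by (simp add: right_diff_distrib) (simp add: t_def add_divide_distrib)
      qed
      have "\<bar>2 * ((x - c) \<bullet> z) + (norm z)\<^sup>2\<bar> \<le> 2 * (R * norm z) + (norm z)\<^sup>2"
        using Cauchy_Schwarz_ineq2[of "x - c" z] zero_le_power2[of "norm z"] unfolding R_def abs_le_iff by linarith
      also have "\<dots> = norm z * (2 * R + norm z)"
        by (simp add: power2_eq_square algebra_simps)
      also have "\<dots> \<le> norm z * (2 * (r + R))"
        using z R by (intro mult_left_mono) auto
      finally have le: "\<bar>2 * ((x - c) \<bullet> z) + (norm z)\<^sup>2\<bar> \<le> norm z * (2 * (r + R))" .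
      have p: "0 < d * (r + R)"
        using rt0 unfolding rt .
      have "\<bar>a\<bar> \<le> norm z * (2 * (r + R)) / (d * (r + R))"
        unfolding a_def rt abs_divide abs_of_pos[OF p] by (rule divide_right_mono[OF le less_imp_le[OF p]])
      also have "\<dots> = 2 * norm z / d"
      proof -
        have "r + R \<noteq> 0"
          using R(1) r0 by simp
        then have "(2 * norm z) * (r + R) / (d * (r + R)) = 2 * norm z / d"
          by (rule nonzero_mult_divide_mult_cancel_right)
        then show ?thesis
          by (simp only: mult.assoc mult.left_commute[of "norm z"])
      qed
      finally have a: "\<bar>a\<bar> \<le> 2 * norm z / d" .
      also have "\<dots> \<le> 1 / 2"
        using z d0 by (simp add: field_simps)
      finally have a2: "\<bar>a\<bar> \<le> 1 / 2" .
      have b: "barrier c r (x + z) = barrier c r x * inverse ((1 - a) ^ ?n)"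
        unfolding barrier_def t' by (simp add: t_def R_def power_mult_distrib)
      have bx: "1 \<le> barrier c r x"
        by (rule barrier_ge_1[OF x])
      have 2: "(2 / 3) ^ ?n * barrier c r x \<le> barrier c r (x + z)"
      proof -
        have "(1 - a) ^ ?n \<le> (3 / 2) ^ ?n"
          using a2 by (intro power_mono) auto
        then have "inverse ((3 / 2) ^ ?n) \<le> inverse ((1 - a) ^ ?n)"
          using a2 by (intro le_imp_inverse_le) auto
        moreover have "inverse ((3 / 2) ^ ?n) = ((2 / 3) ^ ?n :: real)"
          by (simp add: power_inverse[symmetric])
        ultimately show ?thesis
          unfolding b using bx by (simp add: mult.commute)
      qed
      have "a\<^sup>2 \<le> (2 * norm z / d)\<^sup>2"
        using power_mono[OF a abs_ge_zero, of 2] by simp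
      from mult_left_mono[OF this C(1)] have "C * a\<^sup>2 \<le> 4 * C * (norm z)\<^sup>2 / d\<^sup>2"
        by (simp add: power_divide power_mult_distrib mult.assoc mult.left_commute[of C])
      moreover have "real ?n * a \<le> e \<bullet> z + real ?n * (norm z)\<^sup>2 / d\<^sup>2"
      proof -
        have "real ?n * a = e \<bullet> z + real ?n * ((norm z)\<^sup>2 / (r\<^sup>2 * t))"
          by (simp add: a_def e_def add_divide_distrib distrib_left)
        also have "\<dots> \<le> e \<bullet> z + real ?n * ((norm z)\<^sup>2 / d\<^sup>2)"
          using d0 by (intro add_left_mono mult_left_mono divide_left_mono rt_ge mult_pos_pos[OF rt0]) auto
        finally show ?thesis by simp
      qed
      ultimately have "inverse ((1 - a) ^ ?n) \<le> 1 + (e \<bullet> z + D * (norm z)\<^sup>2 / d\<^sup>2)"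
        using C(2)[OF a2] by (simp add: D_def distrib_right add_divide_distrib)
      then have "barrier c r x * inverse ((1 - a) ^ ?n) \<le> barrier c r x * (1 + (e \<bullet> z + D * (norm z)\<^sup>2 / d\<^sup>2))"
        using bx by (intro mult_left_mono) auto
      then show ?thesis
        using 1 2 by (simp add: b distrib_left)
    qed
    then show ?thesis
      by blast
  qed
  then show ?thesis
    using C(1) by (intro exI[of _ D] conjI allI impI) (auto simp: D_def)
qed

lemma measure_ball_scale: "0 \<le> R \<Longrightarrow> measure lborel (ball (c::'a::euclidean_space) R) = measure lborel (ball (0::'a) 1) * R ^ DIM('a)"
  using content_ball_conv_unit_ball[of R c] by (simp add: measure_completion)

lemma barrier_measurable[measurable]: "barrier c r \<in> borel_measurable borel"
  unfolding barrier_def by measurable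

lemma knear_le_power: "knear N r \<tau> z \<le> norm z powr (- N)"
  by (simp add: knear_def)

context supersolution
begin

text \<open>The constant must not depend on \<open>\<tau>\<close>, so the first-order part cannot be
  estimated by absolute values. The truncated kernel is still even, hence this part integrates to
  zero; the quadratic part contributes \<open>d powr (2 - 2 * s) / d\<^sup>2\<close>.\<close>

lemma near_barrier_bound:
  obtains C where "0 \<le> C" "\<And>(c::'a) r x d \<tau>. x \<in> ball c r \<Longrightarrow> d = r - norm (x - c) \<Longrightarrow> 0 < \<tau> \<Longrightarrow>
     integrable lborel (\<lambda>z. knear N r \<tau> z * (indicator (ball 0 (d / 4)) z * (barrier c r (x + z) - barrier c r x))) \<and>
     (LBINT z. knear N r \<tau> z * (indicator (ball 0 (d / 4)) z * (barrier c r (x + z) - barrier c r x)))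
       \<le> C * (barrier c r x * d powr (- 2 * s))"
proof -
  from barrier_increment[where 'a='a]
  obtain D where D0: "0 \<le> D" and D': "\<forall>(c::'a) x r d. x \<in> ball c r \<longrightarrow> d = r - norm (x - c) \<longrightarrow>
     (\<exists>e. \<forall>z. norm z \<le> d / 4 \<longrightarrow>
       x + z \<in> ball c r \<and> (2 / 3) ^ DIM('a) * barrier c r x \<le> barrier c r (x + z) \<and>
       barrier c r (x + z) - barrier c r x \<le> barrier c r x * (e \<bullet> z + D * (norm z)\<^sup>2 / d\<^sup>2))"
    by (elim exE conjE)
  note D = D0 D'[rule_format]
  obtain C0 where C0: "0 \<le> C0"
    "\<forall>R>0. integrable lborel (\<lambda>z::'a. indicator (ball 0 R) z * ((norm z)\<^sup>2 * norm z powr (- N))) \<and>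
      (LBINT z::'a. indicator (ball 0 R) z * ((norm z)\<^sup>2 * norm z powr (- N))) \<le> C0 * R powr (2 - 2 * s)"
    using inner_kernel_integral[OF s, where 'a='a, folded N_def] by (elim exE conjE)
  show ?thesis
  proof (rule that[of "D * C0"])
    show "0 \<le> D * C0"
      using D C0 by simp
    fix c x :: 'a and r d \<tau> :: real
    assume x: "x \<in> ball c r" and d: "d = r - norm (x - c)" and \<tau>: "0 < \<tau>"
    have d0: "0 < d"
      using x unfolding d by (simp add: dist_norm norm_minus_commute)
    let ?k = "knear N r \<tau> :: 'a \<Rightarrow> real"
    let ?h = "barrier c r"
    let ?i = "indicator (ball 0 (d / 4)) :: 'a \<Rightarrow> real"
    obtain e where e: "\<And>z. norm z \<le> d / 4 \<Longrightarrow> x + z \<in> ball c r \<and> ?h (x + z) - ?h x \<le> ?h x * (e \<bullet> z + D * (norm z)\<^sup>2 / d\<^sup>2)"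
      using D(2)[OF x d] by blast
    have h1: "1 \<le> ?h x"
      by (rule barrier_ge_1[OF x])
    have kI: "integrable lborel ?k"
      by (rule knear_integrable[OF N_pos(2) \<tau>])
    have k0: "0 \<le> ?k z" for z
      using N_pos \<tau> by (simp add: knear_nonneg)
    \<comment> \<open>A crude bound that serves only integrability. The summand 1 makes
      \<open>B\<close> also dominate \<open>?h x\<close>, which bounds the increment from
      below.\<close>
    define B where "B = ?h x * (norm e * d + D + 1)"
    have B0: "0 \<le> B"
      using h1 d0 D by (simp add: B_def)
    have bd: "\<bar>?i z * (?h (x + z) - ?h x)\<bar> \<le> B" for z
    proof (cases "z \<in> ball 0 (d / 4)")
      case True
      then have z: "norm z \<le> d / 4" by simp
      have "e \<bullet> z \<le> norm e * norm z"
        by (rule norm_cauchy_schwarz)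
      also have "\<dots> \<le> norm e * d"
        using z d0 by (intro mult_left_mono) auto
      finally have 1: "e \<bullet> z \<le> norm e * d" .
      have "(norm z)\<^sup>2 \<le> d\<^sup>2"
        using z d0 by (intro power_mono) auto
      then have "D * (norm z)\<^sup>2 / d\<^sup>2 \<le> D"
        using d0 D by (simp add: divide_le_eq mult_left_mono)
      with 1 have "?h x * (e \<bullet> z + D * (norm z)\<^sup>2 / d\<^sup>2) \<le> B"
        unfolding B_def using h1 by (intro mult_left_mono) auto
      moreover have "?h x \<le> B"
      proof -
        have "?h x * 1 \<le> B"
          unfolding B_def using h1 d0 D by (intro mult_left_mono) auto
        then show ?thesis by simp
      qed
      moreover have "0 \<le> ?h (x + z)"
        using barrier_ge_1[of "x + z" c r] e[OF z] by linarith
      ultimately have "\<bar>?h (x + z) - ?h x\<bar> \<le> B"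
        using e[OF z, THEN conjunct2] by (intro abs_leI) linarith+
      then show ?thesis
        using True by simp
    qed (use B0 in simp)
    show "integrable lborel (\<lambda>z. ?k z * (?i z * (?h (x + z) - ?h x))) \<and>
      (LBINT z. ?k z * (?i z * (?h (x + z) - ?h x))) \<le> D * C0 * (?h x * d powr (- 2 * s))"
    proof (intro conjI)
      show I: "integrable lborel (\<lambda>z. ?k z * (?i z * (?h (x + z) - ?h x)))"
        by (rule integrable_bounded_mult(2)[OF kI _ bd]) measurable
      have I1: "integrable lborel (\<lambda>z. ?k z * (?i z * (e \<bullet> z)))"
      proof (rule integrable_bounded_mult(2)[OF kI, of _ "norm e * d"])
        show "\<bar>?i z * (e \<bullet> z)\<bar> \<le> norm e * d" for z
        proof (cases "z \<in> ball 0 (d / 4)")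
          case True
          have "\<bar>e \<bullet> z\<bar> \<le> norm e * norm z"
            by (rule Cauchy_Schwarz_ineq2)
          also have "\<dots> \<le> norm e * d"
            using True d0 by (intro mult_left_mono) auto
          finally show ?thesis
            using True by simp
        qed (use d0 in simp)
      qed measurable
      have zero: "(LBINT z. ?k z * (?i z * (e \<bullet> z))) = 0"
      proof -
        have "(LBINT z. ?k (0 - z) * (?i (0 - z) * (e \<bullet> (0 - z)))) = (LBINT z. ?k z * (?i z * (e \<bullet> z)))"
          using I1 by (intro lborel_reflect(2)[of "\<lambda>z. ?k z * (?i z * (e \<bullet> z))"]) auto
        moreover have "(\<lambda>z. ?k (0 - z) * (?i (0 - z) * (e \<bullet> (0 - z)))) = (\<lambda>z. - (?k z * (?i z * (e \<bullet> z))))"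
          by (auto simp: knear_minus indicator_def)
        ultimately have "(LBINT z. - (?k z * (?i z * (e \<bullet> z)))) = (LBINT z. ?k z * (?i z * (e \<bullet> z)))"
          by (simp only:)
        then show ?thesis
          by simp
      qed
      let ?S = "\<lambda>z::'a. ?i z * ((norm z)\<^sup>2 * norm z powr (- N))"
      note S' = C0(2)[rule_format, of "d / 4"]
      note S = S'[THEN conjunct1] S'[THEN conjunct2]
      have "(LBINT z. ?k z * (?i z * (?h (x + z) - ?h x))) \<le>
          (LBINT z. ?h x * (?k z * (?i z * (e \<bullet> z))) + ?h x * D / d\<^sup>2 * ?S z)"
      proof (rule integral_mono[OF I])
        show "integrable lborel (\<lambda>z. ?h x * (?k z * (?i z * (e \<bullet> z))) + ?h x * D / d\<^sup>2 * ?S z)"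
          using I1 S(1) d0 by (intro Bochner_Integration.integrable_add integrable_mult_right) auto
        fix z
        show "?k z * (?i z * (?h (x + z) - ?h x)) \<le> ?h x * (?k z * (?i z * (e \<bullet> z))) + ?h x * D / d\<^sup>2 * ?S z"
        proof (cases "z \<in> ball 0 (d / 4)")
          case True
          then have "?k z * (?i z * (?h (x + z) - ?h x)) \<le> ?k z * (?h x * (e \<bullet> z + D * (norm z)\<^sup>2 / d\<^sup>2))"
            using e[of z] k0 by (auto intro!: mult_left_mono)
          also have "\<dots> = ?h x * (?k z * (e \<bullet> z)) + ?h x * D / d\<^sup>2 * ((norm z)\<^sup>2 * ?k z)"
            by (simp add: algebra_simps)
          also have "\<dots> \<le> ?h x * (?k z * (e \<bullet> z)) + ?h x * D / d\<^sup>2 * ((norm z)\<^sup>2 * norm z powr (- N))"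
            using h1 D knear_le_power[of N r \<tau> z] by (intro add_left_mono mult_left_mono) auto
          finally show ?thesis
            using True by simp
        qed simp
      qed
      also have "\<dots> = ?h x * D / d\<^sup>2 * (LBINT z. ?S z)"
        using I1 S(1) d0 zero by simp
      also have "\<dots> \<le> ?h x * D / d\<^sup>2 * (C0 * d powr (2 - 2 * s))"
      proof (rule mult_left_mono)
        have "(LBINT z. ?S z) \<le> C0 * (d / 4) powr (2 - 2 * s)"
          using S(2) d0 by simp
        also have "\<dots> \<le> C0 * d powr (2 - 2 * s)"
          using s d0 C0(1) by (intro mult_left_mono powr_mono2) auto
        finally show "(LBINT z. ?S z) \<le> C0 * d powr (2 - 2 * s)" .
        show "0 \<le> ?h x * D / d\<^sup>2"
          using h1 D by simp
      qed
      also have "\<dots> = D * C0 * (?h x * (d powr (2 - 2 * s) / d\<^sup>2))"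
        by simp
      also have "d powr (2 - 2 * s) / d\<^sup>2 = d powr (- 2 * s)"
        using d0 powr_diff[of d "2 - 2 * s" 2] by simp
      finally show "(LBINT z. ?k z * (?i z * (?h (x + z) - ?h x))) \<le> D * C0 * (?h x * d powr (- 2 * s))" .
    qed
  qed
qed

text \<open>Because \<open>b \<le> q\<close>, only the deficit \<open>max 0 (q - u y)\<close>
  remains. Up to distance \<open>3 * r\<close> the kernel is at most its cap
  \<open>r powr (- N)\<close>; beyond, the distances to \<open>x\<close> and to \<open>c\<close> are
  comparable up to a factor 2, so the tail integral does not depend on \<open>x\<close>.\<close>

lemma far_integral_bound:
  assumes r: "0 < r" and x: "x \<in> ball c r" and bq: "b \<le> q" and G: "cball c (4 * r) \<subseteq> \<Omega>"
  shows "far_pot N r (indicator \<Omega>) x * b - far_pot N r u x \<le>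
      r powr (- N) * (LBINT y. indicator (cball c (3 * r)) y * max 0 (q - u y)) +
      2 powr N * (LBINT y. indicator (\<Omega> - cball c (3 * r)) y * (max 0 (q - u y) * kfar N r (c - y)))" (is "?L \<le> ?R")
    and "integrable lborel (\<lambda>y. indicator (cball c (3 * r)) y * max 0 (q - u y))"
    and "integrable lborel (\<lambda>y. indicator (\<Omega> - cball c (3 * r)) y * (max 0 (q - u y) * kfar N r (c - y)))"
proof -
  let ?g = "\<lambda>y. max 0 (q - u y)"
  let ?i = "indicator (cball c (3 * r)) :: 'a \<Rightarrow> real"
  let ?o = "indicator (\<Omega> - cball c (3 * r)) :: 'a \<Rightarrow> real"
  have c3: "cball c (3 * r) \<subseteq> \<Omega>"
    using G r subset_cball[of "3 * r" "4 * r" c] by simp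
  have om: "\<Omega> - cball c (3 * r) \<in> sets borel"
    by auto
  note [measurable] = om
  show I1: "integrable lborel (\<lambda>y. ?i y * ?g y)"
  proof (rule Bochner_Integration.integrable_bound[OF Bochner_Integration.integrable_add[OF
          integrable_mult_right[OF integrable_indicator_cball[of c "3 * r"], of "\<bar>q\<bar>"] integrable_abs[OF trunc_integrable(1)[OF c3]]]])
    show "AE y in lborel. norm (?i y * ?g y) \<le> norm (\<bar>q\<bar> * ?i y + \<bar>trunc c (3 * r) y\<bar>)"
      by (auto simp: trunc_def indicator_def)
  qed measurable
  have Fi: "integrable lborel (\<lambda>y. indicator \<Omega> y * kfar N r (x - y))" "integrable lborel (\<lambda>y. u y * kfar N r (x - y))" for x
    using far_pot_integrable[OF r N_pos(2) indicator_weight] far_pot_integrable[OF r N_pos(2) u_weight] by auto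
  have gk: "integrable lborel (\<lambda>y. indicator \<Omega> y * (?g y * kfar N r (x - y)))" for x
  proof (rule Bochner_Integration.integrable_bound[OF Bochner_Integration.integrable_add[OF
          integrable_mult_right[OF Fi(1)[of x], of "\<bar>q\<bar>"] integrable_abs[OF Fi(2)[of x]]]])
    show "AE y in lborel. norm (indicator \<Omega> y * (?g y * kfar N r (x - y)))
        \<le> norm (\<bar>q\<bar> * (indicator \<Omega> y * kfar N r (x - y)) + \<bar>u y * kfar N r (x - y)\<bar>)"
    proof (rule AE_I2)
      fix y
      have "?g y \<le> \<bar>q\<bar> + \<bar>u y\<bar>" by auto
      then have "?g y * kfar N r (x - y) \<le> (\<bar>q\<bar> + \<bar>u y\<bar>) * kfar N r (x - y)"
        by (intro mult_right_mono) (auto simp: kfar_nonneg)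
      then show "norm (indicator \<Omega> y * (?g y * kfar N r (x - y)))
        \<le> norm (\<bar>q\<bar> * (indicator \<Omega> y * kfar N r (x - y)) + \<bar>u y * kfar N r (x - y)\<bar>)"
        by (simp add: abs_mult kfar_nonneg distrib_right indicator_def)
    qed
  qed measurable
  show I2: "integrable lborel (\<lambda>y. ?o y * (?g y * kfar N r (c - y)))"
    by (rule Bochner_Integration.integrable_bound[OF gk[of c]]) (auto simp: indicator_def)
  have "far_pot N r (indicator \<Omega>) x * b - far_pot N r u x =
      (LBINT y. b * (indicator \<Omega> y * kfar N r (x - y)) - u y * kfar N r (x - y))"
    using Fi[of x] by (simp add: far_pot_def)
  also have "\<dots> \<le> (LBINT y. r powr (- N) * (?i y * ?g y) + 2 powr N * (?o y * (?g y * kfar N r (c - y))))"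
  proof (rule integral_mono)
    show "integrable lborel (\<lambda>y. b * (indicator \<Omega> y * kfar N r (x - y)) - u y * kfar N r (x - y))"
      using Fi[of x] by auto
    show "integrable lborel (\<lambda>y. r powr (- N) * (?i y * ?g y) + 2 powr N * (?o y * (?g y * kfar N r (c - y))))"
      using I1 I2 by auto
    fix y
    show "b * (indicator \<Omega> y * kfar N r (x - y)) - u y * kfar N r (x - y)
        \<le> r powr (- N) * (?i y * ?g y) + 2 powr N * (?o y * (?g y * kfar N r (c - y)))"
    proof (cases "y \<in> \<Omega>")
      case True
      then have "b * (indicator \<Omega> y * kfar N r (x - y)) - u y * kfar N r (x - y) = (b - u y) * kfar N r (x - y)"
        by (simp add: algebra_simps)
      also have "\<dots> \<le> ?g y * kfar N r (x - y)"
        using bq by (intro mult_right_mono) (auto simp: kfar_nonneg)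
      also have "\<dots> \<le> r powr (- N) * (?i y * ?g y) + 2 powr N * (?o y * (?g y * kfar N r (c - y)))"
      proof (cases "y \<in> cball c (3 * r)")
        case i: True
        have "?g y * kfar N r (x - y) \<le> ?g y * r powr (- N)"
          using kfar_le[OF r N_pos(2), of "x - y"] by (intro mult_left_mono) auto
        then show ?thesis
          using i by (simp add: mult.commute)
      next
        case o: False
        have "kfar N r (x - y) \<le> 2 powr N * kfar N r (c - y)"
        proof -
          have m: "max (norm (c - y)) r / 2 \<le> max (norm (x - y)) r"
            using o x r norm_triangle_ineq[of "c - x" "x - y"] by (auto simp: dist_norm)
          have "kfar N r (x - y) \<le> (max (norm (c - y)) r / 2) powr (- N)"
            unfolding kfar_def using m r N_pos by (intro powr_mono2') (auto simp: max_def)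
          also have "\<dots> = 2 powr N * kfar N r (c - y)"
            using r by (simp add: kfar_def powr_divide powr_minus_divide)
          finally show ?thesis .
        qed
        then have "?g y * kfar N r (x - y) \<le> ?g y * (2 powr N * kfar N r (c - y))"
          by (intro mult_left_mono) auto
        then show ?thesis
          using o True by (simp add: algebra_simps)
      qed
      finally show ?thesis .
    next
      case False
      then have "y \<notin> cball c (3 * r)"
        using c3 by blast
      then show ?thesis
        using False u_zero by simp
    qed
  qed
  also have "\<dots> = r powr (- N) * (LBINT y. ?i y * ?g y) + 2 powr N * (LBINT y. ?o y * (?g y * kfar N r (c - y)))"
    using I1 I2 by simp
  finally show "?L \<le> ?R" .
qed


section \<open>Lower bounds from small deficit\<close>

text \<open>Jensen's inequality for the convex function \<open>max 0 (q - t)\<close>, obtained from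
  monotonicity and positivity of averaging. Since \<open>\<epsilon> \<le> r\<close>, averages at
  points of the ball of radius \<open>2 * r\<close> see only the ball of radius
  \<open>3 * r\<close>.\<close>

lemma conv_defect:
  assumes G: "cball c (4 * r) \<subseteq> \<Omega>" and r: "0 < r" and \<rho>: "mollifier \<epsilon> \<rho>" and \<epsilon>: "\<epsilon> \<le> r"
    and ue_def: "ue = conv \<rho> (trunc c (4 * r))"
  shows "integrable lborel (\<lambda>y. indicator (ball c (2 * r)) y * max 0 (q - ue y))"
    and "(LBINT y. indicator (ball c (2 * r)) y * max 0 (q - ue y)) \<le>
      (LBINT y. indicator (cball c (3 * r)) y * max 0 (q - u y))"
proof -
  let ?U = "trunc c (4 * r)"
  let ?A = "\<lambda>y. indicator (cball c (3 * r)) y * max 0 (q - u y)"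
  let ?i4 = "indicator (cball c (4 * r)) :: 'a \<Rightarrow> real"
  have UI: "integrable lborel ?U"
    by (rule trunc_integrable(1)[OF G])
  have AI: "integrable lborel ?A"
    by (rule far_integral_bound(2)[OF r centre_in_ball[THEN iffD2, OF r] order_refl G])
  have cA: "integrable lborel (conv \<rho> ?A)"
    by (rule integrable_conv[OF mollifierD(5)[OF \<rho>] AI])
  have A0: "0 \<le> conv \<rho> ?A y" for y
    by (rule conv_nonneg[OF \<rho>]) simp
  have le: "indicator (ball c (2 * r)) y * max 0 (q - ue y) \<le> conv \<rho> ?A y" for y
  proof (cases "y \<in> ball c (2 * r)")
    case True
    have near: "w \<in> cball c (3 * r)" "w \<in> cball c (4 * r)" if "norm (y - w) < \<epsilon>" for w
      using that True \<epsilon> r dist_triangle[of c w y] by (auto simp: dist_norm)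
    have "q - ue y = conv \<rho> (\<lambda>w. q * ?i4 w + (-1) * ?U w + 0 * ?U w) y"
      unfolding conv_lincomb[OF mollifierD(1)[OF \<rho>] integrable_indicator_cball UI UI] ue_def
      using conv_const_near[OF \<rho> integrable_indicator_cball, of y c "4 * r" 1] near by simp
    also have "\<dots> \<le> conv \<rho> ?A y"
    proof (rule conv_mono[OF \<rho> _ AI])
      show "integrable lborel (\<lambda>w. q * ?i4 w + (-1) * ?U w + 0 * ?U w)"
        using UI integrable_indicator_cball[of c "4 * r"] by auto
      show "q * ?i4 w + (-1) * ?U w + 0 * ?U w \<le> ?A w" if "norm (y - w) < \<epsilon>" for w
        using near[OF that] by (simp add: trunc_def)
    qed
    finally show ?thesis
      using A0[of y] True by simp
  qed (use A0 in simp)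
  have [measurable]: "ue \<in> borel_measurable borel"
    using integrable_conv[OF mollifierD(5)[OF \<rho>] UI] by (auto simp: ue_def)
  show I: "integrable lborel (\<lambda>y. indicator (ball c (2 * r)) y * max 0 (q - ue y))"
    by (rule Bochner_Integration.integrable_bound[OF cA]) (use le A0 in \<open>auto intro!: AE_I2\<close>)
  have "(LBINT y. indicator (ball c (2 * r)) y * max 0 (q - ue y)) \<le> (LBINT y. conv \<rho> ?A y)"
    by (rule integral_mono[OF I cA le])
  then show "(LBINT y. indicator (ball c (2 * r)) y * max 0 (q - ue y)) \<le>
      (LBINT y. indicator (cball c (3 * r)) y * max 0 (q - u y))"
    by (simp add: integral_conv[OF \<rho> AI])
qed

text \<open>
  The last term comes from the ball of radius \<open>l\<close> around \<open>x\<close>: there \<open>b\<close> lies below \<open>q - M\<^sub>0\<close> with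
  \<open>M\<^sub>0 = \<theta> * (2 / 3) ^ DIM('a) * barrier c r x\<close>, so \<open>ue - b\<close> exceeds \<open>M\<^sub>0\<close> minus the deficit. As
  \<open>l \<rightarrow> 0\<close> it grows like \<open>l powr (- 2 * s)\<close> and beats all the other terms.
\<close>

lemma near_integral_bound:
  assumes G: "cball c (4 * r) \<subseteq> \<Omega>" and r: "0 < r" and \<rho>: "mollifier \<epsilon> \<rho>" and \<epsilon>: "\<epsilon> \<le> r"
    and ue_def: "ue = conv \<rho> (trunc c (4 * r))"
    and \<theta>: "0 < \<theta>" and b_def: "b = (\<lambda>x. q - \<theta> * barrier c r x)"
    and x: "x \<in> ball c r" and d: "d = r - norm (x - c)"
    and near: "\<And>\<tau>. 0 < \<tau> \<Longrightarrow>
     integrable lborel (\<lambda>z. knear N r \<tau> z * (indicator (ball 0 (d / 4)) z * (barrier c r (x + z) - barrier c r x))) \<and>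
     (LBINT z. knear N r \<tau> z * (indicator (ball 0 (d / 4)) z * (barrier c r (x + z) - barrier c r x)))
       \<le> X1"
    and l: "0 < l" "l \<le> d / 4" and \<tau>: "0 < \<tau>" "8 * \<tau> \<le> l"
    and lower: "\<And>z. norm z \<le> d / 4 \<Longrightarrow> x + z \<in> ball c r \<and> (2 / 3) ^ DIM('a) * barrier c r x \<le> barrier c r (x + z)"
  defines "I \<equiv> (LBINT y. indicator (cball c (3 * r)) y * max 0 (q - u y))"
  shows "(LBINT z. knear N r \<tau> z * (b x - (ue (x + z) + excess c r b ue (x + z))))
    \<le> \<theta> * X1 + (d / 4) powr (- N) * I - 1 / 2 * l powr (- N) *
       (3 / 4 * (\<theta> * (2 / 3) ^ DIM('a) * barrier c r x) * (measure lborel (ball (0::'a) 1) * l ^ DIM('a)) - I)"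
proof -
  let ?k = "knear N r \<tau> :: 'a \<Rightarrow> real"
  let ?U = "trunc c (4 * r)"
  let ?h = "barrier c r"
  let ?i = "indicator (ball 0 (d / 4)) :: 'a \<Rightarrow> real"
  let ?iS = "indicator (ball 0 l - cball 0 \<tau>) :: 'a \<Rightarrow> real"
  let ?\<omega> = "measure lborel (ball (0::'a) 1)"
  define g where "g = (\<lambda>y. max 0 (q - ue y))"
  define g2 where "g2 = (\<lambda>y. indicator (ball c (2 * r)) y * g y)"
  define M0 where "M0 = \<theta> * (2 / 3) ^ DIM('a) * ?h x"
  define \<kappa> where "\<kappa> = 1 / 2 * l powr (- N)"
  define v where "v = (\<lambda>y. ue y + excess c r b ue y)"
  have dr: "d \<le> r" "0 < d"
    using x unfolding d by (auto simp: dist_norm norm_minus_commute)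
  have h1: "1 \<le> ?h x"
    by (rule barrier_ge_1[OF x])
  have M0: "0 \<le> M0"
    using \<theta> h1 by (simp add: M0_def)
  have \<kappa>0: "0 \<le> \<kappa>"
    by (simp add: \<kappa>_def)
  have UI: "integrable lborel ?U"
    by (rule trunc_integrable(1)[OF G])
  have uem[measurable]: "ue \<in> borel_measurable borel"
    using integrable_conv[OF mollifierD(5)[OF \<rho>] UI] by (auto simp: ue_def)
  obtain M where M: "\<And>y. \<bar>ue y\<bar> \<le> M"
    using conv_bounded[OF \<rho> UI] unfolding ue_def by metis
  have bq: "b y \<le> q" if "y \<in> ball c r" for y
    using barrier_ge_1[OF that] \<theta> by (simp add: b_def)
  have bm: "(\<lambda>x. indicator (ball c r) x * b x) \<in> borel_measurable borel"
    unfolding b_def by measurable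
  note E = excess_bounds[where b = b and w = ue, OF bq bm uem M]
  note [measurable] = E(1)
  have vm[measurable]: "v \<in> borel_measurable borel"
    unfolding v_def by measurable
  have vB: "\<bar>v y\<bar> \<le> M + (\<bar>q\<bar> + M)" for y
    using M[of y] E(3)[of y] unfolding v_def by linarith
  have vb: "b y \<le> v y" if "y \<in> ball c r" for y
    using that by (simp add: v_def excess_def)
  have vue: "ue y \<le> v y" for y
    using E(2)[of y] by (simp add: v_def)
  have kI: "integrable lborel ?k"
    by (rule knear_integrable[OF N_pos(2) \<tau>(1)])
  have k0: "0 \<le> ?k z" for z
    using N_pos \<tau> by (simp add: knear_nonneg)
  have N1: "1 \<le> N"
    using s unfolding N_def by (simp add: add_increasing2 Suc_leI)
  \<comment> \<open>Subtracting \<open>r powr (- N)\<close> costs at most half of the kernel,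
    because \<open>4 * l \<le> d \<le> r\<close> and \<open>N \<ge> 1\<close>.\<close>
  have kS: "\<kappa> \<le> ?k z" if z: "z \<in> ball 0 l - cball 0 \<tau>" for z
  proof -
    have z': "\<tau> < norm z" "norm z < l" "norm z < r"
      using z l dr by auto
    have "l powr (- N) \<le> norm z powr (- N)"
      using z' \<tau> N_pos by (intro powr_mono2') auto
    moreover have "r powr (- N) \<le> (4 * l) powr (- N)"
      using l dr N_pos by (intro powr_mono2') auto
    moreover have "(4 * l) powr (- N) \<le> 1 / 2 * l powr (- N)"
    proof -
      have "(4 * l) powr (- N) = 4 powr (- N) * l powr (- N)"
        by (rule powr_mult)
      also have "4 powr (- N) \<le> (4::real) powr (- 1)"
        using N1 by (intro powr_mono) auto
      also have "(4::real) powr (- 1) \<le> 1 / 2"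
        by (simp add: powr_minus_divide)
      finally show ?thesis
        by (simp add: mult_right_mono)
    qed
    ultimately show ?thesis
      using z' by (simp add: knear_def \<kappa>_def)
  qed
  have g2I: "integrable lborel g2" and g2le: "(LBINT y. g2 y) \<le> I"
    using conv_defect[OF G r \<rho> \<epsilon> ue_def, of q] by (auto simp: g2_def g_def I_def)
  have g2m[measurable]: "g2 \<in> borel_measurable borel"
    using g2I by auto
  have g20: "0 \<le> g2 y" for y
    by (simp add: g2_def g_def)
  have g2x: "integrable lborel (\<lambda>z. g2 (x + z))" "(LBINT z. g2 (x + z)) = (LBINT y. g2 y)"
    using lborel_translate[OF g2m, of x] g2I by (simp_all add: add.commute)
  have iSI: "integrable lborel ?iS"
    using emeasure_bounded_finite[of "ball (0::'a) l - cball 0 \<tau>"] bounded_diff[OF bounded_ball]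
    by (intro integrable_real_indicator) auto
  have Sg: "integrable lborel (\<lambda>z. ?iS z * g2 (x + z))"
    by (rule integrable_bounded_mult(1)[OF g2x(1), of _ 1]) (auto simp: indicator_def)
  \<comment> \<open>Inside radius \<open>d / 4\<close> the difference is the increment of the
    barrier minus \<open>v - b\<close>, which is nonnegative and on the shell at least
    \<open>M0 - g\<close>. Outside, \<open>b x \<le> q\<close> leaves only the deficit, and the
    kernel is at most \<open>(d / 4) powr (- N)\<close>.\<close>
  have pw: "?k z * (b x - v (x + z)) \<le> \<theta> * (?k z * (?i z * (?h (x + z) - ?h x))) + (d / 4) powr (- N) * g2 (x + z)
      - \<kappa> * (M0 * ?iS z - ?iS z * g2 (x + z))" for z
  proof (cases "norm z < d / 4")
    case True
    then have y: "x + z \<in> ball c r" and hl: "(2 / 3) ^ DIM('a) * ?h x \<le> ?h (x + z)"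
      using lower[of z] by auto
    then have g2y: "g2 (x + z) = g (x + z)"
      using r by (simp add: g2_def)
    have bb: "b x - b (x + z) = \<theta> * (?h (x + z) - ?h x)"
      by (simp add: b_def algebra_simps)
    have "\<kappa> * (M0 * ?iS z - ?iS z * g2 (x + z)) \<le> ?k z * (v (x + z) - b (x + z))"
    proof (cases "z \<in> ball 0 l - cball 0 \<tau>")
      case S: True
      have "M0 \<le> \<theta> * ?h (x + z)"
        using hl \<theta> unfolding M0_def mult.assoc by (intro mult_left_mono) auto
      then have vM: "M0 - g (x + z) \<le> v (x + z) - b (x + z)"
        using vue[of "x + z"] by (simp add: b_def g_def)
      have "\<kappa> * (M0 - g (x + z)) \<le> ?k z * (v (x + z) - b (x + z))"
      proof (cases "0 \<le> M0 - g (x + z)")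
        case True
        then show ?thesis
          using kS[OF S] vM k0 by (intro mult_mono) auto
      next
        case False
        then have "\<kappa> * (M0 - g (x + z)) \<le> 0"
          using \<kappa>0 by (simp add: mult_nonneg_nonpos)
        also have "0 \<le> ?k z * (v (x + z) - b (x + z))"
          using k0 vb[OF y] by simp
        finally show ?thesis .
      qed
      then show ?thesis
        using S by (simp add: g2y)
    next
      case False
      then show ?thesis
        using k0[of z] vb[OF y] by simp
    qed
    moreover have "?k z * (b x - v (x + z)) = \<theta> * (?k z * (?i z * (?h (x + z) - ?h x))) - ?k z * (v (x + z) - b (x + z))"
    proof -
      have "?k z * (b x - v (x + z)) = ?k z * (b x - b (x + z)) - ?k z * (v (x + z) - b (x + z))"
        by (simp add: algebra_simps)
      then show ?thesis
        unfolding bb using True by (simp add: mult.left_commute)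
    qed
    moreover have "0 \<le> (d / 4) powr (- N) * g2 (x + z)"
      using g20 by simp
    ultimately show ?thesis
      by linarith
  next
    case False
    then have z0: "?i z = 0" "?iS z = 0"
      using l by auto
    have "?k z * (b x - v (x + z)) \<le> (d / 4) powr (- N) * g2 (x + z)"
    proof (cases "norm z < r")
      case True
      then have "x + z \<in> ball c (2 * r)"
        using x norm_triangle_ineq[of "x - c" z] by (simp add: dist_norm norm_minus_commute algebra_simps)
      then have "b x - v (x + z) \<le> g2 (x + z)"
        using bq[OF x] vue[of "x + z"] by (simp add: g2_def g_def)
      then have "?k z * (b x - v (x + z)) \<le> ?k z * g2 (x + z)"
        using k0 by (intro mult_left_mono)
      also have "\<dots> \<le> (d / 4) powr (- N) * g2 (x + z)"
      proof (rule mult_right_mono[OF _ g20])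
        have "?k z \<le> norm z powr (- N)"
          by (rule knear_le_power)
        also have "\<dots> \<le> (d / 4) powr (- N)"
          using False dr N_pos by (intro powr_mono2') auto
        finally show "?k z \<le> (d / 4) powr (- N)" .
      qed
      finally show ?thesis .
    qed (use g20 in \<open>simp add: knear_def\<close>)
    then show ?thesis
      by (simp add: z0)
  qed
  have "(LBINT z. ?k z * (b x - v (x + z))) \<le>
     (LBINT z. \<theta> * (?k z * (?i z * (?h (x + z) - ?h x))) + (d / 4) powr (- N) * g2 (x + z)
      - \<kappa> * (M0 * ?iS z - ?iS z * g2 (x + z)))"
  proof (rule integral_mono[OF _ _ pw])
    show "integrable lborel (\<lambda>z. ?k z * (b x - v (x + z)))"
    proof (rule integrable_bounded_mult(2)[OF kI])
      show "\<bar>b x - v (x + z)\<bar> \<le> \<bar>b x\<bar> + (M + (\<bar>q\<bar> + M))" for z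
        using vB[of "x + z"] by linarith
    qed measurable
    show "integrable lborel (\<lambda>z. \<theta> * (?k z * (?i z * (?h (x + z) - ?h x))) + (d / 4) powr (- N) * g2 (x + z)
      - \<kappa> * (M0 * ?iS z - ?iS z * g2 (x + z)))"
      using near[OF \<tau>(1)] g2x(1) iSI Sg
      by (intro Bochner_Integration.integrable_diff Bochner_Integration.integrable_add integrable_mult_right) auto
  qed
  also have "\<dots> = \<theta> * (LBINT z. ?k z * (?i z * (?h (x + z) - ?h x))) + (d / 4) powr (- N) * (LBINT z. g2 (x + z))
      - \<kappa> * (M0 * (LBINT z. ?iS z) - (LBINT z. ?iS z * g2 (x + z)))"
    using near[OF \<tau>(1)] g2x(1) iSI Sg by simp
  also have "\<dots> \<le> \<theta> * X1 + (d / 4) powr (- N) * I - \<kappa> * (3 / 4 * M0 * (?\<omega> * l ^ DIM('a)) - I)"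
  proof (intro diff_mono add_mono mult_left_mono)
    show "(LBINT z. ?k z * (?i z * (?h (x + z) - ?h x))) \<le> X1"
      using near[OF \<tau>(1)] by simp
    show "(LBINT z. g2 (x + z)) \<le> I"
      using g2x g2le by simp
    \<comment> \<open>Removing the ball of radius \<open>2 * \<tau>\<close> is more than enough to
      avoid \<open>cball 0 \<tau>\<close>; since \<open>8 * \<tau> \<le> l\<close>, its radius is at
      most \<open>l / 4\<close> and its volume at most a quarter.\<close>
    have "3 / 4 * (?\<omega> * l ^ DIM('a)) \<le> (LBINT z. ?iS z)"
    proof -
      have "(LBINT z. indicator (ball (0::'a) l) z - indicator (ball (0::'a) (2 * \<tau>)) z) \<le> (LBINT z. ?iS z)"
      proof (rule integral_mono[OF _ iSI])
        show "integrable lborel (\<lambda>z. indicator (ball (0::'a) l) z - indicator (ball (0::'a) (2 * \<tau>)) z :: real)"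
          by (intro Bochner_Integration.integrable_diff integrable_indicator_ball)
        show "indicator (ball (0::'a) l) z - indicator (ball (0::'a) (2 * \<tau>)) z \<le> ?iS z" for z
          using \<tau> by (auto simp: indicator_def)
      qed
      moreover have "(LBINT z. indicator (ball (0::'a) l) z - indicator (ball (0::'a) (2 * \<tau>)) z) =
          measure lborel (ball (0::'a) l) - measure lborel (ball (0::'a) (2 * \<tau>))"
        using integrable_indicator_ball[of "0::'a"] by simp
      moreover have "measure lborel (ball (0::'a) (2 * \<tau>)) \<le> 1 / 4 * (?\<omega> * l ^ DIM('a))"
      proof -
        have "(2 * \<tau>) ^ DIM('a) \<le> (1 / 4 * l) ^ DIM('a)"
          using \<tau> by (intro power_mono) auto
        also have "\<dots> = (1 / 4) ^ DIM('a) * l ^ DIM('a)"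
          by (rule power_mult_distrib)
        also have "\<dots> \<le> (1 / 4) ^ 1 * l ^ DIM('a)"
          using l by (intro mult_right_mono power_decreasing) (auto simp: Suc_leI)
        finally have "(2 * \<tau>) ^ DIM('a) \<le> 1 / 4 * l ^ DIM('a)"
          by simp
        then have "?\<omega> * (2 * \<tau>) ^ DIM('a) \<le> ?\<omega> * (1 / 4 * l ^ DIM('a))"
          by (intro mult_left_mono) auto
        then show ?thesis
          using measure_ball_scale[of "2 * \<tau>" "0::'a"] \<tau> by simp
      qed
      ultimately show ?thesis
        using measure_ball_scale[of l "0::'a"] l by simp
    qed
    then have "M0 * (3 / 4 * (?\<omega> * l ^ DIM('a))) \<le> M0 * (LBINT z. ?iS z)"
      using M0 by (rule mult_left_mono)
    then show "3 / 4 * M0 * (?\<omega> * l ^ DIM('a)) \<le> M0 * (LBINT z. ?iS z)"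
      by (simp add: ac_simps)
    have "(LBINT z. ?iS z * g2 (x + z)) \<le> (LBINT z. g2 (x + z))"
      by (rule integral_mono[OF Sg g2x(1)]) (use g20 in \<open>auto simp: indicator_def\<close>)
    then show "(LBINT z. ?iS z * g2 (x + z)) \<le> I"
      using g2x g2le by simp
  qed (use \<theta> \<kappa>0 in auto)
  finally show ?thesis
    by (simp add: v_def M0_def \<kappa>_def)
qed

end

lemma conv_ge_AE:
  assumes \<rho>: "mollifier \<epsilon> \<rho>" and A: "integrable lborel A"
    and ge: "AE w in lborel. norm (x - w) < \<epsilon> \<longrightarrow> M \<le> A w"
  shows "M \<le> conv \<rho> A x"
proof -
  have [measurable]: "\<rho> \<in> borel_measurable borel"
    using mollifierD(5)[OF \<rho>] by auto
  have r: "integrable lborel (\<lambda>w. \<rho> (x - w))" "(LBINT w. \<rho> (x - w)) = 1"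
    using lborel_reflect[of \<rho> x] mollifierD(5,6)[OF \<rho>] by auto
  have "(LBINT w. \<rho> (x - w) * M) \<le> conv \<rho> A x"
    unfolding conv_def
  proof (rule integral_mono_AE)
    show "AE w in lborel. \<rho> (x - w) * M \<le> \<rho> (x - w) * A w"
      using ge
    proof (rule eventually_mono)
      fix w assume "norm (x - w) < \<epsilon> \<longrightarrow> M \<le> A w"
      then show "\<rho> (x - w) * M \<le> \<rho> (x - w) * A w"
        using mollifierD(2,4)[OF \<rho>, of "x - w"] by (cases "norm (x - w) < \<epsilon>") (auto intro: mult_left_mono)
    qed
  qed (use r conv_integrable[OF mollifierD(1)[OF \<rho>] A] in auto)
  then show ?thesis
    using r by simp
qed

context supersolution
begin

lemma barrier_near_estimates:
  obtains C where "0 \<le> C" "\<And>(c::'a) r x d. x \<in> ball c r \<Longrightarrow> d = r - norm (x - c) \<Longrightarrow>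
     (\<forall>z. norm z \<le> d / 4 \<longrightarrow> x + z \<in> ball c r \<and> (2 / 3) ^ DIM('a) * barrier c r x \<le> barrier c r (x + z)) \<and>
     (\<forall>\<tau>>0. integrable lborel (\<lambda>z. knear N r \<tau> z * (indicator (ball 0 (d / 4)) z * (barrier c r (x + z) - barrier c r x))) \<and>
     (LBINT z. knear N r \<tau> z * (indicator (ball 0 (d / 4)) z * (barrier c r (x + z) - barrier c r x)))
       \<le> C * (barrier c r x * d powr (- 2 * s)))"
proof -
  obtain C where C: "0 \<le> C" "\<And>(c::'a) r x d \<tau>. x \<in> ball c r \<Longrightarrow> d = r - norm (x - c) \<Longrightarrow> 0 < \<tau> \<Longrightarrow>
     integrable lborel (\<lambda>z. knear N r \<tau> z * (indicator (ball 0 (d / 4)) z * (barrier c r (x + z) - barrier c r x))) \<and>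
     (LBINT z. knear N r \<tau> z * (indicator (ball 0 (d / 4)) z * (barrier c r (x + z) - barrier c r x)))
       \<le> C * (barrier c r x * d powr (- 2 * s))"
    using near_barrier_bound by blast
  have B: "\<forall>z. norm z \<le> d / 4 \<longrightarrow> x + z \<in> ball c r \<and> (2 / 3) ^ DIM('a) * barrier c r x \<le> barrier c r (x + z)"
    if x: "x \<in> ball c r" and d: "d = r - norm (x - c)" for c x :: 'a and r d
    using barrier_increment[where 'a='a] x d by blast
  show ?thesis
    by (rule that[OF C(1)]) (use B C(2) in blast)
qed

text \<open>At a contact point a lower bound on the mollified function bounds the barrier from
  above, and this turns into a depth that is the same for all contact points. The maximum with 1
  allows the power \<open>DIM('a)\<close> in \<open>barrier_lower\<close> to be dropped.\<close>

lemma barrier_depth: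
  fixes c :: 'a
  assumes x: "x \<in> ball c r" and d: "d = r - norm (x - c)" and le: "barrier c r x \<le> Y"
  shows "r / (2 * max 1 Y) \<le> d"
proof -
  have "norm (x - c) < r"
    using x by (simp add: dist_norm norm_minus_commute)
  then have d0: "0 < d" "0 < r"
    using norm_ge_zero[of "x - c"] unfolding d by linarith+
  have "r / (2 * d) \<le> max 1 Y"
  proof (cases "1 \<le> r / (2 * d)")
    case True
    then have "r / (2 * d) \<le> (r / (2 * d)) ^ DIM('a)"
      by (intro self_le_power) auto
    also have "\<dots> \<le> Y"
      using barrier_lower[OF x d] le by linarith
    finally show ?thesis by simp
  qed simp
  then have "r \<le> max 1 Y * (2 * d)"
    using d0 by (simp add: divide_le_eq)
  then show ?thesis
    by (simp add: divide_le_eq algebra_simps max_def split: if_splits)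
qed

text \<open>\<open>\<nu>\<close> depends on \<open>A\<close> but not on the ball, \<open>q\<close>
  or \<open>\<theta>\<close>, as the hypotheses are scale invariant. The ratio \<open>l\<close> is
  fixed before \<open>\<nu>\<close>: it makes the gain beat the barrier and the tail, and
  \<open>\<nu>\<close> is then small enough for the deficit terms, which carry the large factor
  \<open>l powr (- N)\<close>.\<close>

lemma lower_bound:
  assumes A: "0 \<le> A"
  shows "\<exists>\<nu>>0. \<forall>c r q \<theta>. 0 < r \<longrightarrow> 0 < \<theta> \<longrightarrow> cball c (4 * r) \<subseteq> \<Omega> \<longrightarrow>
    (LBINT y. indicator (cball c (3 * r)) y * max 0 (q - u y)) \<le> \<nu> * \<theta> * r ^ DIM('a) \<longrightarrow>
    (LBINT y. indicator (\<Omega> - cball c (3 * r)) y * (max 0 (q - u y) * kfar N r (c - y))) \<le> A * \<theta> * r powr (- 2 * s) \<longrightarrow>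
    (AE x in lborel. x \<in> ball c r \<longrightarrow> q - \<theta> * barrier c r x \<le> u x)"
proof -
  let ?n = "DIM('a)"
  let ?\<omega> = "measure lborel (ball (0::'a) 1)"
  obtain C where C: "0 \<le> C" and CD: "\<And>(c::'a) r x d. x \<in> ball c r \<Longrightarrow> d = r - norm (x - c) \<Longrightarrow>
     (\<forall>z. norm z \<le> d / 4 \<longrightarrow> x + z \<in> ball c r \<and> (2 / 3) ^ DIM('a) * barrier c r x \<le> barrier c r (x + z)) \<and>
     (\<forall>\<tau>>0. integrable lborel (\<lambda>z. knear N r \<tau> z * (indicator (ball 0 (d / 4)) z * (barrier c r (x + z) - barrier c r x))) \<and>
     (LBINT z. knear N r \<tau> z * (indicator (ball 0 (d / 4)) z * (barrier c r (x + z) - barrier c r x)))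
       \<le> C * (barrier c r x * d powr (- 2 * s)))"
    using barrier_near_estimates by blast
  have \<omega>: "0 < ?\<omega>"
    using content_ball_gt_0_iff[of "0::'a" 1] by (simp add: measure_completion)
  \<comment> \<open>\<open>3 / 8\<close> is \<open>1 / 2\<close> from the kernel on the shell times
    \<open>3 / 4\<close> from the volume of the shell.\<close>
  define B2 where "B2 = 3 / 8 * ?\<omega> * (2 / 3) ^ ?n"
  have B2: "0 < B2"
    using \<omega> by (simp add: B2_def)
  \<comment> \<open>All terms will be measured in units of \<open>\<theta> * X\<close>. The 2
    reserves one unit for all deficit terms together and one for the margin.\<close>
  define Z where "Z = (C + 2 powr N * A + 2) / B2"
  have Z: "0 < Z"
    using C A B2 by (simp add: Z_def add_nonneg_pos)
  define l where "l = min (1 / 4) (Z powr (- 1 / (2 * s)))"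
  have l: "0 < l" "l \<le> 1 / 4"
    using Z by (auto simp: l_def)
  have lZ: "C + 2 powr N * A + 2 \<le> B2 * l powr (- 2 * s)"
  proof -
    have "(Z powr (- 1 / (2 * s))) powr (- 2 * s) \<le> l powr (- 2 * s)"
      using l s by (intro powr_mono2') (auto simp: l_def)
    then have "Z \<le> l powr (- 2 * s)"
      using s Z by (simp add: powr_powr)
    then show ?thesis
      using B2 by (simp add: Z_def divide_le_eq mult.commute)
  qed
  \<comment> \<open>The factors with which the deficit enters: from outside \<open>d / 4\<close>,
    from the shell, and from the far kernel. The powers \<open>2 ^ ?n\<close> come from the bound
    \<open>(r / (2 * d)) ^ ?n\<close> on the barrier.\<close>
  define E where "E = 4 powr N * 2 ^ ?n + l powr (- N) * 2 ^ ?n + 1"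
  have E: "0 < E"
    by (simp add: E_def add_nonneg_pos)
  define \<nu> where "\<nu> = 1 / E"
  have \<nu>: "0 < \<nu>"
    using E by (simp add: \<nu>_def)
  have "AE x in lborel. x \<in> ball c r \<longrightarrow> q - \<theta> * barrier c r x \<le> u x"
    if r: "0 < r" and \<theta>: "0 < \<theta>" and G: "cball c (4 * r) \<subseteq> \<Omega>"
      and I: "(LBINT y. indicator (cball c (3 * r)) y * max 0 (q - u y)) \<le> \<nu> * \<theta> * r ^ ?n"
      and T: "(LBINT y. indicator (\<Omega> - cball c (3 * r)) y * (max 0 (q - u y) * kfar N r (c - y))) \<le> A * \<theta> * r powr (- 2 * s)"
    for c r q \<theta>
  proof -
    let ?h = "barrier c r"
    define II where "II = (LBINT y. indicator (cball c (3 * r)) y * max 0 (q - u y))"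
    define TT where "TT = (LBINT y. indicator (\<Omega> - cball c (3 * r)) y * (max 0 (q - u y) * kfar N r (c - y)))"
    note I = I[folded II_def] and T = T[folded TT_def]
    define b where "b = (\<lambda>x. q - \<theta> * ?h x)"
    have bq: "b x \<le> q" if "x \<in> ball c r" for x
      using barrier_ge_1[OF that] \<theta> by (simp add: b_def)
    have "AE x in lborel. x \<in> ball c r \<longrightarrow> b x \<le> u x"
    proof (rule comparison[OF G r _ bq])
      show "continuous_on (ball c r) b"
        unfolding b_def by (intro continuous_intros barrier_continuous)
      show "0 < \<theta> * r powr (- 2 * s)"
        using \<theta> r by simp
      fix \<epsilon> \<rho> ue
      assume \<epsilon>: "0 < \<epsilon>" "\<epsilon> \<le> r" and \<rho>: "mollifier \<epsilon> \<rho>" and ue: "ue = conv \<rho> (trunc c (4 * r))"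
      obtain M where M: "\<And>y. \<bar>ue y\<bar> \<le> M"
        using conv_bounded[OF \<rho> trunc_integrable(1)[OF G]] unfolding ue by metis
      \<comment> \<open>Contact means \<open>\<theta> * ?h x < q - ue x\<close>; this bounds the
        barrier by \<open>Y\<close> and hence the depth from below by \<open>d0\<close>. The
        truncation index can then be chosen before the contact point.\<close>
      define Y where "Y = (\<bar>q\<bar> + M) / \<theta>"
      define d0 where "d0 = r / (2 * max 1 Y)"
      have d0: "0 < d0"
        using r by (simp add: d0_def)
      obtain m0 where m0: "inverse (real (Suc m0)) < l * d0 / 8"
        using reals_Archimedean[of "l * d0 / 8"] l d0 by auto
      show "\<exists>m0. \<forall>m x. m \<ge> m0 \<longrightarrow> x \<in> ball c r \<longrightarrow> ue x < b x \<longrightarrow>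
         (LBINT z. knear N r (inverse (real (Suc m))) z * (b x - (ue (x + z) + excess c r b ue (x + z))))
         + (far_pot N r (indicator \<Omega>) x * b x - far_pot N r u x) \<le> - (\<theta> * r powr (- 2 * s))"
      proof (intro exI[of _ m0] allI impI)
        fix m x assume m: "m0 \<le> m" and x: "x \<in> ball c r" and less: "ue x < b x"
        define d where "d = r - norm (x - c)"
        have dr: "0 < d" "d \<le> r"
          using x unfolding d_def by (auto simp: dist_norm norm_minus_commute)
        have h1: "1 \<le> ?h x"
          by (rule barrier_ge_1[OF x])
        have "\<theta> * ?h x \<le> \<bar>q\<bar> + M"
          using less M[of x] by (simp add: b_def)
        then have "?h x \<le> Y"
          using \<theta> by (simp add: Y_def pos_le_divide_eq mult.commute)
        then have dd0: "d0 \<le> d"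
          unfolding d0_def by (rule barrier_depth[OF x d_def])
        have \<tau>: "0 < inverse (real (Suc m))" "8 * inverse (real (Suc m)) \<le> l * d"
        proof -
          have "inverse (real (Suc m)) \<le> inverse (real (Suc m0))"
            using m by (intro le_imp_inverse_le) auto
          also have "\<dots> \<le> l * d / 8"
          proof -
            have "l * d0 \<le> l * d"
              using dd0 l by (intro mult_left_mono) auto
            then show ?thesis
              using m0 by linarith
          qed
          finally show "8 * inverse (real (Suc m)) \<le> l * d" by simp
        qed simp
        define X where "X = ?h x * d powr (- 2 * s)"
        have X0: "0 \<le> X"
          using h1 by (simp add: X_def)
        have near: "(LBINT z. knear N r (inverse (real (Suc m))) z * (b x - (ue (x + z) + excess c r b ue (x + z))))
            \<le> \<theta> * (C * X) + (d / 4) powr (- N) * II - 1 / 2 * (l * d) powr (- N) *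
               (3 / 4 * (\<theta> * (2 / 3) ^ ?n * ?h x) * (?\<omega> * (l * d) ^ ?n) - II)"
          unfolding II_def
        proof (rule near_integral_bound[OF G r \<rho> \<epsilon>(2) ue \<theta> b_def x d_def _ _ _ \<tau>])
          show "integrable lborel (\<lambda>z. knear N r \<tau> z * (indicator (ball 0 (d / 4)) z * (?h (x + z) - ?h x))) \<and>
             (LBINT z. knear N r \<tau> z * (indicator (ball 0 (d / 4)) z * (?h (x + z) - ?h x))) \<le> C * X"
            if "0 < \<tau>" for \<tau>
            using CD[OF x d_def] that by (simp add: X_def)
          show "0 < l * d" "l * d \<le> d / 4"
            using l dr mult_right_mono[OF l(2), of d] by auto
          show "x + z \<in> ball c r \<and> (2 / 3) ^ ?n * ?h x \<le> ?h (x + z)" if "norm z \<le> d / 4" for z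
            using CD[OF x d_def] that by blast
        qed
        have far: "far_pot N r (indicator \<Omega>) x * b x - far_pot N r u x \<le> r powr (- N) * II + 2 powr N * TT"
          unfolding II_def TT_def by (rule far_integral_bound(1)[OF r x bq[OF x] G])
        have dN: "t ^ ?n * t powr (- N) = t powr (- 2 * s)" if "0 < t" for t :: real
          using that by (simp add: N_def powr_realpow[symmetric] powr_add[symmetric])
        have rX: "r powr (- 2 * s) \<le> X"
        proof -
          have "r powr (- 2 * s) \<le> d powr (- 2 * s)"
            using dr s by (intro powr_mono2') auto
          also have "\<dots> \<le> X"
            unfolding X_def using mult_right_mono[OF h1, of "d powr (- 2 * s)"] by simp
          finally show ?thesis .
        qed
        \<comment> \<open>The allowed deficit is proportional to \<open>r ^ ?n\<close> but is
          weighted by a kernel at scale \<open>d\<close>; the growth of the barrier compensates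
          exactly the factor \<open>(r / d) ^ ?n\<close>.\<close>
        have rnX: "r ^ ?n * d powr (- N) \<le> 2 ^ ?n * X"
        proof -
          have "(r / (2 * d)) ^ ?n \<le> ?h x"
            by (rule barrier_lower[OF x d_def])
          then have "r ^ ?n \<le> ?h x * (2 ^ ?n * d ^ ?n)"
            using dr by (simp add: power_divide power_mult_distrib divide_le_eq)
          then have "r ^ ?n * d powr (- N) \<le> ?h x * (2 ^ ?n * d ^ ?n) * d powr (- N)"
            by (intro mult_right_mono) auto
          also have "\<dots> = 2 ^ ?n * (?h x * (d ^ ?n * d powr (- N)))"
            by simp
          also have "\<dots> = 2 ^ ?n * X"
            by (simp only: dN[OF dr(1)] X_def)
          finally show ?thesis .
        qed
        have gen: "K * d powr (- N) * II \<le> K * 2 ^ ?n * (\<nu> * \<theta> * X)" if "0 \<le> K" for K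
        proof -
          have "K * d powr (- N) * II \<le> K * d powr (- N) * (\<nu> * \<theta> * r ^ ?n)"
            using I that by (intro mult_left_mono) auto
          also have "\<dots> = K * (\<nu> * \<theta>) * (r ^ ?n * d powr (- N))"
            by simp
          also have "\<dots> \<le> K * (\<nu> * \<theta>) * (2 ^ ?n * X)"
            using rnX that \<nu> \<theta> by (intro mult_left_mono) auto
          finally show ?thesis
            by (simp add: ac_simps)
        qed
        have t1: "(d / 4) powr (- N) * II \<le> 4 powr N * 2 ^ ?n * (\<nu> * \<theta> * X)"
        proof -
          have "(d / 4) powr (- N) = 4 powr N * d powr (- N)"
            using dr powr_minus_divide[of "4::real" N] by (simp add: powr_divide)
          then show ?thesis
            using gen[of "4 powr N"] by simp
        qed
        have ld: "(l * d) powr (- N) = l powr (- N) * d powr (- N)"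
          by (rule powr_mult)
        have II0: "0 \<le> II"
          unfolding II_def by (intro Bochner_Integration.integral_nonneg) simp
        have t2: "1 / 2 * (l * d) powr (- N) * II \<le> l powr (- N) * 2 ^ ?n * (\<nu> * \<theta> * X)"
        proof -
          have "1 / 2 * (l * d) powr (- N) * II \<le> l powr (- N) * d powr (- N) * II"
            unfolding ld using II0 by (intro mult_right_mono) auto
          also have "\<dots> \<le> l powr (- N) * 2 ^ ?n * (\<nu> * \<theta> * X)"
            by (rule gen) simp
          finally show ?thesis .
        qed
        have t3: "r powr (- N) * II \<le> 1 * (\<nu> * \<theta> * X)"
        proof -
          have "r powr (- N) * II \<le> r powr (- N) * (\<nu> * \<theta> * r ^ ?n)"
            using I by (intro mult_left_mono) auto
          also have "\<dots> = \<nu> * \<theta> * (r ^ ?n * r powr (- N))"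
            by simp
          also have "\<dots> = \<nu> * \<theta> * r powr (- 2 * s)"
            by (simp only: dN[OF r])
          also have "\<dots> \<le> \<nu> * \<theta> * X"
            using rX \<nu> \<theta> by (intro mult_left_mono) auto
          finally show ?thesis by simp
        qed
        have t4: "2 powr N * TT \<le> 2 powr N * A * (\<theta> * X)"
        proof -
          have "2 powr N * TT \<le> 2 powr N * (A * \<theta> * r powr (- 2 * s))"
            using T by (intro mult_left_mono) auto
          also have "\<dots> \<le> 2 powr N * (A * \<theta> * X)"
            using rX A \<theta> by (intro mult_left_mono) auto
          finally show ?thesis by simp
        qed
        have t5: "1 / 2 * (l * d) powr (- N) * (3 / 4 * (\<theta> * (2 / 3) ^ ?n * ?h x) * (?\<omega> * (l * d) ^ ?n))
            = B2 * l powr (- 2 * s) * (\<theta> * X)"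
        proof -
          have "1 / 2 * (l * d) powr (- N) * (3 / 4 * (\<theta> * (2 / 3) ^ ?n * ?h x) * (?\<omega> * (l * d) ^ ?n)) =
            B2 * (\<theta> * ?h x) * ((l * d) ^ ?n * (l * d) powr (- N))"
            by (simp add: B2_def)
          also have "(l * d) ^ ?n * (l * d) powr (- N) = l powr (- 2 * s) * d powr (- 2 * s)"
            using dN[of "l * d"] l dr powr_mult[of l d "- 2 * s"] by simp
          finally show ?thesis
            by (simp add: X_def)
        qed
        have sum1: "4 powr N * 2 ^ ?n * (\<nu> * \<theta> * X) + l powr (- N) * 2 ^ ?n * (\<nu> * \<theta> * X) + 1 * (\<nu> * \<theta> * X) = \<theta> * X"
        proof -
          have "4 powr N * 2 ^ ?n * (\<nu> * \<theta> * X) + l powr (- N) * 2 ^ ?n * (\<nu> * \<theta> * X) + 1 * (\<nu> * \<theta> * X) = (E * \<nu>) * (\<theta> * X)"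
            by (simp add: E_def algebra_simps)
          also have "E * \<nu> = 1"
            using E by (simp add: \<nu>_def)
          finally show ?thesis by simp
        qed
        have "(C + 2 powr N * A + 2) * (\<theta> * X) \<le> B2 * l powr (- 2 * s) * (\<theta> * X)"
          using lZ \<theta> X0 by (intro mult_right_mono) auto
        then have fin: "\<theta> * (C * X) + 2 powr N * A * (\<theta> * X) + 2 * (\<theta> * X) \<le> B2 * l powr (- 2 * s) * (\<theta> * X)"
          by (simp add: algebra_simps)
        have "\<theta> * r powr (- 2 * s) \<le> \<theta> * X"
          using rX \<theta> by (intro mult_left_mono) auto
        moreover have "1 / 2 * (l * d) powr (- N) *
               (3 / 4 * (\<theta> * (2 / 3) ^ ?n * ?h x) * (?\<omega> * (l * d) ^ ?n) - II)
             = B2 * l powr (- 2 * s) * (\<theta> * X) - 1 / 2 * (l * d) powr (- N) * II"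
          unfolding t5[symmetric] by (rule right_diff_distrib)
        ultimately show "(LBINT z. knear N r (inverse (real (Suc m))) z * (b x - (ue (x + z) + excess c r b ue (x + z))))
         + (far_pot N r (indicator \<Omega>) x * b x - far_pot N r u x) \<le> - (\<theta> * r powr (- 2 * s))"
          using near far t1 t2 t3 t4 sum1 fin by linarith
      qed
    qed
    then show ?thesis
      by (simp add: b_def)
  qed
  then show ?thesis
    using \<nu> by (intro exI[of _ \<nu>]) blast
qed


section \<open>The strong minimum principle\<close>

text \<open>Since \<open>u \<ge> m\<close>, every unfavourable term is proportional to the height
  \<open>\<theta>\<close> of the barrier above \<open>m\<close>, whereas the pull \<open>K\<close>
  of the set where \<open>u > m\<close> is fixed. A small \<open>\<theta>\<close> therefore
  suffices, and the far kernel feels that set from every \<open>c\<close>, however distant.\<close>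

lemma strong_minimum:
  assumes m: "AE x in lborel. x \<in> \<Omega> \<longrightarrow> m \<le> u x" and nc: "\<not> (AE x in lborel. x \<in> \<Omega> \<longrightarrow> u x = m)"
    and c: "c \<in> \<Omega>"
  shows "\<exists>e>0. \<exists>p>m. ball c e \<subseteq> \<Omega> \<and> (AE x in lborel. x \<in> ball c e \<longrightarrow> p \<le> u x)"
proof -
  let ?n = "DIM('a)"
  obtain C where C: "0 \<le> C" and CD: "\<And>(c::'a) r x d. x \<in> ball c r \<Longrightarrow> d = r - norm (x - c) \<Longrightarrow>
     (\<forall>z. norm z \<le> d / 4 \<longrightarrow> x + z \<in> ball c r \<and> (2 / 3) ^ DIM('a) * barrier c r x \<le> barrier c r (x + z)) \<and>
     (\<forall>\<tau>>0. integrable lborel (\<lambda>z. knear N r \<tau> z * (indicator (ball 0 (d / 4)) z * (barrier c r (x + z) - barrier c r x))) \<and>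
     (LBINT z. knear N r \<tau> z * (indicator (ball 0 (d / 4)) z * (barrier c r (x + z) - barrier c r x)))
       \<le> C * (barrier c r x * d powr (- 2 * s)))"
    using barrier_near_estimates by blast
  obtain C2 where C2: "0 \<le> C2"
    "\<forall>R>0. integrable lborel (\<lambda>z::'a. indicator (- ball 0 R) z * norm z powr (- N)) \<and>
      (LBINT z::'a. indicator (- ball 0 R) z * norm z powr (- N)) \<le> C2 * R powr (- 2 * s)"
    using outer_kernel_integral[OF s(1), where 'a='a, folded N_def] by (elim exE conjE)
  obtain R where R: "0 < R" "cball c R \<subseteq> \<Omega>"
    using open_\<Omega> c open_contains_cball by blast
  define r where "r = R / 4"
  have r: "0 < r" and G: "cball c (4 * r) \<subseteq> \<Omega>"
    using R by (auto simp: r_def)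
  let ?h = "barrier c r"
  let ?F = "\<lambda>x y. indicator \<Omega> y * (u y - m) * kfar N r (x - y)"
  have Fi: "integrable lborel (\<lambda>y. indicator \<Omega> y * kfar N r (x - y))" "integrable lborel (\<lambda>y. u y * kfar N r (x - y))" for x
    using far_pot_integrable[OF r N_pos(2) indicator_weight] far_pot_integrable[OF r N_pos(2) u_weight] by auto
  have Feq: "?F x y = u y * kfar N r (x - y) - m * (indicator \<Omega> y * kfar N r (x - y))" for x y
    using u_zero[of y] by (cases "y \<in> \<Omega>") (auto simp: algebra_simps)
  have FI: "integrable lborel (?F x)" for x
    unfolding Feq using Fi[of x] by auto
  have F0: "AE y in lborel. 0 \<le> ?F x y" for x
    using m by (rule eventually_mono) (auto simp: kfar_nonneg indicator_def)
  have kpos: "0 < kfar N r z" for z :: 'a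
    using r by (auto simp: kfar_def max_def)
  \<comment> \<open>The far kernel is positive everywhere, so \<open>K = 0\<close> would force
    \<open>u = m\<close> almost everywhere on \<open>\<Omega>\<close>. Moving from \<open>c\<close>
    to another point of the ball changes the kernel by at most the factor
    \<open>2 powr N\<close>.\<close>
  define K where "K = (LBINT y. ?F c y)"
  have K: "0 < K"
  proof -
    have "K \<noteq> 0"
    proof
      assume "K = 0"
      then have "AE y in lborel. ?F c y = 0"
        unfolding K_def using integral_nonneg_eq_0_iff_AE[OF FI F0, of c] by simp
      then have "AE y in lborel. y \<in> \<Omega> \<longrightarrow> u y = m"
      proof (rule eventually_mono, intro impI)
        fix y assume "?F c y = 0" "y \<in> \<Omega>"
        then show "u y = m"
          using kpos[of "c - y"] by simp
      qed
      then show False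
        using nc by blast
    qed
    moreover have "0 \<le> K"
      unfolding K_def by (rule integral_nonneg_AE[OF F0])
    ultimately show ?thesis by simp
  qed
  have k2: "kfar N r (x - y) \<le> 2 powr N * kfar N r (x' - y)" if "norm (x - x') \<le> r" for x x' y :: 'a
  proof -
    have m: "max (norm (x' - y)) r / 2 \<le> max (norm (x - y)) r"
      using that r norm_triangle_ineq[of "x' - x" "x - y"] by (auto simp: norm_minus_commute)
    have "kfar N r (x - y) \<le> (max (norm (x' - y)) r / 2) powr (- N)"
      unfolding kfar_def using m r N_pos by (intro powr_mono2') (auto simp: max_def)
    also have "\<dots> = 2 powr N * kfar N r (x' - y)"
      using r by (simp add: kfar_def powr_divide powr_minus_divide)
    finally show ?thesis .
  qed
  let ?V = "far_pot N r (indicator \<Omega>)"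
  have V0: "0 \<le> ?V c"
    by (rule far_pot_\<Omega>_nonneg)
  \<comment> \<open>The unfavourable terms per unit of \<open>\<theta>\<close>: increments of the
    barrier at depth at least \<open>r / 4\<close>, the near kernel outside \<open>d / 4\<close>,
    which is at least \<open>r / 16\<close>, and the far potential of \<open>\<Omega>\<close>. The
    choice of \<open>\<theta>\<close> keeps their total at most half of the gain.\<close>
  define L where "L = C * (2 * (r / 4) powr (- 2 * s)) + C2 * (r / 16) powr (- 2 * s) + 2 powr N * ?V c"
  have L: "0 \<le> L"
    using C C2(1) V0 by (simp add: L_def)
  define \<theta> where "\<theta> = 2 powr (- N) * K / (2 * (L + 1))"
  have \<theta>: "0 < \<theta>"
    using K L by (simp add: \<theta>_def)
  have \<theta>L: "\<theta> * L \<le> 2 powr (- N) * K / 2"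
  proof -
    have "\<theta> * L \<le> \<theta> * (L + 1)"
      using \<theta> by simp
    also have "\<dots> = 2 powr (- N) * K / 2"
    proof -
      have "L + 1 \<noteq> 0"
        using L by simp
      then show ?thesis
        unfolding \<theta>_def times_divide_eq_left by (rule nonzero_mult_divide_mult_cancel_right)
    qed
    finally show ?thesis .
  qed
  \<comment> \<open>The barrier is at least 1, with value 1 at the centre, so \<open>b\<close> peaks
    at \<open>m + \<theta>\<close>. At contact \<open>m \<le> ue x < b x\<close> forces the barrier
    below 2, which gives the depth \<open>r / 4\<close>.\<close>
  define q where "q = m + 2 * \<theta>"
  define b where "b = (\<lambda>x. q - \<theta> * ?h x)"
  have b1: "b x \<le> m + \<theta>" if "x \<in> ball c r" for x
    using mult_left_mono[OF barrier_ge_1[OF that], of \<theta>] \<theta> by (simp add: b_def q_def)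
  have bq: "b x \<le> q" if "x \<in> ball c r" for x
    using b1[OF that] \<theta> by (simp add: q_def)
  have "AE x in lborel. x \<in> ball c r \<longrightarrow> b x \<le> u x"
  proof (rule comparison[OF G r _ bq])
    show "continuous_on (ball c r) b"
      unfolding b_def by (intro continuous_intros barrier_continuous)
    show "0 < 2 powr (- N) * K / 2"
      using K by simp
    fix \<epsilon> \<rho> ue
    assume \<epsilon>: "0 < \<epsilon>" "\<epsilon> \<le> r" and \<rho>: "mollifier \<epsilon> \<rho>" and ue: "ue = conv \<rho> (trunc c (4 * r))"
    have UI: "integrable lborel (trunc c (4 * r))"
      by (rule trunc_integrable(1)[OF G])
    have uem: "ue \<in> borel_measurable borel"
      using integrable_conv[OF mollifierD(5)[OF \<rho>] UI] by (auto simp: ue)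
    obtain M where M: "\<And>y. \<bar>ue y\<bar> \<le> M"
      using conv_bounded[OF \<rho> UI] unfolding ue by metis
    have uem': "m \<le> ue y" if y: "y \<in> ball c (2 * r)" for y
      unfolding ue
    proof (rule conv_ge_AE[OF \<rho> UI])
      show "AE w in lborel. norm (y - w) < \<epsilon> \<longrightarrow> m \<le> trunc c (4 * r) w"
        using m
      proof (rule eventually_mono, intro impI)
        fix w assume w: "w \<in> \<Omega> \<longrightarrow> m \<le> u w" "norm (y - w) < \<epsilon>"
        have "w \<in> cball c (4 * r)"
          using w(2) y \<epsilon> r dist_triangle[of c w y] by (auto simp: dist_norm)
        then show "m \<le> trunc c (4 * r) w"
          using w(1) G by (auto simp: trunc_def)
      qed
    qed
    have bm: "(\<lambda>x. indicator (ball c r) x * b x) \<in> borel_measurable borel"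
      unfolding b_def by (intro borel_measurable_times borel_measurable_indicator borel_measurable_diff borel_measurable_const barrier_measurable) auto
    define v where "v = (\<lambda>y. ue y + excess c r b ue y)"
    note E = excess_bounds[where b = b and w = ue, OF bq bm uem M]
    have vm[measurable]: "v \<in> borel_measurable borel"
      unfolding v_def by (intro borel_measurable_add uem E(1))
    have vB: "\<bar>v y\<bar> \<le> M + (\<bar>q\<bar> + M)" for y
      using M[of y] E(3)[of y] unfolding v_def by linarith
    have vb: "b y \<le> v y" if "y \<in> ball c r" for y
      using that by (simp add: v_def excess_def)
    have vue: "ue y \<le> v y" for y
      using E(2)[of y] by (simp add: v_def)
    show "\<exists>m0. \<forall>m x. m \<ge> m0 \<longrightarrow> x \<in> ball c r \<longrightarrow> ue x < b x \<longrightarrow>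
       (LBINT z. knear N r (inverse (real (Suc m))) z * (b x - (ue (x + z) + excess c r b ue (x + z))))
       + (far_pot N r (indicator \<Omega>) x * b x - far_pot N r u x) \<le> - (2 powr (- N) * K / 2)"
    \<comment> \<open>All estimates here are uniform in the truncation, so every index is
      admissible.\<close>
    proof (intro exI[of _ 0] allI impI)
      fix j x assume x: "x \<in> ball c r" and less: "ue x < b x"
      let ?k = "knear N r (inverse (real (Suc j))) :: 'a \<Rightarrow> real"
      define d where "d = r - norm (x - c)"
      have dr: "0 < d" "d \<le> r"
        using x unfolding d_def by (auto simp: dist_norm norm_minus_commute)
      let ?i = "indicator (ball 0 (d / 4)) :: 'a \<Rightarrow> real"
      let ?o = "\<lambda>z::'a. indicator (- ball 0 (d / 4)) z * norm z powr (- N) :: real"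
      have k0: "0 \<le> ?k z" for z
        using N_pos by (simp add: knear_nonneg)
      have kI: "integrable lborel ?k"
        by (rule knear_integrable[OF N_pos(2)]) simp
      have "m \<le> ue x"
        using x r by (intro uem') auto
      then have "\<theta> * ?h x \<le> \<theta> * 2"
        using less by (simp add: b_def q_def)
      then have h2: "?h x \<le> 2"
        using \<theta> by simp
      have d4: "r / 4 \<le> d"
        using barrier_depth[OF x d_def h2] by simp
      have near: "integrable lborel (\<lambda>z. ?k z * (?i z * (?h (x + z) - ?h x)))"
        "(LBINT z. ?k z * (?i z * (?h (x + z) - ?h x))) \<le> C * (?h x * d powr (- 2 * s))"
        using CD[OF x d_def] by auto
      have out: "integrable lborel ?o" "(LBINT z. ?o z) \<le> C2 * (d / 4) powr (- 2 * s)"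
        using C2(2) dr by auto
      have pw: "?k z * (b x - v (x + z)) \<le> \<theta> * (?k z * (?i z * (?h (x + z) - ?h x))) + \<theta> * ?o z" for z
      proof (cases "norm z < d / 4")
        case True
        then have "x + z \<in> ball c r"
          using CD[OF x d_def] by auto
        then have "b x - v (x + z) \<le> \<theta> * (?h (x + z) - ?h x)"
          using vb[of "x + z"] by (simp add: b_def algebra_simps)
        then have "?k z * (b x - v (x + z)) \<le> ?k z * (\<theta> * (?h (x + z) - ?h x))"
          using k0 by (rule mult_left_mono)
        then show ?thesis
          using True by (simp add: ac_simps)
      next
        case False
        have "?k z * (b x - v (x + z)) \<le> \<theta> * norm z powr (- N)"
        proof (cases "norm z < r")
          case True
          then have "x + z \<in> ball c (2 * r)"
            using x norm_triangle_ineq[of "x - c" z] by (simp add: dist_norm norm_minus_commute algebra_simps)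
          then have "b x - v (x + z) \<le> \<theta>"
            using uem'[of "x + z"] vue[of "x + z"] b1[OF x] by linarith
          then have "?k z * (b x - v (x + z)) \<le> ?k z * \<theta>"
            using k0 by (rule mult_left_mono)
          also have "\<dots> \<le> norm z powr (- N) * \<theta>"
            using \<theta> by (intro mult_right_mono knear_le_power) auto
          finally show ?thesis
            by (simp add: mult.commute)
        qed (use \<theta> in \<open>simp add: knear_def\<close>)
        then show ?thesis
          using False by simp
      qed
      have "(LBINT z. ?k z * (b x - v (x + z))) \<le>
          (LBINT z. \<theta> * (?k z * (?i z * (?h (x + z) - ?h x))) + \<theta> * ?o z)"
      proof (rule integral_mono[OF _ _ pw])
        show "integrable lborel (\<lambda>z. ?k z * (b x - v (x + z)))"
        proof (rule integrable_bounded_mult(2)[OF kI])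
          show "\<bar>b x - v (x + z)\<bar> \<le> \<bar>b x\<bar> + (M + (\<bar>q\<bar> + M))" for z
            using vB[of "x + z"] by linarith
        qed measurable
        show "integrable lborel (\<lambda>z. \<theta> * (?k z * (?i z * (?h (x + z) - ?h x))) + \<theta> * ?o z)"
          using near(1) out(1) by (intro Bochner_Integration.integrable_add integrable_mult_right)
      qed
      also have "\<dots> = \<theta> * (LBINT z. ?k z * (?i z * (?h (x + z) - ?h x))) + \<theta> * (LBINT z. ?o z)"
        using near(1) out(1) by simp
      also have "\<dots> \<le> \<theta> * (C * (2 * (r / 4) powr (- 2 * s))) + \<theta> * (C2 * (r / 16) powr (- 2 * s))"
      proof (intro add_mono mult_left_mono)
        have "?h x * d powr (- 2 * s) \<le> 2 * (r / 4) powr (- 2 * s)"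
          using h2 d4 r s by (intro mult_mono powr_mono2') auto
        then have "C * (?h x * d powr (- 2 * s)) \<le> C * (2 * (r / 4) powr (- 2 * s))"
          using C by (rule mult_left_mono)
        then show "(LBINT z. ?k z * (?i z * (?h (x + z) - ?h x))) \<le> C * (2 * (r / 4) powr (- 2 * s))"
          using near(2) by linarith
        have "(d / 4) powr (- 2 * s) \<le> (r / 16) powr (- 2 * s)"
          using d4 r s by (intro powr_mono2') auto
        then have "C2 * (d / 4) powr (- 2 * s) \<le> C2 * (r / 16) powr (- 2 * s)"
          using C2(1) by (rule mult_left_mono)
        then show "(LBINT z. ?o z) \<le> C2 * (r / 16) powr (- 2 * s)"
          using out(2) by linarith
      qed (use \<theta> in auto)
      finally have n: "(LBINT z. ?k z * (b x - v (x + z))) \<le>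
          \<theta> * (C * (2 * (r / 4) powr (- 2 * s))) + \<theta> * (C2 * (r / 16) powr (- 2 * s))" .
      have xc: "norm (x - c) \<le> r" "norm (c - x) \<le> r"
        using x by (auto simp: dist_norm norm_minus_commute)
      have "?V x * b x - far_pot N r u x = (b x - m) * ?V x - (LBINT y. ?F x y)"
        unfolding Feq far_pot_def using Fi[of x] by (simp add: algebra_simps)
      also have "\<dots> \<le> \<theta> * (2 powr N * ?V c) - 2 powr (- N) * K"
      proof (intro diff_mono)
        have "?V x \<le> (LBINT y. 2 powr N * (indicator \<Omega> y * kfar N r (c - y)))"
          unfolding far_pot_def
          by (rule integral_mono) (use Fi k2[OF xc(1)] in \<open>auto simp: indicator_def\<close>)
        then have Vx: "?V x \<le> 2 powr N * ?V c"
          by (simp add: far_pot_def)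
        have "(b x - m) * ?V x \<le> \<theta> * ?V x"
          using b1[OF x] far_pot_\<Omega>_nonneg by (intro mult_right_mono) auto
        also have "\<dots> \<le> \<theta> * (2 powr N * ?V c)"
          using Vx \<theta> by (intro mult_left_mono) auto
        finally show "(b x - m) * ?V x \<le> \<theta> * (2 powr N * ?V c)" .
        have "K \<le> (LBINT y. 2 powr N * ?F x y)"
          unfolding K_def
        proof (rule integral_mono_AE[OF FI])
          show "integrable lborel (\<lambda>y. 2 powr N * ?F x y)"
            using FI by (rule integrable_mult_right)
          show "AE y in lborel. ?F c y \<le> 2 powr N * ?F x y"
            using m
          proof (rule eventually_mono)
            fix y assume y: "y \<in> \<Omega> \<longrightarrow> m \<le> u y"
            show "?F c y \<le> 2 powr N * ?F x y"
            proof (cases "y \<in> \<Omega>")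
              case True
              then have "(u y - m) * kfar N r (c - y) \<le> (u y - m) * (2 powr N * kfar N r (x - y))"
                using k2[OF xc(2), of y] y by (intro mult_left_mono) auto
              then show ?thesis
                using True by (simp add: ac_simps)
            qed simp
          qed
        qed
        then have "2 powr (- N) * K \<le> 2 powr (- N) * (2 powr N * (LBINT y. ?F x y))"
          by (intro mult_left_mono) auto
        also have "\<dots> = (LBINT y. ?F x y)"
          by (simp add: mult.assoc[symmetric] powr_add[symmetric])
        finally show "2 powr (- N) * K \<le> (LBINT y. ?F x y)" .
      qed
      finally have f: "?V x * b x - far_pot N r u x \<le> \<theta> * (2 powr N * ?V c) - 2 powr (- N) * K" .
      have "\<theta> * (C * (2 * (r / 4) powr (- 2 * s))) + \<theta> * (C2 * (r / 16) powr (- 2 * s)) + \<theta> * (2 powr N * ?V c) = \<theta> * L"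
        by (simp add: L_def algebra_simps)
      then show "(LBINT z. ?k z * (b x - (ue (x + z) + excess c r b ue (x + z))))
         + (?V x * b x - far_pot N r u x) \<le> - (2 powr (- N) * K / 2)"
        using n f \<theta>L unfolding v_def by linarith
    qed
  qed
  moreover obtain e where e: "0 < e" "e \<le> r" "\<And>x. x \<in> ball c e \<Longrightarrow> ?h x \<le> 3 / 2"
  proof -
    have "isCont ?h c"
      using barrier_continuous[of c r] r continuous_on_eq_continuous_at[OF open_ball, of c r ?h] by auto
    moreover have "?h c = 1"
      by (simp add: barrier_def)
    ultimately obtain e where "e > 0" "\<And>x. dist x c < e \<Longrightarrow> dist (?h x) 1 < 1 / 2"
      unfolding continuous_at_eps_delta by (metis zero_less_divide_1_iff zero_less_numeral)
    then have "?h x \<le> 3 / 2" if "x \<in> ball c (min e r)" for x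
    proof -
      have "dist (?h x) 1 < 1 / 2"
        using that by (intro \<open>\<And>x. dist x c < e \<Longrightarrow> _\<close>) (simp add: dist_commute)
      then show ?thesis
        unfolding dist_real_def by linarith
    qed
    then show ?thesis
      using r \<open>e > 0\<close> by (intro that[of "min e r"]) auto
  qed
  ultimately have "AE x in lborel. x \<in> ball c e \<longrightarrow> m + \<theta> / 2 \<le> u x"
  proof (elim eventually_mono, intro impI)
    fix x assume 1: "x \<in> ball c r \<longrightarrow> b x \<le> u x" and x: "x \<in> ball c e"
    have "b x \<le> u x"
      using 1 x e(2) by auto
    moreover have "\<theta> * ?h x \<le> \<theta> * (3 / 2)"
      using e(3)[OF x] \<theta> by (intro mult_left_mono) auto
    ultimately show "m + \<theta> / 2 \<le> u x"
      by (simp add: b_def q_def)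
  qed
  moreover have "ball c e \<subseteq> \<Omega>"
    using G e r by (auto simp: subset_eq)
  ultimately show ?thesis
    using e(1) \<theta> by (intro exI[of _ e] exI[of _ "m + \<theta> / 2"] conjI) auto
qed

end

section \<open>The lower semicontinuous representative\<close>

text \<open>The exceptional null sets are indexed by uncountably many balls; the Lindelof property
  leaves countably many.\<close>

lemma AE_locally:
  fixes S :: "'a::euclidean_space set"
  assumes "\<And>x. x \<in> S \<Longrightarrow> \<exists>e>0. AE y in lborel. y \<in> ball x e \<longrightarrow> P y"
  shows "AE y in lborel. y \<in> S \<longrightarrow> P y"
proof -
  define F where "F = {ball x e |x e. AE y in lborel. y \<in> ball x e \<longrightarrow> P y}"
  have "\<And>B. B \<in> F \<Longrightarrow> open B"
    by (auto simp: F_def)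
  then obtain F' where F': "F' \<subseteq> F" "countable F'" "\<Union>F' = \<Union>F"
    using Lindelof[of F] by metis
  have "S \<subseteq> \<Union>F"
  proof
    fix x assume "x \<in> S"
    then obtain e where "e > 0" "AE y in lborel. y \<in> ball x e \<longrightarrow> P y"
      using assms by blast
    then have "ball x e \<in> F" "x \<in> ball x e"
      by (auto simp: F_def)
    then show "x \<in> \<Union>F" by blast
  qed
  have "\<forall>B\<in>F'. AE y in lborel. y \<in> B \<longrightarrow> P y"
    using F'(1) by (auto simp: F_def)
  then have "AE y in lborel. \<forall>B\<in>F'. y \<in> B \<longrightarrow> P y"
    by (subst AE_ball_countable[OF F'(2)])
  then show ?thesis
    by (rule eventually_mono) (use \<open>S \<subseteq> \<Union>F\<close> F'(3) in blast)
qed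

lemma barrier_half:
  fixes c :: "'a::euclidean_space"
  assumes x: "x \<in> ball c (r / 2)"
  shows "barrier c r x \<le> 2 ^ DIM('a)"
proof -
  have n: "norm (x - c) < r / 2"
    using x by (simp add: dist_norm norm_minus_commute)
  then have r: "0 < r"
    using norm_ge_zero[of "x - c"] by linarith
  have "(norm (x - c))\<^sup>2 \<le> (r / 2)\<^sup>2"
    using n by (intro power_mono) auto
  then have "(norm (x - c))\<^sup>2 / r\<^sup>2 \<le> 1 / 4"
    using r by (simp add: power2_eq_square field_simps)
  then have "1 / 2 \<le> 1 - (norm (x - c))\<^sup>2 / r\<^sup>2"
    by linarith
  then have "(1 / 2) ^ DIM('a) \<le> (1 - (norm (x - c))\<^sup>2 / r\<^sup>2) ^ DIM('a)"
    by (rule power_mono) simp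
  then have "barrier c r x \<le> inverse ((1 / 2) ^ DIM('a))"
    unfolding barrier_def by (intro le_imp_inverse_le) auto
  then show ?thesis
    by (simp add: power_inverse[symmetric])
qed

context supersolution
begin

text \<open>The deficit needs to be small only relative to \<open>\<theta>\<close>, and here
  \<open>\<theta>\<close> may be as large as required. It is chosen to absorb the deficit and the
  tail at level 0, which are finite numbers.\<close>

lemma locally_bounded_below:
  assumes c: "c \<in> \<Omega>"
  shows "\<exists>e>0. \<exists>p. ball c e \<subseteq> \<Omega> \<and> (AE x in lborel. x \<in> ball c e \<longrightarrow> p \<le> u x)"
proof -
  obtain \<nu> where \<nu>: "0 < \<nu>" and LB: "\<forall>c r q \<theta>. 0 < r \<longrightarrow> 0 < \<theta> \<longrightarrow> cball c (4 * r) \<subseteq> \<Omega> \<longrightarrow>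
    (LBINT y. indicator (cball c (3 * r)) y * max 0 (q - u y)) \<le> \<nu> * \<theta> * r ^ DIM('a) \<longrightarrow>
    (LBINT y. indicator (\<Omega> - cball c (3 * r)) y * (max 0 (q - u y) * kfar N r (c - y))) \<le> 1 * \<theta> * r powr (- 2 * s) \<longrightarrow>
    (AE x in lborel. x \<in> ball c r \<longrightarrow> q - \<theta> * barrier c r x \<le> u x)"
    using lower_bound[of 1] by auto
  obtain R where R: "0 < R" "cball c R \<subseteq> \<Omega>"
    using open_\<Omega> c open_contains_cball by blast
  define r where "r = R / 4"
  have r: "0 < r" and G: "cball c (4 * r) \<subseteq> \<Omega>"
    using R by (auto simp: r_def)
  define I where "I = (LBINT y. indicator (cball c (3 * r)) y * max 0 (0 - u y))"
  define T where "T = (LBINT y. indicator (\<Omega> - cball c (3 * r)) y * (max 0 (0 - u y) * kfar N r (c - y)))"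
  have I0: "0 \<le> I" and T0: "0 \<le> T"
    unfolding I_def T_def by (auto intro!: Bochner_Integration.integral_nonneg simp: kfar_nonneg)
  define \<theta> where "\<theta> = I / (\<nu> * r ^ DIM('a)) + T / r powr (- 2 * s) + 1"
  have t: "0 \<le> I / (\<nu> * r ^ DIM('a))" "0 \<le> T / r powr (- 2 * s)"
    using I0 T0 \<nu> r by auto
  then have \<theta>: "0 < \<theta>"
    by (simp add: \<theta>_def)
  have "I / (\<nu> * r ^ DIM('a)) \<le> \<theta>" "T / r powr (- 2 * s) \<le> \<theta>"
    using t by (auto simp: \<theta>_def)
  then have "I \<le> \<nu> * \<theta> * r ^ DIM('a)" "T \<le> 1 * \<theta> * r powr (- 2 * s)"
    using \<nu> r by (simp_all add: pos_divide_le_eq ac_simps)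
  then have A: "AE x in lborel. x \<in> ball c r \<longrightarrow> 0 - \<theta> * barrier c r x \<le> u x"
    using LB[rule_format, OF r \<theta> G, of 0] by (simp only: I_def T_def)
  have "AE x in lborel. x \<in> ball c (r / 2) \<longrightarrow> - (\<theta> * 2 ^ DIM('a)) \<le> u x"
    using A
  proof (rule eventually_mono, intro impI)
    fix x assume 1: "x \<in> ball c r \<longrightarrow> 0 - \<theta> * barrier c r x \<le> u x" and x: "x \<in> ball c (r / 2)"
    have "\<theta> * barrier c r x \<le> \<theta> * 2 ^ DIM('a)"
      using barrier_half[OF x] \<theta> by (intro mult_left_mono) auto
    moreover have "x \<in> ball c r"
      using x r by auto
    ultimately show "- (\<theta> * 2 ^ DIM('a)) \<le> u x"
      using 1 by auto
  qed
  moreover have "ball c (r / 2) \<subseteq> \<Omega>"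
    using G r by (auto simp: subset_eq)
  ultimately show ?thesis
    using r by (intro exI[of _ "r / 2"] conjI exI[of _ "- (\<theta> * 2 ^ DIM('a))"]) auto
qed

text \<open>Requiring the bound on a whole ball makes these sets open, which is the source of lower
  semicontinuity. They grow as \<open>p\<close> decreases and play the part of superlevel sets for
  the limit of essential infima.\<close>

definition level :: "real \<Rightarrow> 'a set" where
  "level p = {x. \<exists>e>0. ball x e \<subseteq> \<Omega> \<and> (AE y in lborel. y \<in> ball x e \<longrightarrow> p \<le> u y)}"

lemma ball_subset_level:
  assumes "ball c r \<subseteq> \<Omega>" "AE y in lborel. y \<in> ball c r \<longrightarrow> p \<le> u y"
  shows "ball c r \<subseteq> level p"
proof
  fix x assume x: "x \<in> ball c r"
  then obtain e where e: "e > 0" "ball x e \<subseteq> ball c r"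
    using open_contains_ball open_ball by metis
  have "AE y in lborel. y \<in> ball x e \<longrightarrow> p \<le> u y"
    using assms(2) by (rule eventually_mono) (use e(2) in blast)
  then show "x \<in> level p"
    unfolding level_def using e assms(1) by blast
qed

lemma open_level: "open (level p)"
  unfolding open_contains_ball
proof
  fix x assume "x \<in> level p"
  then obtain e where "e > 0" "ball x e \<subseteq> \<Omega>" "AE y in lborel. y \<in> ball x e \<longrightarrow> p \<le> u y"
    unfolding level_def by blast
  then show "\<exists>e>0. ball x e \<subseteq> level p"
    using ball_subset_level by blast
qed

lemma level_AE: "AE x in lborel. x \<in> level p \<longrightarrow> p \<le> u x"
  by (rule AE_locally) (auto simp: level_def)

lemma level_antimono: "p \<le> q \<Longrightarrow> level q \<subseteq> level p"
  unfolding level_def by (force elim: eventually_mono)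

text \<open>The factor \<open>A\<close> is uniform in the centre and in the scale, so a single
  \<open>\<nu>\<close> serves while the radius shrinks. Within distance \<open>R\<close> of
  \<open>x1\<close> the bound \<open>- M\<close> and the outer kernel integral give the power of
  \<open>r\<close>; farther out the kernel is comparable to the weight, and that constant is
  absorbed because \<open>r \<le> 1\<close>.\<close>

lemma tail_bound:
  assumes R: "0 < R" "cball x1 R \<subseteq> \<Omega>" and M: "0 \<le> M" "AE x in lborel. x \<in> ball x1 R \<longrightarrow> - M \<le> u x"
  shows "\<exists>A\<ge>0. \<forall>c r. c \<in> ball x1 (R / 2) \<longrightarrow> 0 < r \<longrightarrow> r \<le> 1 \<longrightarrow> r \<le> R / 2 \<longrightarrow>
    (LBINT y. indicator (\<Omega> - cball c (3 * r)) y * (max 0 (q - u y) * kfar N r (c - y))) \<le> A * r powr (- 2 * s)"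
proof -
  obtain C2 where C2: "0 \<le> C2"
    "\<forall>R>0. integrable lborel (\<lambda>z::'a. indicator (- ball 0 R) z * norm z powr (- N)) \<and>
      (LBINT z::'a. indicator (- ball 0 R) z * norm z powr (- N)) \<le> C2 * R powr (- 2 * s)"
    using outer_kernel_integral[OF s(1), where 'a='a, folded N_def] by (elim exE conjE)
  define C3 where "C3 = (R / 2) powr (- N) + (3 + norm x1 / (R / 2)) powr N"
  have C3: "0 \<le> C3"
    by (simp add: C3_def)
  define H where "H = (\<lambda>y. \<bar>q\<bar> * (indicator \<Omega> y * (1 / (1 + norm y powr N))) + \<bar>u y * (1 / (1 + norm y powr N))\<bar>)"
  have HI: "integrable lborel H"
    unfolding H_def
    by (intro Bochner_Integration.integrable_add integrable_mult_right indicator_weight integrable_abs u_weight)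
  have H0: "0 \<le> H y" for y
    by (simp add: H_def)
  define C4 where "C4 = C3 * (LBINT y. H y)"
  have C4: "0 \<le> C4"
    unfolding C4_def using C3 H0 by (intro mult_nonneg_nonneg Bochner_Integration.integral_nonneg) auto
  have "(LBINT y. indicator (\<Omega> - cball c (3 * r)) y * (max 0 (q - u y) * kfar N r (c - y)))
      \<le> ((\<bar>q\<bar> + M) * C2 + C4) * r powr (- 2 * s)"
    if c: "c \<in> ball x1 (R / 2)" and r: "0 < r" "r \<le> 1" "r \<le> R / 2" for c r
  proof -
    let ?o = "\<lambda>y::'a. indicator (- ball 0 r) (c - y) * norm (c - y) powr (- N) :: real"
    note C2r = C2(2)[rule_format, OF r(1)]
    have om: "(\<lambda>z::'a. indicator (- ball 0 r) z * norm z powr (- N) :: real) \<in> borel_measurable borel"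
      using borel_measurable_integrable[OF C2r[THEN conjunct1]] by (simp only: measurable_lborel2)
    have oI: "integrable lborel ?o" "(LBINT y. ?o y) \<le> C2 * r powr (- 2 * s)"
      using lborel_reflect[OF om, of c] C2r by (simp_all only:)
    have "(LBINT y. indicator (\<Omega> - cball c (3 * r)) y * (max 0 (q - u y) * kfar N r (c - y)))
       \<le> (LBINT y. (\<bar>q\<bar> + M) * ?o y + C3 * H y)"
    proof (rule integral_mono_AE')
      show "integrable lborel (\<lambda>y. (\<bar>q\<bar> + M) * ?o y + C3 * H y)"
        by (intro Bochner_Integration.integrable_add integrable_mult_right oI HI)
      show "AE y in lborel. indicator (\<Omega> - cball c (3 * r)) y * (max 0 (q - u y) * kfar N r (c - y))
          \<le> (\<bar>q\<bar> + M) * ?o y + C3 * H y"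
        using M(2)
      proof (rule eventually_mono)
        fix y assume y: "y \<in> ball x1 R \<longrightarrow> - M \<le> u y"
        have o0: "0 \<le> ?o y" by simp
        show "indicator (\<Omega> - cball c (3 * r)) y * (max 0 (q - u y) * kfar N r (c - y)) \<le> (\<bar>q\<bar> + M) * ?o y + C3 * H y"
        proof (cases "y \<in> \<Omega> - cball c (3 * r)")
          case True
          then have cy: "r < norm (c - y)"
            using r by (auto simp: dist_norm)
          then have k: "kfar N r (c - y) = norm (c - y) powr (- N)" and o: "?o y = norm (c - y) powr (- N)"
            by (auto simp: kfar_def)
          show ?thesis
          proof (cases "y \<in> ball x1 R")
            case b: True
            then have "max 0 (q - u y) \<le> \<bar>q\<bar> + M"
              using y M(1) by auto
            then have "max 0 (q - u y) * kfar N r (c - y) \<le> (\<bar>q\<bar> + M) * ?o y"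
              unfolding k o by (intro mult_right_mono) auto
            moreover have "0 \<le> C3 * H y"
              using C3 H0 by simp
            ultimately show ?thesis
              using True by simp
          next
            case b: False
            have "R / 2 \<le> norm (c - y)"
              using b c dist_triangle[of x1 y c] by (auto simp: dist_norm)
            then have k': "kfar N r (c - y) = kfar N (R / 2) (c - y)"
              unfolding k by (simp only: kfar_def max_absorb1)
            have "kfar N (R / 2) (c - y) \<le> C3 * (1 / (1 + norm y powr N))"
              unfolding C3_def using c R by (intro kfar_weight N_pos) auto
            moreover have "max 0 (q - u y) \<le> \<bar>q\<bar> + \<bar>u y\<bar>"
              by auto
            ultimately have "max 0 (q - u y) * kfar N r (c - y) \<le> (\<bar>q\<bar> + \<bar>u y\<bar>) * (C3 * (1 / (1 + norm y powr N)))"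
              unfolding k' by (intro mult_mono) (auto simp: kfar_nonneg)
            also have "\<dots> = C3 * H y"
              using True by (simp add: H_def abs_mult algebra_simps add_divide_distrib)
            finally show ?thesis
              using True o0 M(1) by (simp add: add_increasing)
          qed
        next
          case False
          have "0 \<le> (\<bar>q\<bar> + M) * ?o y + C3 * H y"
            using o0 M(1) C3 H0 by (intro add_nonneg_nonneg mult_nonneg_nonneg) auto
          then show ?thesis
            using False by simp
        qed
      qed
      show "AE y in lborel. 0 \<le> (\<bar>q\<bar> + M) * ?o y + C3 * H y"
        using M(1) C3 H0 by (intro AE_I2 add_nonneg_nonneg mult_nonneg_nonneg) auto
    qed
    also have "\<dots> = (\<bar>q\<bar> + M) * (LBINT y. ?o y) + C4"
      using oI(1) HI by (simp add: C4_def)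
    also have "\<dots> \<le> (\<bar>q\<bar> + M) * (C2 * r powr (- 2 * s)) + C4 * r powr (- 2 * s)"
    proof (intro add_mono mult_left_mono oI(2))
      have "1 powr (- 2 * s) \<le> r powr (- 2 * s)"
        using r s by (intro powr_mono2') auto
      then show "C4 \<le> C4 * r powr (- 2 * s)"
        using mult_left_mono[OF _ C4, of 1 "r powr (- 2 * s)"] by simp
    qed (use M(1) in simp)
    finally show ?thesis
      by (simp add: algebra_simps)
  qed
  moreover have "0 \<le> (\<bar>q\<bar> + M) * C2 + C4"
    using M(1) C2(1) C4 by simp
  ultimately show ?thesis
    by blast
qed

end

lemma integral_indicator_cube:
  fixes x :: "'a::euclidean_space"
  assumes "0 \<le> h"
  shows "integrable lborel (indicator (cbox x (x + h *\<^sub>R One)) :: 'a \<Rightarrow> real)"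
    "(LBINT y. indicator (cbox x (x + h *\<^sub>R One)) y) = h ^ DIM('a)"
proof -
  show "integrable lborel (indicator (cbox x (x + h *\<^sub>R One)) :: 'a \<Rightarrow> real)"
    using emeasure_bounded_finite[OF bounded_cbox[of x "x + h *\<^sub>R One"]] by (intro integrable_real_indicator) auto
  have "measure lborel (cbox x (x + h *\<^sub>R One)) = (\<Prod>b\<in>Basis. (x + h *\<^sub>R One - x) \<bullet> b)"
    by (rule measure_lborel_cbox) (use assms in \<open>auto simp: inner_simps\<close>)
  also have "\<dots> = h ^ DIM('a)"
    by (simp add: inner_simps)
  finally show "(LBINT y. indicator (cbox x (x + h *\<^sub>R One)) y) = h ^ DIM('a)"
    by simp
qed

lemma cball_subset_cube:
  fixes x :: "'a::euclidean_space"
  assumes "0 \<le> h"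
  shows "cball (x + (h / 2) *\<^sub>R One) (h / 2) \<subseteq> cbox x (x + h *\<^sub>R One)"
proof
  fix y assume y: "y \<in> cball (x + (h / 2) *\<^sub>R One) (h / 2)"
  show "y \<in> cbox x (x + h *\<^sub>R One)"
    unfolding mem_box
  proof
    fix b :: 'a assume b: "b \<in> Basis"
    have "\<bar>(y - (x + (h / 2) *\<^sub>R One)) \<bullet> b\<bar> \<le> norm (y - (x + (h / 2) *\<^sub>R One))"
      using b by (rule Basis_le_norm)
    also have "\<dots> \<le> h / 2"
      using y by (simp add: dist_norm norm_minus_commute)
    finally have "\<bar>y \<bullet> b - x \<bullet> b - h / 2\<bar> \<le> h / 2"
      using b by (simp add: inner_simps algebra_simps)
    then have "x \<bullet> b \<le> y \<bullet> b" "y \<bullet> b \<le> x \<bullet> b + h"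
      unfolding abs_le_iff by linarith+
    then show "x \<bullet> b \<le> y \<bullet> b \<and> y \<bullet> b \<le> (x + h *\<^sub>R One) \<bullet> b"
      using b by (simp add: inner_simps)
  qed
qed

context supersolution
begin

text \<open>
  The differentiation theorem of the library uses cubes with corner \<open>x\<close>. The lower bound therefore
  holds in a small ball next to \<open>x\<close>, of a fixed proportion of the cube, and the conclusion follows
  because the exceptional set has density one at almost all of its points.
\<close>

lemma level_lower_local:
  assumes pq: "p < q" and R: "0 < R" "cball x1 R \<subseteq> \<Omega>" and M: "0 \<le> M" "AE x in lborel. x \<in> ball x1 R \<longrightarrow> - M \<le> u x"
  shows "AE x in lborel. x \<in> ball x1 (R / 2) \<longrightarrow> q \<le> u x \<longrightarrow> x \<in> level p"
proof -
  let ?n = "DIM('a)"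
  \<comment> \<open>On the ball of half the radius the barrier is at most \<open>2 ^ ?n\<close>, so
    this choice keeps \<open>q - \<theta> * barrier c r y\<close> at or above \<open>p\<close>
    there.\<close>
  define \<theta> where "\<theta> = (q - p) / 2 ^ ?n"
  have \<theta>: "0 < \<theta>" and \<theta>2: "\<theta> * 2 ^ ?n = q - p"
    using pq by (auto simp: \<theta>_def)
  obtain A0 where A0: "0 \<le> A0" "\<And>c r. c \<in> ball x1 (R / 2) \<Longrightarrow> 0 < r \<Longrightarrow> r \<le> 1 \<Longrightarrow> r \<le> R / 2 \<Longrightarrow>
    (LBINT y. indicator (\<Omega> - cball c (3 * r)) y * (max 0 (q - u y) * kfar N r (c - y))) \<le> A0 * r powr (- 2 * s)"
    using tail_bound[OF R M, of q] by blast
  define A where "A = A0 / \<theta>"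
  have A: "0 \<le> A" "A * \<theta> = A0"
    using A0(1) \<theta> by (auto simp: A_def)
  obtain \<nu> where \<nu>: "0 < \<nu>" and LB: "\<forall>c r q \<theta>. 0 < r \<longrightarrow> 0 < \<theta> \<longrightarrow> cball c (4 * r) \<subseteq> \<Omega> \<longrightarrow>
    (LBINT y. indicator (cball c (3 * r)) y * max 0 (q - u y)) \<le> \<nu> * \<theta> * r ^ DIM('a) \<longrightarrow>
    (LBINT y. indicator (\<Omega> - cball c (3 * r)) y * (max 0 (q - u y) * kfar N r (c - y))) \<le> A * \<theta> * r powr (- 2 * s) \<longrightarrow>
    (AE x in lborel. x \<in> ball c r \<longrightarrow> q - \<theta> * barrier c r x \<le> u x)"
    using lower_bound[OF A(1)] by (elim exE conjE)
  define E where "E = {x \<in> ball x1 (R / 2). q \<le> u x} - level p"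
  have Em: "E \<in> sets borel"
  proof -
    have "{x \<in> space borel. q \<le> u x} \<in> sets borel"
      by measurable
    then have "ball x1 (R / 2) \<inter> {x. q \<le> u x} - level p \<in> sets borel"
      using open_level by (intro sets.Diff sets.Int) auto
    then show ?thesis
      unfolding E_def by (rule back_subst[of "\<lambda>S. S \<in> sets borel"]) auto
  qed
  have EI: "integrable lborel (indicator E :: 'a \<Rightarrow> real)"
  proof (rule integrable_real_indicator)
    have "E \<subseteq> ball x1 (R / 2)"
      by (auto simp: E_def)
    then show "emeasure lborel E < \<infinity>"
      by (intro emeasure_bounded_finite bounded_subset[OF bounded_ball])
  qed (use Em in simp)
  let ?G = "\<lambda>y. indicator (cball x1 R) y * max 0 (q - u y)"
  have GI: "integrable lborel ?G"
  proof (rule Bochner_Integration.integrable_bound[OF Bochner_Integration.integrable_add[OF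
          integrable_mult_right[OF integrable_indicator_cball[of x1 R], of "\<bar>q\<bar>"] integrable_abs[OF trunc_integrable(1)[OF R(2)]]]])
    show "AE y in lborel. norm (?G y) \<le> norm (\<bar>q\<bar> * indicator (cball x1 R) y + \<bar>trunc x1 R y\<bar>)"
      by (auto simp: trunc_def indicator_def)
  qed measurable
  let ?\<omega> = "measure lborel (ball (0::'a) 1)"
  have \<omega>: "0 < ?\<omega>"
    using content_ball_gt_0_iff[of "0::'a" 1] by (simp add: measure_completion)
  \<comment> \<open>With \<open>r = h / 6\<close>, \<open>e1 * h ^ ?n\<close> is exactly the deficit
    that the lower bound tolerates, and \<open>e2\<close> is the share of the cube of side
    \<open>h\<close> taken by the ball of radius \<open>r / 2 = h / 12\<close>.\<close>
  define e1 where "e1 = \<nu> * \<theta> / 6 ^ ?n"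
  define e2 where "e2 = ?\<omega> / 12 ^ ?n"
  have e12: "0 < e1" "0 < e2"
    using \<nu> \<theta> \<omega> by (auto simp: e1_def e2_def)
  have "AE x in lborel. x \<notin> E"
    using lebesgue_differentiation[OF GI] lebesgue_differentiation[OF EI]
  proof eventually_elim
    case (elim x)
    show "x \<notin> E"
    proof
      assume xE: "x \<in> E"
      then have x: "x \<in> ball x1 (R / 2)" "q \<le> u x"
        by (auto simp: E_def)
      obtain d1 where d1: "d1 > 0" "\<And>h. 0 < h \<Longrightarrow> h < d1 \<Longrightarrow>
          \<bar>(LBINT y. indicator (cbox x (x + h *\<^sub>R One)) y * ?G y) / h ^ ?n - ?G x\<bar> < e1"
        using elim(1) e12(1) by blast
      obtain d2 where d2: "d2 > 0" "\<And>h. 0 < h \<Longrightarrow> h < d2 \<Longrightarrow>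
          \<bar>(LBINT y. indicator (cbox x (x + h *\<^sub>R One)) y * indicator E y) / h ^ ?n - indicator E x\<bar> < e2"
        using elim(2) e12(2) by blast
      have Gx: "?G x = 0"
        using x by simp
      define h0 where "h0 = (R / 2 - dist x1 x) / (2 * real ?n)"
      have h0: "0 < h0"
        using x by (simp add: h0_def)
      define h where "h = min (min (d1 / 2) (d2 / 2)) (min h0 (min 1 (R / 2)))"
      have h: "0 < h" "h \<le> d1 / 2" "h \<le> d2 / 2" "h \<le> h0" "h \<le> 1" "h \<le> R / 2"
        using d1(1) d2(1) h0 R unfolding h_def by (auto simp: min_le_iff_disj)
      then have hd: "h < d1" "h < d2"
        using d1(1) d2(1) by linarith+
      let ?Q = "cbox x (x + h *\<^sub>R One)"
      let ?iQ = "indicator (cbox x (x + h *\<^sub>R One)) :: 'a \<Rightarrow> real"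
      define c where "c = x + (h / 2) *\<^sub>R (One :: 'a)"
      define r where "r = h / 6"
      have r: "0 < r" "r \<le> 1" "r \<le> R / 2" "3 * r = h / 2"
        using h by (auto simp: r_def)
      have hn: "h * real ?n \<le> (R / 2 - dist x1 x) / 2"
        using h(4) by (simp add: h0_def field_simps)
      have hn': "h \<le> h * real ?n"
        using h(1) by (simp add: Suc_leI)
      have cQ: "cball c (3 * r) \<subseteq> ?Q"
        unfolding r(4) c_def using h(1) by (intro cball_subset_cube) simp
      have QB: "?Q \<subseteq> ball x1 (R / 2)"
      proof
        fix y assume "y \<in> ?Q"
        then have "dist x y \<le> h * real ?n"
          using h(1) by (intro cbox_cube_subset) auto
        then show "y \<in> ball x1 (R / 2)"
          using hn x(1) dist_triangle[of x1 y x] by auto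
      qed
      have "c \<in> cball c (3 * r)"
        using r by simp
      then have cB: "c \<in> ball x1 (R / 2)"
        using cQ QB by blast
      have c4: "cball c (4 * r) \<subseteq> \<Omega>"
      proof
        fix y assume "y \<in> cball c (4 * r)"
        then have "dist x1 y \<le> dist x1 c + h"
          using dist_triangle[of x1 y c] h(1) by (simp add: r_def)
        then have "y \<in> cball x1 R"
          using cB h(6) by simp
        then show "y \<in> \<Omega>"
          using R(2) by blast
      qed
      have I: "(LBINT y. indicator (cball c (3 * r)) y * max 0 (q - u y)) \<le> \<nu> * \<theta> * r ^ ?n"
      proof -
        have "(LBINT y. indicator (cball c (3 * r)) y * max 0 (q - u y)) \<le> (LBINT y. ?iQ y * ?G y)"
        proof (rule integral_mono[OF far_integral_bound(2)[OF r(1) _ _ c4]])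
          show "c \<in> ball c r" "q \<le> q"
            using r by auto
          show "integrable lborel (\<lambda>y. ?iQ y * ?G y)"
            by (rule integrable_bounded_mult(1)[OF GI, of _ 1]) (auto simp: indicator_def)
          show "indicator (cball c (3 * r)) y * max 0 (q - u y) \<le> ?iQ y * ?G y" for y
          proof (cases "y \<in> cball c (3 * r)")
            case True
            then have yQ: "y \<in> ?Q"
              using cQ by blast
            then have "y \<in> ball x1 (R / 2)"
              using QB by blast
            then have "y \<in> cball x1 R"
              using R(1) by simp
            with yQ show ?thesis
              using True by simp
          qed simp
        qed
        also have "\<dots> \<le> e1 * h ^ ?n"
        proof -
          have "(LBINT y. ?iQ y * ?G y) / h ^ ?n < e1"
            using d1(2)[OF h(1) hd(1)] unfolding Gx diff_zero by linarith
          then show ?thesis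
            using h(1) by (simp add: pos_divide_less_eq)
        qed
        also have "\<dots> = \<nu> * \<theta> * r ^ ?n"
          by (simp add: e1_def r_def power_divide)
        finally show ?thesis .
      qed
      have T: "(LBINT y. indicator (\<Omega> - cball c (3 * r)) y * (max 0 (q - u y) * kfar N r (c - y))) \<le> A * \<theta> * r powr (- 2 * s)"
        using A0(2)[OF cB r(1-3)] by (simp only: A(2))
      have "AE x in lborel. x \<in> ball c r \<longrightarrow> q - \<theta> * barrier c r x \<le> u x"
        using LB[rule_format, OF r(1) \<theta> c4 I T] .
      then have "AE x in lborel. x \<in> ball c (r / 2) \<longrightarrow> p \<le> u x"
      proof (rule eventually_mono, intro impI)
        fix y assume 1: "y \<in> ball c r \<longrightarrow> q - \<theta> * barrier c r y \<le> u y" and y: "y \<in> ball c (r / 2)"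
        have "\<theta> * barrier c r y \<le> \<theta> * 2 ^ ?n"
          using barrier_half[OF y] \<theta> by (intro mult_left_mono) auto
        moreover have "y \<in> ball c r"
          using y r by auto
        ultimately show "p \<le> u y"
          using 1 \<theta>2 by auto
      qed
      moreover have sub: "ball c (r / 2) \<subseteq> cball c (3 * r)" "ball c (r / 2) \<subseteq> \<Omega>"
        using r(1) c4 by (auto simp: subset_eq)
      ultimately have lev: "ball c (r / 2) \<subseteq> level p"
        by (intro ball_subset_level)
      \<comment> \<open>The small ball lies in the cube and in \<open>level p\<close>, hence misses
        \<open>E\<close>. So \<open>E\<close> fills at most the share \<open>1 - e2\<close> of the
        cube, against density one at \<open>x\<close>.\<close>
      have "(LBINT y. ?iQ y * indicator E y) \<le> (LBINT y. ?iQ y - indicator (ball c (r / 2)) y)"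
      proof (rule integral_mono)
        show "integrable lborel (\<lambda>y. ?iQ y * indicator E y)"
          by (rule integrable_bounded_mult(1)[OF EI, of _ 1]) (auto simp: indicator_def)
        show "integrable lborel (\<lambda>y. ?iQ y - indicator (ball c (r / 2)) y)"
          using h(1) by (intro Bochner_Integration.integrable_diff integral_indicator_cube integrable_indicator_ball) simp
        show "?iQ y * indicator E y \<le> ?iQ y - indicator (ball c (r / 2)) y" for y
          using lev sub cQ by (cases "y \<in> ball c (r / 2)") (auto simp: E_def indicator_def)
      qed
      also have "\<dots> = h ^ ?n - measure lborel (ball c (r / 2))"
        using integral_indicator_cube[of h x] h(1) integrable_indicator_ball[of c "r / 2"] by simp
      also have "measure lborel (ball c (r / 2)) = e2 * h ^ ?n"
        using measure_ball_scale[of "r / 2" c] r(1) by (simp add: e2_def r_def power_divide)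
      finally have "(LBINT y. ?iQ y * indicator E y) \<le> (1 - e2) * h ^ ?n"
        by (simp only: left_diff_distrib mult_1)
      then have "(LBINT y. ?iQ y * indicator E y) / h ^ ?n \<le> 1 - e2"
        by (subst pos_divide_le_eq[OF zero_less_power[OF h(1)]])
      moreover have "indicator E x = (1::real)"
        using xE by simp
      ultimately show False
        using d2(2)[OF h(1) hd(2)] by linarith
    qed
  qed
  then show ?thesis
    by (rule eventually_mono) (auto simp: E_def)
qed

lemma level_lower:
  assumes pq: "p < q"
  shows "AE x in lborel. x \<in> \<Omega> \<longrightarrow> q \<le> u x \<longrightarrow> x \<in> level p"
proof (rule AE_locally)
  fix x1 assume "x1 \<in> \<Omega>"
  then obtain e M where e: "e > 0" "ball x1 e \<subseteq> \<Omega>" "AE x in lborel. x \<in> ball x1 e \<longrightarrow> M \<le> u x"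
    using locally_bounded_below by blast
  define R where "R = e / 2"
  have R: "0 < R" "cball x1 R \<subseteq> \<Omega>"
    using e by (auto simp: R_def subset_eq)
  have "AE x in lborel. x \<in> ball x1 R \<longrightarrow> - \<bar>M\<bar> \<le> u x"
    using e(3) by (rule eventually_mono) (use e(1) in \<open>auto simp: R_def\<close>)
  then have "AE x in lborel. x \<in> ball x1 (R / 2) \<longrightarrow> q \<le> u x \<longrightarrow> x \<in> level p"
    by (intro level_lower_local[OF pq R, of "\<bar>M\<bar>"]) auto
  then show "\<exists>e>0. AE y in lborel. y \<in> ball x1 e \<longrightarrow> q \<le> u y \<longrightarrow> y \<in> level p"
    using R(1) by (intro exI[of _ "R / 2"]) auto
qed

text \<open>The supremum is taken in \<open>ereal\<close>, so the value \<open>\<infinity>\<close>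
  is allowed. A point outside \<open>\<Omega>\<close> lies in no level set and receives the supremum
  of the empty set, \<open>-\<infinity>\<close>.\<close>

definition repr :: "'a \<Rightarrow> ereal" where
  "repr x = Sup (ereal ` {p. x \<in> level p})"

lemma repr_ge: "x \<in> level p \<Longrightarrow> ereal p \<le> repr x"
  unfolding repr_def by (intro Sup_upper) auto

text \<open>Rational levels leave countably many null sets. Two rationals are inserted between
  \<open>repr x\<close> and \<open>u x\<close>, because passing from \<open>q \<le> u x\<close> to
  membership in \<open>level p\<close> loses a gap \<open>p < q\<close>.\<close>

lemma repr_AE: "AE x in lborel. x \<in> \<Omega> \<longrightarrow> repr x = ereal (u x)"
proof -
  have 1: "AE x in lborel. \<forall>p\<in>\<rat>. x \<in> level p \<longrightarrow> p \<le> u x"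
    by (subst AE_ball_countable[OF countable_rat]) (use level_AE in blast)
  have "AE x in lborel. \<forall>p\<in>\<rat>. \<forall>q\<in>\<rat>. p < q \<longrightarrow> x \<in> \<Omega> \<longrightarrow> q \<le> u x \<longrightarrow> x \<in> level p"
  proof (subst AE_ball_countable[OF countable_rat], intro ballI, subst AE_ball_countable[OF countable_rat], intro ballI)
    fix p q :: real
    show "AE x in lborel. p < q \<longrightarrow> x \<in> \<Omega> \<longrightarrow> q \<le> u x \<longrightarrow> x \<in> level p"
      using level_lower[of p q] by (cases "p < q") auto
  qed
  with 1 show ?thesis
  proof eventually_elim
    case (elim x)
    show ?case
    proof (intro impI antisym)
      assume x: "x \<in> \<Omega>"
      show "repr x \<le> ereal (u x)"
        unfolding repr_def
      proof (rule Sup_least)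
        fix t assume "t \<in> ereal ` {p. x \<in> level p}"
        then obtain p where p: "t = ereal p" "x \<in> level p" by auto
        have "p \<le> u x"
        proof (rule ccontr)
          assume "\<not> p \<le> u x"
          then obtain p' where p': "p' \<in> \<rat>" "u x < p'" "p' < p"
            using Rats_dense_in_real[of "u x" p] by auto
          then have "x \<in> level p'"
            using p(2) level_antimono[of p' p] by auto
          then show False
            using elim(1) p' by force
        qed
        then show "t \<le> ereal (u x)"
          by (simp add: p)
      qed
      show "ereal (u x) \<le> repr x"
      proof (rule ccontr)
        assume "\<not> ereal (u x) \<le> repr x"
        then have l: "repr x < ereal (u x)" by simp
        obtain t where t: "repr x < ereal t" "ereal t < ereal (u x)"
          using ereal_dense2[OF l] by auto
        then obtain q where q: "q \<in> \<rat>" "t < q" "q < u x"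
          using Rats_dense_in_real[of t "u x"] by auto
        obtain p where p: "p \<in> \<rat>" "t < p" "p < q"
          using Rats_dense_in_real[of t q] q by auto
        have "x \<in> level p"
          using elim(2) p q x by force
        then have "ereal p \<le> repr x"
          by (rule repr_ge)
        then show False
          using t(1) p(2) by (metis ereal_less_eq(3) less_imp_le not_less order_trans)
      qed
    qed
  qed
qed

lemma repr_lsc: "lsc_on \<Omega> repr"
  unfolding lsc_on_def
proof
  fix x
  show "repr x \<le> Liminf (at x within \<Omega>) repr"
    unfolding repr_def[of x]
  proof (rule Sup_least)
    fix t assume "t \<in> ereal ` {p. x \<in> level p}"
    then obtain p where p: "t = ereal p" "x \<in> level p" by auto
    have "eventually (\<lambda>y. y \<in> level p) (at x within \<Omega>)"
      using open_level p(2) by (auto simp: eventually_at_topological)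
    then have "eventually (\<lambda>y. t \<le> repr y) (at x within \<Omega>)"
      by (rule eventually_mono) (simp add: p repr_ge)
    then show "t \<le> Liminf (at x within \<Omega>) repr"
      by (rule Liminf_bounded)
  qed
qed

lemma level_exists: "x \<in> \<Omega> \<Longrightarrow> \<exists>p. x \<in> level p"
  using locally_bounded_below[of x] unfolding level_def by blast

lemma repr_locally_bounded: "locally_bdd_below_on \<Omega> repr"
  unfolding locally_bdd_below_on_def
proof
  fix x assume "x \<in> \<Omega>"
  then obtain p where "x \<in> level p"
    using level_exists by blast
  then show "\<exists>U c. open U \<and> x \<in> U \<and> (\<forall>y\<in>U \<inter> \<Omega>. ereal c \<le> repr y)"
    using open_level repr_ge by blast
qed

lemma repr_gt_minus_infinity: "x \<in> \<Omega> \<Longrightarrow> - \<infinity> < repr x"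
  using level_exists repr_ge by (metis ereal_infty_less(2) ereal_infty_less_eq(2) MInfty_neq_ereal(1) less_le)

lemma repr_gt_minimum:
  assumes "AE x in lborel. x \<in> \<Omega> \<longrightarrow> m \<le> u x" "\<not> (AE x in lborel. x \<in> \<Omega> \<longrightarrow> u x = m)" "x \<in> \<Omega>"
  shows "ereal m < repr x"
proof -
  obtain e p where e: "e > 0" "m < p" "ball x e \<subseteq> \<Omega>" "AE y in lborel. y \<in> ball x e \<longrightarrow> p \<le> u y"
    using strong_minimum[OF assms] by blast
  then have "x \<in> level p"
    unfolding level_def by blast
  then have "ereal p \<le> repr x"
    by (rule repr_ge)
  then show ?thesis
    using e(2) by (metis ereal_less(2) less_ereal.simps(1) order_less_le_trans)
qed

end

section \<open>Passage from Lebesgue to Borel measurable data\<close>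

lemma AE_pair_lborel:
  fixes P :: "'a::euclidean_space \<Rightarrow> bool"
  assumes "AE x in lborel. P x"
  shows "AE p in (lborel :: ('a \<times> 'a) measure). P (fst p) \<and> P (snd p)"
proof -
  obtain N where N: "N \<in> null_sets lborel" "\<And>x. x \<notin> N \<Longrightarrow> P x"
    using assms unfolding eventually_ae_filter by auto
  have "N \<times> UNIV \<in> null_sets (lborel \<Otimes>\<^sub>M lborel :: ('a \<times> 'a) measure)"
    "UNIV \<times> N \<in> null_sets (lborel \<Otimes>\<^sub>M lborel :: ('a \<times> 'a) measure)"
    using N(1) by (auto simp: null_sets_def lborel.emeasure_pair_measure_Times)
  then have "N \<times> UNIV \<union> UNIV \<times> N \<in> null_sets (lborel :: ('a \<times> 'a) measure)"
    unfolding lborel_prod by (rule null_sets.Un)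
  then show ?thesis
    by (rule AE_I') (use N(2) in force)
qed

theorem corollary4p3:
  fixes s :: real and \<Omega> :: "(real^'n) set" and u :: "real^'n \<Rightarrow> real"
  assumes "0 < s" and "s < 1"
    and "open \<Omega>" and "connected \<Omega>" and "\<Omega> \<noteq> {}"
    and "u \<in> borel_measurable (lebesgue_on \<Omega>)"
    and "\<not> (\<exists>c. AE x in lebesgue_on \<Omega>. u x = c)"
    and "u \<in> Hs_loc s \<Omega>"
    and "set_integrable lebesgue \<Omega> (\<lambda>x. \<bar>u x\<bar> / (1 + norm x powr (real CARD('n) + 2 * s)))"
    and "regional_superharmonic s \<Omega> u"
  shows "\<exists>w :: real^'n \<Rightarrow> ereal.
           (AE x in lebesgue_on \<Omega>. w x = ereal (u x)) \<and>
           (\<forall>x\<in>\<Omega>. w x > -\<infinity>) \<and>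
           lsc_on \<Omega> w \<and>
           locally_bdd_below_on \<Omega> w \<and>
           (\<forall>x\<in>\<Omega>. w x > essinf_on \<Omega> (\<lambda>y. ereal (u y)))"
proof -
  define N where "N = real DIM(real^'n) + 2 * s"
  have N': "real CARD('n) + 2 * s = N"
    by (simp add: N_def)
  have \<Omega>m[measurable]: "\<Omega> \<in> sets borel"
    using assms(3) by simp
  then have \<Omega>l: "\<Omega> \<inter> space lebesgue \<in> sets lebesgue"
    by simp
  have fm: "(\<lambda>x. indicator \<Omega> x * u x) \<in> borel_measurable lebesgue"
    using assms(6) borel_measurable_restrict_space_iff[OF \<Omega>l, of u] by simp
  then obtain u1 where u1[measurable]: "u1 \<in> borel_measurable lborel" and ae1: "AE x in lborel. indicator \<Omega> x * u x = u1 x"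
    using completion_ex_borel_measurable_real by blast
  \<comment> \<open>The second factor \<open>indicator \<Omega>\<close> restores vanishing at every
    point off \<open>\<Omega>\<close>; the Borel representative \<open>u1\<close> has it only almost
    everywhere.\<close>
  define u' where "u' x = indicator \<Omega> x * u1 x" for x
  have u'm[measurable]: "u' \<in> borel_measurable borel"
    using u1 unfolding u'_def by measurable
  have ae: "AE x in lborel. x \<in> \<Omega> \<longrightarrow> u x = u' x"
    using ae1 by (rule eventually_mono) (auto simp: u'_def)
  then have aeL: "AE x in lebesgue. x \<in> \<Omega> \<longrightarrow> u x = u' x"
    by (rule AE_completion)
  have on_iff: "(AE x in lebesgue_on \<Omega>. P x) \<longleftrightarrow> (AE x in lborel. x \<in> \<Omega> \<longrightarrow> P x)" for P
    unfolding AE_restrict_space_iff[OF \<Omega>l] AE_completion_iff ..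
  have loc: "\<exists>v\<in>Hs s. AE x in lborel. x \<in> cball c R \<longrightarrow> u' x = v x" if "cball c R \<subseteq> \<Omega>" for c R
  proof -
    have "compactly_inside (cball c R) \<Omega>"
      using that by (simp add: compactly_inside_def)
    then obtain v where v: "v \<in> Hs s" "AE x in lebesgue. x \<in> cball c R \<longrightarrow> u x = v x"
      using assms(8) unfolding Hs_loc_def by blast
    have "AE x in lborel. x \<in> cball c R \<longrightarrow> u x = v x"
      using v(2) unfolding AE_completion_iff .
    then have "AE x in lborel. x \<in> cball c R \<longrightarrow> u' x = v x"
      using ae by eventually_elim (use that in auto)
    then show ?thesis
      using v(1) by blast
  qed
  \<comment> \<open>The dominating function is only Lebesgue integrable, the dominated one is Borel;
    for the latter integrability over the completion and over \<open>lborel\<close>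
    coincide.\<close>
  have int_le: "integrable lborel f" if "f \<in> borel_measurable lborel" "integrable lebesgue g" "AE x in lborel. norm (f x) \<le> norm (g x)"
    for f g :: "'b::euclidean_space \<Rightarrow> real"
  proof -
    have "integrable lebesgue f"
      using that by (intro Bochner_Integration.integrable_bound[OF that(2)] AE_completion) (auto intro: measurable_completion)
    then show ?thesis
      using integrable_completion[OF that(1)] by simp
  qed
  interpret S: supersolution s N \<Omega> u'
  proof
    show "0 < s" "s < 1" "N = real DIM(real^'n) + 2 * s" "open \<Omega>" "u' \<in> borel_measurable borel"
      by (fact assms(1) assms(2) N_def assms(3) u'm)+
    show "u' x = 0" if "x \<notin> \<Omega>" for x
      using that by (simp add: u'_def)
    have "integrable lebesgue (\<lambda>x. indicator \<Omega> x * (\<bar>u x\<bar> / (1 + norm x powr N)))"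
      using assms(9) unfolding set_integrable_def N' by simp
    then show "integrable lborel (\<lambda>x. u' x * (1 / (1 + norm x powr N)))"
    proof (rule int_le[rotated])
      show "AE x in lborel. norm (u' x * (1 / (1 + norm x powr N))) \<le> norm (indicator \<Omega> x * (\<bar>u x\<bar> / (1 + norm x powr N)))"
        using ae by (rule eventually_mono) (auto simp: u'_def abs_mult indicator_def)
    qed measurable
    fix c :: "real^'n" and R :: real
    assume G: "cball c R \<subseteq> \<Omega>"
    obtain v where v: "v \<in> Hs s" and vae: "AE x in lborel. x \<in> cball c R \<longrightarrow> u' x = v x"
      using loc[OF G] by blast
    have cm[measurable]: "cball c R \<in> sets borel"
      by auto
    have "integrable lebesgue (\<lambda>x. (v x)\<^sup>2)"
      using v by (simp add: Hs_def)
    then show "integrable lborel (\<lambda>x. indicator (cball c R) x * (u' x)\<^sup>2)"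
    proof (rule int_le[rotated])
      show "AE x in lborel. norm (indicator (cball c R) x * (u' x)\<^sup>2) \<le> norm ((v x)\<^sup>2)"
        using vae by (rule eventually_mono) (auto simp: indicator_def)
    qed measurable
    let ?F = "\<lambda>(x, y). indicator (cball c R) x * indicator (cball c R) y * ((u' x - u' y)\<^sup>2 * norm (x - y) powr (- N))"
    have "integrable lebesgue (\<lambda>(x, y). (v x - v y)\<^sup>2 / norm (x - y) powr N)"
      using v N' by (simp add: Hs_def)
    then have "integrable lborel ?F"
    proof (rule int_le[rotated])
      have "?F \<in> borel_measurable (lborel \<Otimes>\<^sub>M lborel)"
        by measurable
      then show "?F \<in> borel_measurable lborel"
        by (simp only: lborel_prod)
      show "AE p in lborel. norm (?F p) \<le> norm (case p of (x, y) \<Rightarrow> (v x - v y)\<^sup>2 / norm (x - y) powr N)"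
        using AE_pair_lborel[OF vae]
      proof (rule eventually_mono)
        fix p assume p: "(fst p \<in> cball c R \<longrightarrow> u' (fst p) = v (fst p)) \<and> (snd p \<in> cball c R \<longrightarrow> u' (snd p) = v (snd p))"
        show "norm (?F p) \<le> norm (case p of (x, y) \<Rightarrow> (v x - v y)\<^sup>2 / norm (x - y) powr N)"
          using p by (cases p) (auto simp: indicator_def powr_minus divide_inverse)
      qed
    qed
    then show "integrable (lborel \<Otimes>\<^sub>M lborel) ?F"
      by (simp only: lborel_prod)
  next
    fix \<psi> :: "real^'n \<Rightarrow> real"
    assume \<psi>: "\<psi> \<in> test_functions \<Omega>" "\<And>x. 0 \<le> \<psi> x"
    have "continuous_on UNIV \<psi>"
      using \<psi>(1) unfolding test_functions_def by (metis (mono_tags, lifting) Ck.simps(1) mem_Collect_eq)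
    then have [measurable]: "\<psi> \<in> borel_measurable borel"
      by (rule borel_measurable_continuous_onI)
    let ?F = "\<lambda>(x, y). indicator \<Omega> x * indicator \<Omega> y * ((u' x - u' y) * (\<psi> x - \<psi> y) * norm (x - y) powr (- N))"
    let ?H = "\<lambda>p. indicator (\<Omega> \<times> \<Omega>) p *\<^sub>R (case p of (x, y) \<Rightarrow> (u x - u y) * (\<psi> x - \<psi> y) / norm (x - y) powr N)"
    have Fm: "?F \<in> borel_measurable lborel"
    proof -
      have "?F \<in> borel_measurable (lborel \<Otimes>\<^sub>M lborel)"
        by measurable
      then show ?thesis
        by (simp only: lborel_prod)
    qed
    have "AE p in lborel. ?F p = ?H p"
      using AE_pair_lborel[OF ae]
    proof (rule eventually_mono)
      fix p assume p: "(fst p \<in> \<Omega> \<longrightarrow> u (fst p) = u' (fst p)) \<and> (snd p \<in> \<Omega> \<longrightarrow> u (snd p) = u' (snd p))"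
      show "?F p = ?H p"
        using p by (cases p) (auto simp: indicator_def powr_minus divide_inverse)
    qed
    then have FH: "AE p in lebesgue. ?F p = ?H p"
      by (rule AE_completion)
    have FmL: "?F \<in> borel_measurable lebesgue"
      using Fm by (rule measurable_completion)
    have "integral\<^sup>L lborel ?F = integral\<^sup>L lebesgue ?F"
      by (rule integral_completion[OF Fm, symmetric])
    also have "\<dots> = integral\<^sup>L lebesgue ?H"
      by (rule integral_cong_AE[OF FmL borel_measurable_AE[OF FmL FH] FH])
    finally have eq: "integral\<^sup>L lborel ?F = integral\<^sup>L lebesgue ?H" .
    have "0 \<le> regional_laplacian s \<Omega> u \<psi>"
      using assms(10) \<psi> unfolding regional_superharmonic_def by blast
    also have "regional_laplacian s \<Omega> u \<psi> = frac_const TYPE('n) s / 2 * integral\<^sup>L lebesgue ?H"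
      unfolding regional_laplacian_def set_lebesgue_integral_def N' ..
    finally have "0 \<le> frac_const TYPE('n) s / 2 * integral\<^sup>L lborel ?F"
      unfolding eq .
    \<comment> \<open>\<open>s < 1\<close> makes \<open>Gamma (1 - s)\<close> positive, so the sign
      of the pairing is that of the bare double integral.\<close>
    moreover have "0 < frac_const TYPE('n) s"
      unfolding frac_const_def using assms(1,2)
      by (intro divide_pos_pos mult_pos_pos Gamma_real_pos) (auto simp: add_nonneg_pos)
    ultimately have "0 \<le> integral\<^sup>L lborel ?F"
      by (simp add: zero_le_mult_iff)
    then show "0 \<le> integral\<^sup>L (lborel \<Otimes>\<^sub>M lborel) ?F"
      by (simp only: lborel_prod)
  qed
  let ?E = "essinf_on \<Omega> (\<lambda>y. ereal (u y))"
  have "AE x in lebesgue_on \<Omega>. - ereal (u x) \<le> - ?E"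
    unfolding essinf_on_def using esssup_AE[of "\<lambda>x. - ereal (u x)" "lebesgue_on \<Omega>"] by simp
  then have E: "AE x in lborel. x \<in> \<Omega> \<longrightarrow> ?E \<le> ereal (u x)"
    unfolding on_iff by (simp only: ereal_minus_le_minus)
  show ?thesis
  proof (intro exI[of _ S.repr] conjI ballI)
    have "AE x in lborel. x \<in> \<Omega> \<longrightarrow> S.repr x = ereal (u x)"
      using S.repr_AE ae by eventually_elim auto
    then show "AE x in lebesgue_on \<Omega>. S.repr x = ereal (u x)"
      unfolding on_iff .
    show "- \<infinity> < S.repr x" if "x \<in> \<Omega>" for x
      by (rule S.repr_gt_minus_infinity[OF that])
    show "lsc_on \<Omega> S.repr" "locally_bdd_below_on \<Omega> S.repr"
      by (fact S.repr_lsc S.repr_locally_bounded)+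
    fix x assume x: "x \<in> \<Omega>"
    show "?E < S.repr x"
    proof (cases ?E)
      case (real m)
      have "AE x in lborel. x \<in> \<Omega> \<longrightarrow> m \<le> u' x"
        using E ae by eventually_elim (auto simp: real)
      moreover have "\<not> (AE x in lborel. x \<in> \<Omega> \<longrightarrow> u' x = m)"
      proof
        assume "AE x in lborel. x \<in> \<Omega> \<longrightarrow> u' x = m"
        then have "AE x in lborel. x \<in> \<Omega> \<longrightarrow> u x = m"
          using ae by eventually_elim auto
        then show False
          using assms(7) unfolding on_iff by blast
      qed
      ultimately show ?thesis
        unfolding real by (rule S.repr_gt_minimum[OF _ _ x])
    next
      case PInf
      \<comment> \<open>No real value is at least \<open>\<infinity>\<close>, so almost no point
        lies in \<open>\<Omega>\<close>, and any constant contradicts the assumption that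
        \<open>u\<close> is nonconstant.\<close>
      have "AE x in lborel. x \<in> \<Omega> \<longrightarrow> u x = 0"
        using E by (rule eventually_mono) (auto simp: PInf)
      then show ?thesis
        using assms(7) unfolding on_iff by blast
    next
      case MInf
      then show ?thesis
        using S.repr_gt_minus_infinity[OF x] by simp
    qed
  qed
qed

end
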